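(* The construction $\phi\mapsto\phi^*$ is functorial: there is a contravariant functor $$\mathrm{Ref}:\mathsf{FinODAG}\longrightarrow\mathsf{MarCat}$$ sending each object $G$ of $\mathsf{FinODAG}$ to the free Markov category $\mathcal F_m(G)$ and each morphism $\phi:H\to G$ of $\mathsf{FinODAG}$ to the $\phi$-refinement $\phi^*:\mathcal F_m(G)\to\mathcal F_m(H)$.
   Context: **Markov categories.** A Markov category is a symmetric monoidal category with a distinguished cocommutative comonoid structure $\delta_A:A\to A\otimes A$ (duplicate), $\epsilon_A:A\to\mathbf I$ (discard) on every object, compatible with $\otimes$ (i.e. $\delta_{A\otimes B}$ is $\delta_A\otimes\delta_B$ followed by the middle swap and $\epsilon_{A\otimes B}=\epsilon_A\otimes\epsilon_B$, up to coherence), such that discards are natural: $\epsilon_B\circ f=\epsilon_A$ for all $f:A\to B$. A Markov functor is a strong symmetric monoidal functor preserving duplicates and discards (up to its structure isomorphisms). $\mathsf{MarCat}$ is the category of Markov categories and Markov functors. **$\mathsf{FinODAG}$.** Objects: finite directed acyclic graphs $G$ with exactly one loop (the identity loop) added at each vertex (loops do not count as cycles and are not part of directed paths), together with a total ordering $V_G=(v_1,\dots,v_n)$ of the vertices extending the partial order induced by directed paths. Morphisms: graph homomorphisms (arrows may be collapsed to identity loops) that are (weakly) order-preserving on vertices. Parents of $v$ are the vertices $u\ne v$ with an arrow $u\to v$; children are defined similarly. **Variables.** Elements of the free monoid $W(V)$ of words on $V=V_G$ are variables; vertices are atomic variables. A variable is singular if no atomic variable occurs in it more than once. For $X\subseteq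 V$, the variable listing $X$ in the order of $V$ is denoted by $X$ again. $\mathrm{pa}(v)$ is the variable listing the parents of $v$ in the order of $V$. **$\mathcal F_m(G)$.** The free (strict) Markov category over the graph monoid $W(G)$ with vertices $W(V)$ and generating arrows, for each $v\in V$, $\delta_v:v\to vv$ (duplicate), $\epsilon_v:v\to\emptyset$ (discard), $\kappa_v:\mathrm{pa}(v)\to v$ (causal mechanism); identity loops $1_v$ are identities. Thus its monoid of objects is $W(V)$ with concatenation, $\delta_v$ and $\epsilon_v$ are the duplicate and discard on $v$, and for any strict Markov category $\mathcal D$, any assignment of objects of $\mathcal D$ to the vertices and of morphisms of the corresponding type to the $\kappa_v$ extends uniquely to a strict Markov functor $\mathcal F_m(G)\to\mathcal D$. **Causal effects.** For an object $a$, let $\iota_{a\to a^m}:a\to a^{\otimes m}$ be the iterated duplicate ($\epsilon_a$ if $m=0$, $1_a$ if $m=1$). Let $X,Y\subseteq V$. Let $G_{X\to Y}$ be the subgraph of $G$ consisting of all vertices in $X\cup Y$ and all directed paths that end in $Y$ and do not pass through or end in $X$ (starting in $X$ is allowed). For each vertex $i$ of $G_{X\to Y}$ let $c_i$ be the number of children of $i$ in $G_{X\to Y}$, and take the component $\Gamma_i$ to be: $\iota_{i\to i^{c_i+1}}$ if $i\in X\cap Y$; $\iota_{i\to i^{c_i}}$ if $i\in X\setminus Y$; $\iota_{i\to i^{c_i+1}}\circ\kappa_i$ if $i\in Y\setminus X$; $\iota_{i\to i^{c_i}}\circ\kappa_i$ if $i\notin X\cup Y$. Connect one output of $\Gamma_i$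 to the input labelled $i$ of $\Gamma_k$ for each child $k$ of $i$ in $G_{X\to Y}$; the remaining inputs are those of $\Gamma_i$, $i\in X$, and the remaining outputs are one output of $\Gamma_i$ for each $i\in Y$. The resulting string diagram represents a well-defined morphism $[Y\|X]_{(V_G,K_G)}:X\to Y$ in $\mathcal F_m(G)$, the causal effect of $X$ on $Y$, where $K_G=\{\kappa_u:u\in V_G\}$. **Refinement.** Let $\phi:H\to G$ be a morphism in $\mathsf{FinODAG}$. For a variable $v\in W(V_G)$ let $\phi^{-1}(v)\in W(V_H)$ be the concatenation, over the occurrences of atomic variables $w$ in $v$ in order, of the words listing the vertex sets $\phi^{-1}(w)$ in the order of $V_H$. The $\phi$-refinement $\phi^*:\mathcal F_m(G)\to\mathcal F_m(H)$ is the unique strict Markov functor with $\phi^*(v)=\phi^{-1}(v)$ on objects and, for atomic $v$, $\phi^*(1_v)=1_{\phi^{-1}(v)}$, $\phi^*(\epsilon_v)=\epsilon_{\phi^{-1}(v)}$, $\phi^*(\delta_v)=\delta_{\phi^{-1}(v)}$ and $$\phi^*(\kappa_v)=[\phi^{-1}(v)\,\|\,\phi^{-1}(\mathrm{pa}(v))]_{(V_H,K_H)}.$$ *)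

theory Defs
  imports "HOL-Library.FuncSet"
begin

section \<open>Categories\<close>

record ('o, 'a) cat =
  Obj :: "'o set"
  Arr :: "'a set"
  Dom :: "'a \<Rightarrow> 'o"
  Cod :: "'a \<Rightarrow> 'o"
  Ide :: "'o \<Rightarrow> 'a"
  Cmp :: "'a \<Rightarrow> 'a \<Rightarrow> 'a"  (infixr "\<cdot>\<index>" 60)

definition hom :: "('o, 'a, 'm) cat_scheme \<Rightarrow> 'o \<Rightarrow> 'o \<Rightarrow> 'a set" where
  "hom C a b = {f \<in> Arr C. Dom C f = a \<and> Cod C f = b}"

locale category =
  fixes C :: "('o, 'a, 'm) cat_scheme" (structure)
  assumes Dom_in: "f \<in> Arr C \<Longrightarrow> Dom C f \<in> Obj C"
    and Cod_in: "f \<in> Arr C \<Longrightarrow> Cod C f \<in> Obj C"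
    and Ide_in: "a \<in> Obj C \<Longrightarrow> Ide C a \<in> hom C a a"
    and Cmp_in: "\<lbrakk>f \<in> hom C a b; g \<in> hom C b c\<rbrakk> \<Longrightarrow> g \<cdot> f \<in> hom C a c"
    and Ide_left: "f \<in> hom C a b \<Longrightarrow> Ide C b \<cdot> f = f"
    and Ide_right: "f \<in> hom C a b \<Longrightarrow> f \<cdot> Ide C a = f"
    and Cmp_assoc: "\<lbrakk>f \<in> hom C a b; g \<in> hom C b c; h \<in> hom C c d\<rbrakk>
                      \<Longrightarrow> (h \<cdot> g) \<cdot> f = h \<cdot> (g \<cdot> f)"

definition inverse_arrows :: "('o, 'a, 'm) cat_scheme \<Rightarrow> 'a \<Rightarrow> 'a \<Rightarrow> bool" where
  "inverse_arrows C f g \<longleftrightarrow> f \<in> Arr C \<and> g \<in> hom C (Cod C f) (Dom C f)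
     \<and> Cmp C g f = Ide C (Dom C f) \<and> Cmp C f g = Ide C (Cod C f)"

definition is_iso :: "('o, 'a, 'm) cat_scheme \<Rightarrow> 'a \<Rightarrow> bool" where
  "is_iso C f \<longleftrightarrow> (\<exists>g. inverse_arrows C f g)"

definition Inv :: "('o, 'a, 'm) cat_scheme \<Rightarrow> 'a \<Rightarrow> 'a" where
  "Inv C f = (THE g. inverse_arrows C f g)"

locale contravariant_functor = C: category C + D: category D
  for C :: "('o, 'a, 'm) cat_scheme" and D :: "('p, 'b, 'n) cat_scheme" +
  fixes Fo :: "'o \<Rightarrow> 'p" and Fa :: "'a \<Rightarrow> 'b"
  assumes Fo_in: "x \<in> Obj C \<Longrightarrow> Fo x \<in> Obj D"
    and Fa_in: "f \<in> hom C x y \<Longrightarrow> Fa f \<in> hom D (Fo y) (Fo x)"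
    and Fa_Ide: "x \<in> Obj C \<Longrightarrow> Fa (Ide C x) = Ide D (Fo x)"
    and Fa_Cmp: "\<lbrakk>f \<in> hom C x y; g \<in> hom C y z\<rbrakk>
                   \<Longrightarrow> Fa (Cmp C g f) = Cmp D (Fa f) (Fa g)"


section \<open>Markov categories\<close>

record ('o, 'a) markov = "('o, 'a) cat" +
  TensO :: "'o \<Rightarrow> 'o \<Rightarrow> 'o"  (infixr "\<otimes>\<index>" 70)
  TensA :: "'a \<Rightarrow> 'a \<Rightarrow> 'a"  (infixr "\<odot>\<index>" 70)
  Unit :: 'o
  Assoc :: "'o \<Rightarrow> 'o \<Rightarrow> 'o \<Rightarrow> 'a"
  LUnit :: "'o \<Rightarrow> 'a"
  RUnit :: "'o \<Rightarrow> 'a"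
  Swap :: "'o \<Rightarrow> 'o \<Rightarrow> 'a"
  Dup :: "'o \<Rightarrow> 'a"
  Disc :: "'o \<Rightarrow> 'a"

locale symmetric_monoidal_category = category C
  for C :: "('o, 'a, 'm) markov_scheme" (structure) +
  assumes Unit_in: "Unit C \<in> Obj C"
    and TensO_in: "\<lbrakk>a \<in> Obj C; b \<in> Obj C\<rbrakk> \<Longrightarrow> a \<otimes> b \<in> Obj C"
    and TensA_in: "\<lbrakk>f \<in> hom C a b; g \<in> hom C c d\<rbrakk> \<Longrightarrow> f \<odot> g \<in> hom C (a \<otimes> c) (b \<otimes> d)"
    and TensA_Ide: "\<lbrakk>a \<in> Obj C; b \<in> Obj C\<rbrakk> \<Longrightarrow> Ide C a \<odot> Ide C b = Ide C (a \<otimes> b)"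
    and interchange: "\<lbrakk>f \<in> hom C a b; g \<in> hom C b c; f' \<in> hom C a' b'; g' \<in> hom C b' c'\<rbrakk>
            \<Longrightarrow> (g \<cdot> f) \<odot> (g' \<cdot> f') = (g \<odot> g') \<cdot> (f \<odot> f')"
    and Assoc_in: "\<lbrakk>a \<in> Obj C; b \<in> Obj C; c \<in> Obj C\<rbrakk>
            \<Longrightarrow> Assoc C a b c \<in> hom C ((a \<otimes> b) \<otimes> c) (a \<otimes> (b \<otimes> c)) \<and> is_iso C (Assoc C a b c)"
    and LUnit_in: "a \<in> Obj C \<Longrightarrow> LUnit C a \<in> hom C (Unit C \<otimes> a) a \<and> is_iso C (LUnit C a)"
    and RUnit_in: "a \<in> Obj C \<Longrightarrow> RUnit C a \<in> hom C (a \<otimes> Unit C) a \<and> is_iso C (RUnit C a)"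
    and Swap_in: "\<lbrakk>a \<in> Obj C; b \<in> Obj C\<rbrakk> \<Longrightarrow> Swap C a b \<in> hom C (a \<otimes> b) (b \<otimes> a)"
    and Assoc_natural: "\<lbrakk>f \<in> hom C a a'; g \<in> hom C b b'; h \<in> hom C c c'\<rbrakk>
            \<Longrightarrow> Assoc C a' b' c' \<cdot> ((f \<odot> g) \<odot> h) = (f \<odot> (g \<odot> h)) \<cdot> Assoc C a b c"
    and LUnit_natural: "f \<in> hom C a b
            \<Longrightarrow> LUnit C b \<cdot> (Ide C (Unit C) \<odot> f) = f \<cdot> LUnit C a"
    and RUnit_natural: "f \<in> hom C a b
            \<Longrightarrow> RUnit C b \<cdot> (f \<odot> Ide C (Unit C)) = f \<cdot> RUnit C a"
    and Swap_natural: "\<lbrakk>f \<in> hom C a a'; g \<in> hom C b b'\<rbrakk>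
            \<Longrightarrow> Swap C a' b' \<cdot> (f \<odot> g) = (g \<odot> f) \<cdot> Swap C a b"
    and pentagon: "\<lbrakk>a \<in> Obj C; b \<in> Obj C; c \<in> Obj C; d \<in> Obj C\<rbrakk>
            \<Longrightarrow> Assoc C a b (c \<otimes> d) \<cdot> Assoc C (a \<otimes> b) c d
              = (Ide C a \<odot> Assoc C b c d) \<cdot> Assoc C a (b \<otimes> c) d \<cdot> (Assoc C a b c \<odot> Ide C d)"
    and triangle: "\<lbrakk>a \<in> Obj C; b \<in> Obj C\<rbrakk>
            \<Longrightarrow> (Ide C a \<odot> LUnit C b) \<cdot> Assoc C a (Unit C) b = RUnit C a \<odot> Ide C b"
    and hexagon: "\<lbrakk>a \<in> Obj C; b \<in> Obj C; c \<in> Obj C\<rbrakk>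
            \<Longrightarrow> (Ide C b \<odot> Swap C a c) \<cdot> Assoc C b a c \<cdot> (Swap C a b \<odot> Ide C c)
              = Assoc C b c a \<cdot> Swap C a (b \<otimes> c) \<cdot> Assoc C a b c"
    and Swap_Swap: "\<lbrakk>a \<in> Obj C; b \<in> Obj C\<rbrakk> \<Longrightarrow> Swap C b a \<cdot> Swap C a b = Ide C (a \<otimes> b)"

text \<open>The coherence isomorphism \<open>(a \<otimes> a) \<otimes> (b \<otimes> b) \<rightarrow> (a \<otimes> b) \<otimes> (a \<otimes> b)\<close>.\<close>

definition middle_swap :: "('o, 'a, 'm) markov_scheme \<Rightarrow> 'o \<Rightarrow> 'o \<Rightarrow> 'a" where
  "middle_swap C a b =
     Inv C (Assoc C a b (a \<otimes>\<^bsub>C\<^esub> b))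
     \<cdot>\<^bsub>C\<^esub> (Ide C a \<odot>\<^bsub>C\<^esub> (Assoc C b a b \<cdot>\<^bsub>C\<^esub> (Swap C a b \<odot>\<^bsub>C\<^esub> Ide C b) \<cdot>\<^bsub>C\<^esub> Inv C (Assoc C a b b)))
     \<cdot>\<^bsub>C\<^esub> Assoc C a a (b \<otimes>\<^bsub>C\<^esub> b)"

locale markov_category = symmetric_monoidal_category C
  for C :: "('o, 'a, 'm) markov_scheme" (structure) +
  assumes Dup_in: "a \<in> Obj C \<Longrightarrow> Dup C a \<in> hom C a (a \<otimes> a)"
    and Disc_in: "a \<in> Obj C \<Longrightarrow> Disc C a \<in> hom C a (Unit C)"
    and Dup_coassoc: "a \<in> Obj C
            \<Longrightarrow> Assoc C a a a \<cdot> (Dup C a \<odot> Ide C a) \<cdot> Dup C a = (Ide C a \<odot> Dup C a) \<cdot> Dup C a"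
    and Dup_counit_left: "a \<in> Obj C \<Longrightarrow> LUnit C a \<cdot> (Disc C a \<odot> Ide C a) \<cdot> Dup C a = Ide C a"
    and Dup_counit_right: "a \<in> Obj C \<Longrightarrow> RUnit C a \<cdot> (Ide C a \<odot> Disc C a) \<cdot> Dup C a = Ide C a"
    and Dup_cocomm: "a \<in> Obj C \<Longrightarrow> Swap C a a \<cdot> Dup C a = Dup C a"
    and Dup_tens: "\<lbrakk>a \<in> Obj C; b \<in> Obj C\<rbrakk>
            \<Longrightarrow> Dup C (a \<otimes> b) = middle_swap C a b \<cdot> (Dup C a \<odot> Dup C b)"
    and Disc_tens: "\<lbrakk>a \<in> Obj C; b \<in> Obj C\<rbrakk>
            \<Longrightarrow> Disc C (a \<otimes> b) = LUnit C (Unit C) \<cdot> (Disc C a \<odot> Disc C b)"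
    and Disc_natural: "f \<in> hom C a b \<Longrightarrow> Disc C b \<cdot> f = Disc C a"

text \<open>
  A functor carries its source and target, and its structure isomorphisms
  \<open>Mu a b : F a \<otimes> F b \<rightarrow> F (a \<otimes> b)\<close> and \<open>Eta : I \<rightarrow> F I\<close>. The component functions are
  required to be \<open>undefined\<close> off their domains, so that equality of records is equality of functors.
\<close>

record ('o, 'a, 'p, 'b) mfunctor =
  Src :: "('o, 'a) markov"
  Tgt :: "('p, 'b) markov"
  OMap :: "'o \<Rightarrow> 'p"
  AMap :: "'a \<Rightarrow> 'b"
  Mu :: "'o \<Rightarrow> 'o \<Rightarrow> 'b"
  Eta :: 'b

locale markov_functor =
  fixes C :: "('o, 'a) markov"
    and D :: "('p, 'b) markov" (structure)
    and F :: "('o, 'a, 'p, 'b) mfunctor"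
  assumes Src: "Src F = C" and Tgt: "Tgt F = D"
    and markov_C: "markov_category C" and markov_D: "markov_category D"
    and OMap_ext: "OMap F \<in> extensional (Obj C)"
    and AMap_ext: "AMap F \<in> extensional (Arr C)"
    and Mu_ext: "case_prod (Mu F) \<in> extensional (Obj C \<times> Obj C)"
    and OMap_in: "a \<in> Obj C \<Longrightarrow> OMap F a \<in> Obj D"
    and AMap_in: "f \<in> hom C a b \<Longrightarrow> AMap F f \<in> hom D (OMap F a) (OMap F b)"
    and AMap_Ide: "a \<in> Obj C \<Longrightarrow> AMap F (Ide C a) = Ide D (OMap F a)"
    and AMap_Cmp: "\<lbrakk>f \<in> hom C a b; g \<in> hom C b c\<rbrakk>
            \<Longrightarrow> AMap F (g \<cdot>\<^bsub>C\<^esub> f) = AMap F g \<cdot> AMap F f"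
    and Mu_in: "\<lbrakk>a \<in> Obj C; b \<in> Obj C\<rbrakk>
            \<Longrightarrow> Mu F a b \<in> hom D (OMap F a \<otimes> OMap F b) (OMap F (a \<otimes>\<^bsub>C\<^esub> b)) \<and> is_iso D (Mu F a b)"
    and Eta_in: "Eta F \<in> hom D (Unit D) (OMap F (Unit C)) \<and> is_iso D (Eta F)"
    and Mu_natural: "\<lbrakk>f \<in> hom C a a'; g \<in> hom C b b'\<rbrakk>
            \<Longrightarrow> Mu F a' b' \<cdot> (AMap F f \<odot> AMap F g) = AMap F (f \<odot>\<^bsub>C\<^esub> g) \<cdot> Mu F a b"
    and Mu_Assoc: "\<lbrakk>a \<in> Obj C; b \<in> Obj C; c \<in> Obj C\<rbrakk>
            \<Longrightarrow> AMap F (Assoc C a b c) \<cdot> Mu F (a \<otimes>\<^bsub>C\<^esub> b) c \<cdot> (Mu F a b \<odot> Ide D (OMap F c))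
              = Mu F a (b \<otimes>\<^bsub>C\<^esub> c) \<cdot> (Ide D (OMap F a) \<odot> Mu F b c)
                  \<cdot> Assoc D (OMap F a) (OMap F b) (OMap F c)"
    and Mu_LUnit: "a \<in> Obj C
            \<Longrightarrow> AMap F (LUnit C a) \<cdot> Mu F (Unit C) a \<cdot> (Eta F \<odot> Ide D (OMap F a)) = LUnit D (OMap F a)"
    and Mu_RUnit: "a \<in> Obj C
            \<Longrightarrow> AMap F (RUnit C a) \<cdot> Mu F a (Unit C) \<cdot> (Ide D (OMap F a) \<odot> Eta F) = RUnit D (OMap F a)"
    and Mu_Swap: "\<lbrakk>a \<in> Obj C; b \<in> Obj C\<rbrakk>
            \<Longrightarrow> AMap F (Swap C a b) \<cdot> Mu F a b = Mu F b a \<cdot> Swap D (OMap F a) (OMap F b)"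
    and AMap_Dup: "a \<in> Obj C \<Longrightarrow> AMap F (Dup C a) = Mu F a a \<cdot> Dup D (OMap F a)"
    and AMap_Disc: "a \<in> Obj C \<Longrightarrow> AMap F (Disc C a) = Eta F \<cdot> Disc D (OMap F a)"

locale strict_markov_functor = markov_functor +
  assumes OMap_Unit: "OMap F (Unit C) = Unit D"
    and OMap_TensO: "\<lbrakk>a \<in> Obj C; b \<in> Obj C\<rbrakk> \<Longrightarrow> OMap F (a \<otimes>\<^bsub>C\<^esub> b) = OMap F a \<otimes> OMap F b"
    and Mu_strict: "\<lbrakk>a \<in> Obj C; b \<in> Obj C\<rbrakk> \<Longrightarrow> Mu F a b = Ide D (OMap F a \<otimes> OMap F b)"
    and Eta_strict: "Eta F = Ide D (Unit D)"

definition MarCat :: "(('o, 'a) markov, ('o, 'a, 'o, 'a) mfunctor) cat" where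
  "MarCat =
    \<lparr> Obj = {C. markov_category C},
      Arr = {F. markov_functor (Src F) (Tgt F) F},
      Dom = Src,
      Cod = Tgt,
      Ide = (\<lambda>C.
        \<lparr> Src = C, Tgt = C,
          OMap = (\<lambda>a\<in>Obj C. a),
          AMap = (\<lambda>f\<in>Arr C. f),
          Mu = curry (\<lambda>(a, b)\<in>Obj C \<times> Obj C. Ide C (a \<otimes>\<^bsub>C\<^esub> b)),
          Eta = Ide C (Unit C) \<rparr>),
      Cmp = (\<lambda>G F.
        \<lparr> Src = Src F, Tgt = Tgt G,
          OMap = compose (Obj (Src F)) (OMap G) (OMap F),
          AMap = compose (Arr (Src F)) (AMap G) (AMap F),
          Mu = curry (\<lambda>(a, b)\<in>Obj (Src F) \<times> Obj (Src F).
                 AMap G (Mu F a b) \<cdot>\<^bsub>Tgt G\<^esub> Mu G (OMap F a) (OMap F b)),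
          Eta = AMap G (Eta F) \<cdot>\<^bsub>Tgt G\<^esub> Eta G \<rparr>) \<rparr>"


section \<open>Finite ordered directed acyclic graphs\<close>

text \<open>The list \<open>verts\<close> is the totally ordered vertex set; \<open>arcs\<close> contains the identity loops.\<close>

record 'v odag =
  verts :: "'v list"
  arcs :: "('v \<times> 'v) set"

definition proper_arcs :: "'v odag \<Rightarrow> ('v \<times> 'v) set" where
  "proper_arcs G = {(u, v) \<in> arcs G. u \<noteq> v}"

definition vle :: "'v odag \<Rightarrow> 'v \<Rightarrow> 'v \<Rightarrow> bool" where
  "vle G u v \<longleftrightarrow> (\<exists>i j. i \<le> j \<and> j < length (verts G) \<and> verts G ! i = u \<and> verts G ! j = v)"

definition odag :: "'v odag \<Rightarrow> bool" where
  "odag G \<longleftrightarrow> distinct (verts G)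
     \<and> arcs G \<subseteq> set (verts G) \<times> set (verts G)
     \<and> (\<forall>v\<in>set (verts G). (v, v) \<in> arcs G)
     \<and> acyclic (proper_arcs G)
     \<and> (\<forall>u v. (u, v) \<in> (proper_arcs G)\<^sup>+ \<longrightarrow> vle G u v)"

record 'v odag_mor =
  osrc :: "'v odag"
  otgt :: "'v odag"
  vmap :: "'v \<Rightarrow> 'v"

definition odag_mor :: "'v odag_mor \<Rightarrow> bool" where
  "odag_mor \<phi> \<longleftrightarrow> odag (osrc \<phi>) \<and> odag (otgt \<phi>)
     \<and> vmap \<phi> \<in> set (verts (osrc \<phi>)) \<rightarrow>\<^sub>E set (verts (otgt \<phi>))
     \<and> (\<forall>u v. (u, v) \<in> arcs (osrc \<phi>) \<longrightarrow> (vmap \<phi> u, vmap \<phi> v) \<in> arcs (otgt \<phi>))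
     \<and> (\<forall>u v. vle (osrc \<phi>) u v \<longrightarrow> vle (otgt \<phi>) (vmap \<phi> u) (vmap \<phi> v))"

definition FinODAG :: "('v odag, 'v odag_mor) cat" where
  "FinODAG =
    \<lparr> Obj = {G. odag G},
      Arr = {\<phi>. odag_mor \<phi>},
      Dom = osrc,
      Cod = otgt,
      Ide = (\<lambda>G. \<lparr> osrc = G, otgt = G, vmap = (\<lambda>v\<in>set (verts G). v) \<rparr>),
      Cmp = (\<lambda>\<psi> \<phi>. \<lparr> osrc = osrc \<phi>, otgt = otgt \<psi>,
                     vmap = compose (set (verts (osrc \<phi>))) (vmap \<psi>) (vmap \<phi>) \<rparr>) \<rparr>"

definition listing :: "'v odag \<Rightarrow> 'v set \<Rightarrow> 'v list" where
  "listing G X = filter (\<lambda>v. v \<in> X) (verts G)"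

definition parents :: "'v odag \<Rightarrow> 'v \<Rightarrow> 'v set" where
  "parents G v = {u. (u, v) \<in> proper_arcs G}"

definition pa :: "'v odag \<Rightarrow> 'v \<Rightarrow> 'v list" where
  "pa G v = listing G (parents G v)"


section \<open>The free strict Markov category of an ordered graph\<close>

text \<open>
  Arrows are terms in the operations of a strict Markov category over the generators \<open>Mech v\<close>
  (the causal mechanism \<open>pa v \<rightarrow> v\<close>), modulo the congruence generated by the axioms of strict
  Markov categories. \<open>Seq t s\<close> stands for \<open>t\<close> after \<open>s\<close>. Swaps, duplicates and discards are present
  at all words; the axioms reduce them to those at single vertices.
\<close>

datatype 'v mterm =
    Idn "'v list"
  | Braid "'v list" "'v list"
  | Copy "'v list"
  | Delete "'v list"
  | Mech 'v
  | Seq "'v mterm" "'v mterm"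
  | Par "'v mterm" "'v mterm"

primrec tdom :: "'v odag \<Rightarrow> 'v mterm \<Rightarrow> 'v list" where
  "tdom G (Idn a) = a"
| "tdom G (Braid a b) = a @ b"
| "tdom G (Copy a) = a"
| "tdom G (Delete a) = a"
| "tdom G (Mech v) = pa G v"
| "tdom G (Seq t s) = tdom G s"
| "tdom G (Par s t) = tdom G s @ tdom G t"

primrec tcod :: "'v odag \<Rightarrow> 'v mterm \<Rightarrow> 'v list" where
  "tcod G (Idn a) = a"
| "tcod G (Braid a b) = b @ a"
| "tcod G (Copy a) = a @ a"
| "tcod G (Delete a) = []"
| "tcod G (Mech v) = [v]"
| "tcod G (Seq t s) = tcod G t"
| "tcod G (Par s t) = tcod G s @ tcod G t"

primrec wt :: "'v odag \<Rightarrow> 'v mterm \<Rightarrow> bool" where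
  "wt G (Idn a) \<longleftrightarrow> a \<in> lists (set (verts G))"
| "wt G (Braid a b) \<longleftrightarrow> a \<in> lists (set (verts G)) \<and> b \<in> lists (set (verts G))"
| "wt G (Copy a) \<longleftrightarrow> a \<in> lists (set (verts G))"
| "wt G (Delete a) \<longleftrightarrow> a \<in> lists (set (verts G))"
| "wt G (Mech v) \<longleftrightarrow> v \<in> set (verts G)"
| "wt G (Seq t s) \<longleftrightarrow> wt G t \<and> wt G s \<and> tcod G s = tdom G t"
| "wt G (Par s t) \<longleftrightarrow> wt G s \<and> wt G t"

inductive meq :: "'v odag \<Rightarrow> 'v mterm \<Rightarrow> 'v mterm \<Rightarrow> bool" for G where
  refl: "wt G t \<Longrightarrow> meq G t t"
| sym: "meq G s t \<Longrightarrow> meq G t s"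
| trans: "\<lbrakk>meq G s t; meq G t u\<rbrakk> \<Longrightarrow> meq G s u"
| Seq_cong: "\<lbrakk>meq G s s'; meq G t t'; wt G (Seq t s)\<rbrakk> \<Longrightarrow> meq G (Seq t s) (Seq t' s')"
| Par_cong: "\<lbrakk>meq G s s'; meq G t t'\<rbrakk> \<Longrightarrow> meq G (Par s t) (Par s' t')"
| Id_left: "wt G t \<Longrightarrow> meq G (Seq (Idn (tcod G t)) t) t"
| Id_right: "wt G t \<Longrightarrow> meq G (Seq t (Idn (tdom G t))) t"
| Seq_assoc: "wt G (Seq u (Seq t s)) \<Longrightarrow> meq G (Seq (Seq u t) s) (Seq u (Seq t s))"
| Par_Id: "wt G (Par (Idn a) (Idn b)) \<Longrightarrow> meq G (Par (Idn a) (Idn b)) (Idn (a @ b))"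
| Par_Seq: "\<lbrakk>wt G (Seq t s); wt G (Seq t' s')\<rbrakk>
              \<Longrightarrow> meq G (Par (Seq t s) (Seq t' s')) (Seq (Par t t') (Par s s'))"
| Par_assoc: "\<lbrakk>wt G s; wt G t; wt G u\<rbrakk> \<Longrightarrow> meq G (Par (Par s t) u) (Par s (Par t u))"
| Par_unit_left: "wt G t \<Longrightarrow> meq G (Par (Idn []) t) t"
| Par_unit_right: "wt G t \<Longrightarrow> meq G (Par t (Idn [])) t"
| Braid_natural: "\<lbrakk>wt G s; wt G t\<rbrakk>
    \<Longrightarrow> meq G (Seq (Braid (tcod G s) (tcod G t)) (Par s t)) (Seq (Par t s) (Braid (tdom G s) (tdom G t)))"
| Braid_hexagon: "\<lbrakk>wt G (Idn a); wt G (Idn b); wt G (Idn c)\<rbrakk>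
    \<Longrightarrow> meq G (Braid a (b @ c)) (Seq (Par (Idn b) (Braid a c)) (Par (Braid a b) (Idn c)))"
| Braid_Braid: "\<lbrakk>wt G (Idn a); wt G (Idn b)\<rbrakk> \<Longrightarrow> meq G (Seq (Braid b a) (Braid a b)) (Idn (a @ b))"
| Copy_coassoc: "wt G (Idn a)
    \<Longrightarrow> meq G (Seq (Par (Copy a) (Idn a)) (Copy a)) (Seq (Par (Idn a) (Copy a)) (Copy a))"
| Copy_counit_left: "wt G (Idn a) \<Longrightarrow> meq G (Seq (Par (Delete a) (Idn a)) (Copy a)) (Idn a)"
| Copy_counit_right: "wt G (Idn a) \<Longrightarrow> meq G (Seq (Par (Idn a) (Delete a)) (Copy a)) (Idn a)"
| Copy_cocomm: "wt G (Idn a) \<Longrightarrow> meq G (Seq (Braid a a) (Copy a)) (Copy a)"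
| Copy_append: "\<lbrakk>wt G (Idn a); wt G (Idn b)\<rbrakk>
    \<Longrightarrow> meq G (Copy (a @ b)) (Seq (Par (Idn a) (Par (Braid a b) (Idn b))) (Par (Copy a) (Copy b)))"
| Delete_append: "\<lbrakk>wt G (Idn a); wt G (Idn b)\<rbrakk> \<Longrightarrow> meq G (Delete (a @ b)) (Par (Delete a) (Delete b))"
| Delete_natural: "wt G t \<Longrightarrow> meq G (Seq (Delete (tcod G t)) t) (Delete (tdom G t))"

definition cls :: "'v odag \<Rightarrow> 'v mterm \<Rightarrow> 'v mterm set" where
  "cls G t = {s. meq G t s}"

definition Fm :: "'v odag \<Rightarrow> ('v list, 'v mterm set) markov" where
  "Fm G =
    \<lparr> Obj = lists (set (verts G)),
      Arr = {cls G t |t. wt G t},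
      Dom = (\<lambda>f. the_elem (tdom G ` f)),
      Cod = (\<lambda>f. the_elem (tcod G ` f)),
      Ide = (\<lambda>a. cls G (Idn a)),
      Cmp = (\<lambda>g f. {u. \<exists>t\<in>g. \<exists>s\<in>f. meq G (Seq t s) u}),
      TensO = (@),
      TensA = (\<lambda>f g. {u. \<exists>s\<in>f. \<exists>t\<in>g. meq G (Par s t) u}),
      Unit = [],
      Assoc = (\<lambda>a b c. cls G (Idn (a @ b @ c))),
      LUnit = (\<lambda>a. cls G (Idn a)),
      RUnit = (\<lambda>a. cls G (Idn a)),
      Swap = (\<lambda>a b. cls G (Braid a b)),
      Dup = (\<lambda>a. cls G (Copy a)),
      Disc = (\<lambda>a. cls G (Delete a)) \<rparr>"

definition kappa :: "'v odag \<Rightarrow> 'v \<Rightarrow> 'v mterm set" where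
  "kappa G v = cls G (Mech v)"


section \<open>String diagrams and causal effects\<close>

text \<open>
  The operations of this section are meant for strict Markov categories, and omit all coherence
  isomorphisms. Wires carry pairwise distinct names \<open>'w\<close>; \<open>ty\<close> gives the object on a wire.
\<close>

definition wires_obj :: "('o, 'a) markov \<Rightarrow> ('w \<Rightarrow> 'o) \<Rightarrow> 'w list \<Rightarrow> 'o" where
  "wires_obj C ty ws = foldr (\<lambda>w a. ty w \<otimes>\<^bsub>C\<^esub> a) ws (Unit C)"

text \<open>
  The symmetry \<open>ws \<rightarrow> ws'\<close> for a permutation \<open>ws'\<close> of the list of distinct wires \<open>ws\<close>:
  the first wire of \<open>ws'\<close> is swapped to the front, then the others are permuted.
\<close>

fun permute_wires :: "('o, 'a) markov \<Rightarrow> ('w \<Rightarrow> 'o) \<Rightarrow> 'w list \<Rightarrow> 'w list \<Rightarrow> 'a" where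
  "permute_wires C ty ws [] = Ide C (wires_obj C ty ws)"
| "permute_wires C ty ws (w # ws') =
     (let as = takeWhile (\<lambda>x. x \<noteq> w) ws; bs = tl (dropWhile (\<lambda>x. x \<noteq> w) ws) in
        (Ide C (ty w) \<odot>\<^bsub>C\<^esub> permute_wires C ty (as @ bs) ws')
        \<cdot>\<^bsub>C\<^esub> (Swap C (wires_obj C ty as) (ty w) \<odot>\<^bsub>C\<^esub> Ide C (wires_obj C ty bs)))"

text \<open>
  A component is given by its input wires, its arrow and its output wires. The morphism represented
  by a diagram is computed by applying the components one after the other, each one to the
  wires carrying its inputs and with identities on all other wires present. The components must be
  listed so that each wire is produced before it is consumed; the value does not depend on
  the choice of such a listing.
\<close>

fun diagram :: "('o, 'a) markov \<Rightarrow> ('w \<Rightarrow> 'o) \<Rightarrow> 'w list \<Rightarrow> ('w list \<times> 'a \<times> 'w list) list \<Rightarrow> 'w list \<Rightarrow> 'a" where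
  "diagram C ty ws [] outs = permute_wires C ty ws outs"
| "diagram C ty ws ((is, f, os) # cs) outs =
     (let rest = filter (\<lambda>w. w \<notin> set is) ws in
        diagram C ty (os @ rest) cs outs
        \<cdot>\<^bsub>C\<^esub> (f \<odot>\<^bsub>C\<^esub> Ide C (wires_obj C ty rest))
        \<cdot>\<^bsub>C\<^esub> permute_wires C ty ws (is @ rest))"

fun iterated_dup :: "('o, 'a) markov \<Rightarrow> 'o \<Rightarrow> nat \<Rightarrow> 'a" where
  "iterated_dup C a 0 = Disc C a"
| "iterated_dup C a (Suc 0) = Ide C a"
| "iterated_dup C a (Suc (Suc m)) = (Ide C a \<odot>\<^bsub>C\<^esub> iterated_dup C a (Suc m)) \<cdot>\<^bsub>C\<^esub> Dup C a"

text \<open>The directed paths that end in \<open>Y\<close> and meet \<open>X\<close> at most in their starting vertex.\<close>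

definition effect_path :: "'v odag \<Rightarrow> 'v set \<Rightarrow> 'v set \<Rightarrow> 'v list \<Rightarrow> bool" where
  "effect_path G X Y p \<longleftrightarrow> p \<noteq> [] \<and> successively (\<lambda>u v. (u, v) \<in> proper_arcs G) p
     \<and> last p \<in> Y \<and> set (tl p) \<inter> X = {}"

definition effect_verts :: "'v odag \<Rightarrow> 'v set \<Rightarrow> 'v set \<Rightarrow> 'v set" where
  "effect_verts G X Y = X \<union> Y \<union> \<Union> {set p |p. effect_path G X Y p}"

definition effect_arcs :: "'v odag \<Rightarrow> 'v set \<Rightarrow> 'v set \<Rightarrow> ('v \<times> 'v) set" where
  "effect_arcs G X Y = \<Union> {set (zip p (tl p)) |p. effect_path G X Y p}"

definition effect_children :: "'v odag \<Rightarrow> 'v set \<Rightarrow> 'v set \<Rightarrow> 'v \<Rightarrow> 'v list" where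
  "effect_children G X Y i = listing G {k. (i, k) \<in> effect_arcs G X Y}"

text \<open>
  \<open>In i\<close> and \<open>Out i\<close> are the external input and output of the component of \<open>i\<close>;
  \<open>Edge i k\<close> leads from an output of the component of \<open>i\<close> to the input labelled \<open>i\<close> of that of \<open>k\<close>.
\<close>

datatype 'v wire = In 'v | Edge 'v 'v | Out 'v

primrec wire_ty :: "'v wire \<Rightarrow> 'v list" where
  "wire_ty (In i) = [i]"
| "wire_ty (Edge i k) = [i]"
| "wire_ty (Out i) = [i]"

definition Gamma :: "'v odag \<Rightarrow> 'v set \<Rightarrow> 'v set \<Rightarrow> 'v \<Rightarrow> 'v mterm set" where
  "Gamma G X Y i =
     (let \<iota> = iterated_dup (Fm G) [i]; c = length (effect_children G X Y i) in
      if i \<in> X \<inter> Y then \<iota> (c + 1)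
      else if i \<in> X - Y then \<iota> c
      else if i \<in> Y - X then \<iota> (c + 1) \<cdot>\<^bsub>Fm G\<^esub> kappa G i
      else \<iota> c \<cdot>\<^bsub>Fm G\<^esub> kappa G i)"

definition component :: "'v odag \<Rightarrow> 'v set \<Rightarrow> 'v set \<Rightarrow> 'v \<Rightarrow> 'v wire list \<times> 'v mterm set \<times> 'v wire list" where
  "component G X Y i =
     (if i \<in> X then [In i] else map (\<lambda>p. Edge p i) (pa G i),
      Gamma G X Y i,
      map (Edge i) (effect_children G X Y i) @ (if i \<in> Y then [Out i] else []))"

text \<open>\<open>causal_effect G Y X\<close> is \<open>[Y || X]\<close>, an arrow from \<open>X\<close> to \<open>Y\<close>.\<close>

definition causal_effect :: "'v odag \<Rightarrow> 'v set \<Rightarrow> 'v set \<Rightarrow> 'v mterm set" where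
  "causal_effect G Y X =
     diagram (Fm G) wire_ty (map In (listing G X))
       (map (component G X Y) (listing G (effect_verts G X Y)))
       (map Out (listing G Y))"


section \<open>Refinement\<close>

definition fibre :: "'v odag_mor \<Rightarrow> 'v set \<Rightarrow> 'v set" where
  "fibre \<phi> X = {u \<in> set (verts (osrc \<phi>)). vmap \<phi> u \<in> X}"

definition preimage_word :: "'v odag_mor \<Rightarrow> 'v list \<Rightarrow> 'v list" where
  "preimage_word \<phi> a = concat (map (\<lambda>v. listing (osrc \<phi>) (fibre \<phi> {v})) a)"

definition refines :: "'v odag_mor \<Rightarrow> ('v list, 'v mterm set, 'v list, 'v mterm set) mfunctor \<Rightarrow> bool" where
  "refines \<phi> F \<longleftrightarrow>
     (let G = otgt \<phi>; H = osrc \<phi> in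
       strict_markov_functor (Fm G) (Fm H) F
       \<and> (\<forall>a \<in> Obj (Fm G). OMap F a = preimage_word \<phi> a)
       \<and> (\<forall>v \<in> set (verts G).
            AMap F (Ide (Fm G) [v]) = Ide (Fm H) (preimage_word \<phi> [v])
          \<and> AMap F (Disc (Fm G) [v]) = Disc (Fm H) (preimage_word \<phi> [v])
          \<and> AMap F (Dup (Fm G) [v]) = Dup (Fm H) (preimage_word \<phi> [v])
          \<and> AMap F (kappa G v) = causal_effect H (fibre \<phi> {v}) (fibre \<phi> (parents G v))))"

definition is_refinement :: "'v odag_mor \<Rightarrow> ('v list, 'v mterm set, 'v list, 'v mterm set) mfunctor \<Rightarrow> bool" where
  "is_refinement \<phi> F \<longleftrightarrow> refines \<phi> F \<and> (\<forall>F'. refines \<phi> F' \<longrightarrow> F' = F)"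

end

theory Submission
  imports Defs
begin

text \<open>
  A refinement is determined by its values on generators and exists because every axiom of strict
  Markov categories is mapped to an instance of itself, so functoriality reduces to
  \<open>\<phi>\<^sup>* [Y || X] = [\<phi>\<^sup>-\<^sup>1 Y || \<phi>\<^sup>-\<^sup>1 X]\<close>. To compare such diagrams, they are evaluated in a normal form:
  starting from the inputs, the mechanisms are run in order, each one reading copies of earlier
  values, while all values are kept; at the end the values of \<open>Y\<close> are selected. Every intermediate
  stage of a string diagram is a selection from the values kept so far, which absorbs all
  permutations, copies and deletions of wires. In this form, replacing a vertex by its fibre inserts
  a block of consecutive runs, since a causal effect from the preimage of the parents runs through
  exactly the fibre. The two sides then differ only in mechanisms whose values are
  not used, and these are removed by naturality of discarding.
\<close>

section \<open>Categories and Markov functors\<close>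

text \<open>The obstacle is that mechanisms do not commute with copying: running one and copying its
  value differs from running it twice. Composites therefore cannot be treated as tuples of
  functions; only selections of wires may be moved through copies. This forces a form in which each
  mechanism occurs once and all copying is left to selections.

  Selections address values by letter, so the words standing for different vertices must be disjoint
  and free of repetition. For a refinement these words are fibres of a map, whence the disjointness.

  One evaluation lemma is proved for strict functors out of \<open>Fm G\<close> and instantiated
  twice, at the refinement and at the identity functor of \<open>Fm H\<close>, so that both sides
  become runs in \<open>Fm H\<close>. They differ because a directed path of \<open>G\<close> need
  not lift to \<open>H\<close>: the preimage of the graph of a causal effect may contain vertices
  from which no admissible path leads to the preimage of \<open>Y\<close>. Monotonicity on vertices
  enters where fibres are concatenated: it makes the resulting word the listing of the preimage in
  the order of \<open>H\<close>.\<close>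

context category
begin

lemma arr_hom: "f \<in> Arr C \<Longrightarrow> f \<in> hom C (Dom C f) (Cod C f)"
  by (simp add: hom_def)

text \<open>Axioms stated with hom-sets leave objects to be guessed by the simplifier. Here, as in
  many lemmas ending in \<open>_arr\<close>, domains and codomains are computed from the arrows, so
  that typing becomes a side condition solved by rewriting.\<close>

lemma Cmp_arr:
  assumes "f \<in> Arr C" "g \<in> Arr C" "Dom C g = Cod C f"
  shows "g \<cdot> f \<in> Arr C" "Dom C (g \<cdot> f) = Dom C f" "Cod C (g \<cdot> f) = Cod C g"
  using Cmp_in[of f "Dom C f" "Cod C f" g "Cod C g"] assms by (auto simp: hom_def)

lemma Ide_arr:
  assumes "a \<in> Obj C"
  shows "Ide C a \<in> Arr C" "Dom C (Ide C a) = a" "Cod C (Ide C a) = a"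
  using Ide_in[OF assms] by (auto simp: hom_def)

lemma assoc_arr:
  "\<lbrakk>f \<in> Arr C; g \<in> Arr C; h \<in> Arr C; Dom C g = Cod C f; Dom C h = Cod C g\<rbrakk>
    \<Longrightarrow> (h \<cdot> g) \<cdot> f = h \<cdot> g \<cdot> f"
  by (rule Cmp_assoc[OF arr_hom]) (auto simp: hom_def)

lemma Ide_left_arr: "\<lbrakk>f \<in> Arr C; Cod C f = b\<rbrakk> \<Longrightarrow> Ide C b \<cdot> f = f"
  using Ide_left[OF arr_hom, of f] by simp

lemma Ide_right_arr: "\<lbrakk>f \<in> Arr C; Dom C f = a\<rbrakk> \<Longrightarrow> f \<cdot> Ide C a = f"
  using Ide_right[OF arr_hom, of f] by simp

lemmas cat_simps = Dom_in Cod_in Cmp_arr Ide_arr assoc_arr Ide_left_arr Ide_right_arr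

text \<open>Composites are rewritten to right-associated form, where \<open>g \<cdot> f\<close> is
  no longer a subterm of \<open>g \<cdot> f \<cdot> h\<close>. This form of the equation still
  applies there.\<close>

lemma Cmp_reassoc:
  assumes "g \<cdot> f = k" "f \<in> Arr C" "g \<in> Arr C" "h \<in> Arr C" "Dom C g = Cod C f" "Dom C f = Cod C h"
  shows "g \<cdot> f \<cdot> h = k \<cdot> h"
  using assms by (metis assoc_arr)

lemma inverse_arrows_unique:
  assumes "inverse_arrows C f g" "inverse_arrows C f h" shows "g = h"
proof -
  have "g = (h \<cdot> f) \<cdot> g"
    using assms by (simp add: inverse_arrows_def hom_def Ide_left_arr)
  also have "\<dots> = h \<cdot> f \<cdot> g"
    using assms by (intro assoc_arr) (auto simp: inverse_arrows_def hom_def)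
  also have "\<dots> = h"
    using assms by (simp add: inverse_arrows_def hom_def Ide_right_arr)
  finally show ?thesis .
qed

lemma Inv_eq: "inverse_arrows C f g \<Longrightarrow> Inv C f = g"
  unfolding Inv_def by (rule the_equality) (auto intro: inverse_arrows_unique)

lemma inverse_arrows_Ide: "a \<in> Obj C \<Longrightarrow> inverse_arrows C (Ide C a) (Ide C a)"
  by (simp add: inverse_arrows_def hom_def cat_simps)

lemma is_iso_Ide: "a \<in> Obj C \<Longrightarrow> is_iso C (Ide C a)"
  unfolding is_iso_def using inverse_arrows_Ide by auto

lemma is_iso_Cmp:
  assumes "is_iso C f" "is_iso C g" "Dom C g = Cod C f"
  shows "is_iso C (g \<cdot> f)"
proof -
  obtain f' g' where f': "inverse_arrows C f f'" and g': "inverse_arrows C g g'"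
    using assms by (auto simp: is_iso_def)
  then have t: "f \<in> Arr C" "f' \<in> Arr C" "Dom C f' = Cod C f" "Cod C f' = Dom C f"
     "g \<in> Arr C" "g' \<in> Arr C" "Dom C g' = Cod C g" "Cod C g' = Dom C g"
    "f' \<cdot> f = Ide C (Dom C f)" "f \<cdot> f' = Ide C (Cod C f)"
    "g' \<cdot> g = Ide C (Dom C g)" "g \<cdot> g' = Ide C (Cod C g)"
    by (auto simp: inverse_arrows_def hom_def)
  have "(f' \<cdot> g') \<cdot> (g \<cdot> f) = f' \<cdot> ((g' \<cdot> g) \<cdot> f)"
    using t(1-8) assms(3) by (simp add: cat_simps)
  also have "\<dots> = Ide C (Dom C f)"
    using t assms(3) by (simp add: Ide_left_arr)
  finally have 1: "(f' \<cdot> g') \<cdot> (g \<cdot> f) = Ide C (Dom C f)" .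
  have "(g \<cdot> f) \<cdot> (f' \<cdot> g') = g \<cdot> ((f \<cdot> f') \<cdot> g')"
    using t(1-8) assms(3) by (simp add: cat_simps)
  also have "\<dots> = Ide C (Cod C g)"
    using t assms(3) by (simp add: Ide_left_arr)
  finally have 2: "(g \<cdot> f) \<cdot> (f' \<cdot> g') = Ide C (Cod C g)" .
  have "inverse_arrows C (g \<cdot> f) (f' \<cdot> g')"
    using t(1-8) assms(3) 1 2 by (simp add: inverse_arrows_def hom_def Cmp_arr)
  then show ?thesis by (auto simp: is_iso_def)
qed

end

lemma (in symmetric_monoidal_category) TensA_arr:
  assumes "f \<in> Arr C" "g \<in> Arr C"
  shows "f \<odot> g \<in> Arr C" "Dom C (f \<odot> g) = Dom C f \<otimes> Dom C g" "Cod C (f \<odot> g) = Cod C f \<otimes> Cod C g"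
  using TensA_in[OF arr_hom arr_hom, of f g] assms by (auto simp: hom_def)

lemma (in symmetric_monoidal_category) interchange_arr:
  "\<lbrakk>f \<in> Arr C; g \<in> Arr C; f' \<in> Arr C; g' \<in> Arr C; Dom C g = Cod C f; Dom C g' = Cod C f'\<rbrakk>
    \<Longrightarrow> (g \<odot> g') \<cdot> (f \<odot> f') = (g \<cdot> f) \<odot> (g' \<cdot> f')"
  by (rule interchange[symmetric, OF arr_hom _ arr_hom]) (auto simp: hom_def)

context markov_functor
begin

sublocale C: markov_category C by (rule markov_C)
sublocale D: markov_category D by (rule markov_D)

lemma AMap_arr:
  assumes "f \<in> Arr C"
  shows "AMap F f \<in> Arr D" "Dom D (AMap F f) = OMap F (Dom C f)" "Cod D (AMap F f) = OMap F (Cod C f)"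
  using AMap_in[OF C.arr_hom, OF assms] by (auto simp: hom_def)

lemma AMap_Cmp_arr:
  "\<lbrakk>f \<in> Arr C; g \<in> Arr C; Dom C g = Cod C f\<rbrakk> \<Longrightarrow> AMap F (g \<cdot>\<^bsub>C\<^esub> f) = AMap F g \<cdot> AMap F f"
  by (rule AMap_Cmp[OF C.arr_hom]) (auto simp: hom_def)

lemma Mu_arr:
  assumes "a \<in> Obj C" "b \<in> Obj C"
  shows "Mu F a b \<in> Arr D" "Dom D (Mu F a b) = OMap F a \<otimes> OMap F b"
    "Cod D (Mu F a b) = OMap F (a \<otimes>\<^bsub>C\<^esub> b)" "is_iso D (Mu F a b)"
  using Mu_in[OF assms] by (auto simp: hom_def)

lemma Eta_arr:
  "Eta F \<in> Arr D" "Dom D (Eta F) = Unit D" "Cod D (Eta F) = OMap F (Unit C)" "is_iso D (Eta F)"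
  using Eta_in by (auto simp: hom_def)

lemma Mu_natural_arr:
  "\<lbrakk>f \<in> Arr C; g \<in> Arr C; a' = Cod C f; b' = Cod C g\<rbrakk>
    \<Longrightarrow> Mu F a' b' \<cdot> (AMap F f \<odot> AMap F g) = AMap F (f \<odot>\<^bsub>C\<^esub> g) \<cdot> Mu F (Dom C f) (Dom C g)"
  using Mu_natural[OF C.arr_hom C.arr_hom, of f g] by simp

lemma AMap_is_iso:
  assumes "is_iso C f" shows "is_iso D (AMap F f)"
proof -
  obtain g where "inverse_arrows C f g" using assms by (auto simp: is_iso_def)
  then have t: "f \<in> Arr C" "g \<in> Arr C" "Dom C g = Cod C f" "Cod C g = Dom C f"
    "g \<cdot>\<^bsub>C\<^esub> f = Ide C (Dom C f)" "f \<cdot>\<^bsub>C\<^esub> g = Ide C (Cod C f)"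
    by (auto simp: inverse_arrows_def hom_def)
  then have "AMap F g \<cdot> AMap F f = Ide D (OMap F (Dom C f))"
    "AMap F f \<cdot> AMap F g = Ide D (OMap F (Cod C f))"
    using AMap_Cmp_arr[of f g] AMap_Cmp_arr[of g f] by (simp_all add: AMap_Ide C.Dom_in C.Cod_in)
  then have "inverse_arrows D (AMap F f) (AMap F g)"
    using t by (simp add: inverse_arrows_def hom_def AMap_arr)
  then show ?thesis by (auto simp: is_iso_def)
qed

end

lemma markov_arrs:
  assumes "markov_category C" "a \<in> Obj C"
  shows "Dup C a \<in> Arr C" "Dom C (Dup C a) = a" "Cod C (Dup C a) = a \<otimes>\<^bsub>C\<^esub> a"
    "Disc C a \<in> Arr C" "Dom C (Disc C a) = a" "Cod C (Disc C a) = Unit C"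
    "LUnit C a \<in> Arr C" "Dom C (LUnit C a) = Unit C \<otimes>\<^bsub>C\<^esub> a" "Cod C (LUnit C a) = a"
    "RUnit C a \<in> Arr C" "Dom C (RUnit C a) = a \<otimes>\<^bsub>C\<^esub> Unit C" "Cod C (RUnit C a) = a"
proof -
  interpret markov_category C by fact
  show "Dup C a \<in> Arr C" "Dom C (Dup C a) = a" "Cod C (Dup C a) = a \<otimes>\<^bsub>C\<^esub> a"
    "Disc C a \<in> Arr C" "Dom C (Disc C a) = a" "Cod C (Disc C a) = Unit C"
    "LUnit C a \<in> Arr C" "Dom C (LUnit C a) = Unit C \<otimes>\<^bsub>C\<^esub> a" "Cod C (LUnit C a) = a"
    "RUnit C a \<in> Arr C" "Dom C (RUnit C a) = a \<otimes>\<^bsub>C\<^esub> Unit C" "Cod C (RUnit C a) = a"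
    using Dup_in[of a] Disc_in[of a] LUnit_in[of a] RUnit_in[of a] assms(2) by (auto simp: hom_def)
qed

lemma symmetric_arrs:
  assumes "markov_category C" "a \<in> Obj C" "b \<in> Obj C"
  shows "Swap C a b \<in> Arr C" "Dom C (Swap C a b) = a \<otimes>\<^bsub>C\<^esub> b" "Cod C (Swap C a b) = b \<otimes>\<^bsub>C\<^esub> a"
  and "c \<in> Obj C \<Longrightarrow> Assoc C a b c \<in> Arr C"
      "c \<in> Obj C \<Longrightarrow> Dom C (Assoc C a b c) = (a \<otimes>\<^bsub>C\<^esub> b) \<otimes>\<^bsub>C\<^esub> c"
      "c \<in> Obj C \<Longrightarrow> Cod C (Assoc C a b c) = a \<otimes>\<^bsub>C\<^esub> (b \<otimes>\<^bsub>C\<^esub> c)"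
proof -
  interpret markov_category C by fact
  show "Swap C a b \<in> Arr C" "Dom C (Swap C a b) = a \<otimes>\<^bsub>C\<^esub> b" "Cod C (Swap C a b) = b \<otimes>\<^bsub>C\<^esub> a"
    using Swap_in[of a b] assms(2,3) by (auto simp: hom_def)
  show "c \<in> Obj C \<Longrightarrow> Assoc C a b c \<in> Arr C"
      "c \<in> Obj C \<Longrightarrow> Dom C (Assoc C a b c) = (a \<otimes>\<^bsub>C\<^esub> b) \<otimes>\<^bsub>C\<^esub> c"
      "c \<in> Obj C \<Longrightarrow> Cod C (Assoc C a b c) = a \<otimes>\<^bsub>C\<^esub> (b \<otimes>\<^bsub>C\<^esub> c)"
    using Assoc_in[of a b c] assms(2,3) by (auto simp: hom_def)
qed

section \<open>The category of Markov categories and Markov functors\<close>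

lemma MarCat_simps [simp]:
  "Obj MarCat = {C. markov_category C}" "Arr MarCat = {F. markov_functor (Src F) (Tgt F) F}"
  "Dom MarCat = Src" "Cod MarCat = Tgt"
  by (simp_all add: MarCat_def)

lemma Ide_MarCat_simps [simp]:
  "Src (Ide MarCat C) = C" "Tgt (Ide MarCat C) = C" "OMap (Ide MarCat C) = (\<lambda>a\<in>Obj C. a)"
  "AMap (Ide MarCat C) = (\<lambda>f\<in>Arr C. f)"
  "Mu (Ide MarCat C) = curry (\<lambda>(a, b)\<in>Obj C \<times> Obj C. Ide C (a \<otimes>\<^bsub>C\<^esub> b))"
  "Eta (Ide MarCat C) = Ide C (Unit C)"
  by (simp_all add: MarCat_def)

lemma Cmp_MarCat_simps [simp]:
  "Src (Cmp MarCat G F) = Src F" "Tgt (Cmp MarCat G F) = Tgt G"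
  "OMap (Cmp MarCat G F) = compose (Obj (Src F)) (OMap G) (OMap F)"
  "AMap (Cmp MarCat G F) = compose (Arr (Src F)) (AMap G) (AMap F)"
  "Mu (Cmp MarCat G F) = curry (\<lambda>(a, b)\<in>Obj (Src F) \<times> Obj (Src F).
                 AMap G (Mu F a b) \<cdot>\<^bsub>Tgt G\<^esub> Mu G (OMap F a) (OMap F b))"
  "Eta (Cmp MarCat G F) = AMap G (Eta F) \<cdot>\<^bsub>Tgt G\<^esub> Eta G"
  by (simp_all add: MarCat_def)

lemma markov_functor_Ide:
  assumes "markov_category C" shows "markov_functor C C (Ide MarCat C)"
proof -
  interpret markov_category C by fact
  note ar = cat_simps TensA_arr TensO_in Unit_in TensA_Ide markov_arrs[OF assms] symmetric_arrs[OF assms]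
  show ?thesis
    by unfold_locales (simp_all add: hom_def ar is_iso_Ide curry_def extensional_def)
qed

text \<open>Each coherence law for the composite has three sources: naturality moves the structure
  maps of \<open>G\<close> past images of structure maps of \<open>F\<close>, then
  \<open>AMap G\<close> is applied to the law for \<open>F\<close>, and what remains is the law for
  \<open>G\<close>.\<close>

lemma markov_functor_Cmp:
  assumes "markov_functor C D F" "markov_functor D E G"
  shows "markov_functor C E (Cmp MarCat G F)"
proof -
  interpret F: markov_functor C D F by fact
  interpret G: markov_functor D E G by fact
  note [simp] = F.Src F.Tgt G.Src G.Tgt F.OMap_in G.OMap_in
    F.AMap_arr G.AMap_arr F.AMap_Ide G.AMap_Ide F.AMap_Cmp_arr G.AMap_Cmp_arr
    F.Mu_arr G.Mu_arr F.Eta_arr G.Eta_arr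
    F.C.cat_simps F.D.cat_simps G.D.cat_simps
    F.C.TensA_arr F.D.TensA_arr G.D.TensA_arr
    F.C.TensO_in F.D.TensO_in G.D.TensO_in F.C.Unit_in F.D.Unit_in G.D.Unit_in
    F.C.TensA_Ide F.D.TensA_Ide G.D.TensA_Ide
    markov_arrs[OF F.markov_C] markov_arrs[OF G.markov_C] markov_arrs[OF G.markov_D]
    symmetric_arrs[OF F.markov_C] symmetric_arrs[OF G.markov_C] symmetric_arrs[OF G.markov_D]
    G.AMap_is_iso
  note [simp] = curry_def compose_def
  show ?thesis
  proof unfold_locales
    show "OMap (Cmp MarCat G F) \<in> extensional (Obj C)" by (simp add: extensional_def)
    show "AMap (Cmp MarCat G F) \<in> extensional (Arr C)" by (simp add: extensional_def)
    show "case_prod (Mu (Cmp MarCat G F)) \<in> extensional (Obj C \<times> Obj C)"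
      by (simp add: extensional_def)
    fix a a' b b' f g assume f: "f \<in> hom C a a'" and g: "g \<in> hom C b b'"
    have [simp]: "f \<in> Arr C" "Dom C f = a" "Cod C f = a'" "g \<in> Arr C" "Dom C g = b" "Cod C g = b'"
      using f g by (auto simp: hom_def)
    have [simp]: "a \<in> Obj C" "a' \<in> Obj C" "b \<in> Obj C" "b' \<in> Obj C"
      using F.C.Dom_in[of f] F.C.Cod_in[of f] F.C.Dom_in[of g] F.C.Cod_in[of g] by simp_all
    have 1: "Mu G (OMap F a') (OMap F b') \<cdot>\<^bsub>E\<^esub> (AMap G (AMap F f) \<odot>\<^bsub>E\<^esub> AMap G (AMap F g))
       = AMap G (AMap F f \<odot>\<^bsub>D\<^esub> AMap F g) \<cdot>\<^bsub>E\<^esub> Mu G (OMap F a) (OMap F b)"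
      by (subst G.Mu_natural_arr) simp_all
    have "Mu F a' b' \<cdot>\<^bsub>D\<^esub> (AMap F f \<odot>\<^bsub>D\<^esub> AMap F g) = AMap F (f \<odot>\<^bsub>C\<^esub> g) \<cdot>\<^bsub>D\<^esub> Mu F a b"
      using F.Mu_natural[OF f g] .
    from arg_cong[OF this, of "AMap G"]
    have 2: "AMap G (Mu F a' b') \<cdot>\<^bsub>E\<^esub> AMap G (AMap F f \<odot>\<^bsub>D\<^esub> AMap F g)
        = AMap G (AMap F (f \<odot>\<^bsub>C\<^esub> g)) \<cdot>\<^bsub>E\<^esub> AMap G (Mu F a b)" by simp
    show "Mu (Cmp MarCat G F) a' b' \<cdot>\<^bsub>E\<^esub> (AMap (Cmp MarCat G F) f \<odot>\<^bsub>E\<^esub> AMap (Cmp MarCat G F) g)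
      = AMap (Cmp MarCat G F) (f \<odot>\<^bsub>C\<^esub> g) \<cdot>\<^bsub>E\<^esub> Mu (Cmp MarCat G F) a b"
      by (simp add: 1 G.D.Cmp_reassoc[OF 2])
  next
    fix a b c assume [simp]: "a \<in> Obj C" "b \<in> Obj C" "c \<in> Obj C"
    let ?M = "Mu (Cmp MarCat G F)"
    have 0: "(AMap G (Mu F a b) \<cdot>\<^bsub>E\<^esub> Mu G (OMap F a) (OMap F b)) \<odot>\<^bsub>E\<^esub> Ide E (OMap G (OMap F c))
       = (AMap G (Mu F a b) \<odot>\<^bsub>E\<^esub> AMap G (Ide D (OMap F c))) \<cdot>\<^bsub>E\<^esub>
         (Mu G (OMap F a) (OMap F b) \<odot>\<^bsub>E\<^esub> Ide E (OMap G (OMap F c)))"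
      by (subst G.D.interchange_arr) simp_all
    have 1: "Mu G (OMap F (a \<otimes>\<^bsub>C\<^esub> b)) (OMap F c) \<cdot>\<^bsub>E\<^esub> (AMap G (Mu F a b) \<odot>\<^bsub>E\<^esub> AMap G (Ide D (OMap F c)))
       = AMap G (Mu F a b \<odot>\<^bsub>D\<^esub> Ide D (OMap F c)) \<cdot>\<^bsub>E\<^esub> Mu G (OMap F a \<otimes>\<^bsub>D\<^esub> OMap F b) (OMap F c)"
      by (subst G.Mu_natural_arr) (simp_all del: G.AMap_Ide)
    from arg_cong[OF F.Mu_Assoc[of a b c], of "AMap G"]
    have 2: "AMap G (AMap F (Assoc C a b c)) \<cdot>\<^bsub>E\<^esub> AMap G (Mu F (a \<otimes>\<^bsub>C\<^esub> b) c)
        \<cdot>\<^bsub>E\<^esub> AMap G (Mu F a b \<odot>\<^bsub>D\<^esub> Ide D (OMap F c)) =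
       AMap G (Mu F a (b \<otimes>\<^bsub>C\<^esub> c)) \<cdot>\<^bsub>E\<^esub> AMap G (Ide D (OMap F a) \<odot>\<^bsub>D\<^esub> Mu F b c)
         \<cdot>\<^bsub>E\<^esub> AMap G (Assoc D (OMap F a) (OMap F b) (OMap F c))" by simp
    have 3: "AMap G (Assoc D (OMap F a) (OMap F b) (OMap F c)) \<cdot>\<^bsub>E\<^esub> Mu G (OMap F a \<otimes>\<^bsub>D\<^esub> OMap F b) (OMap F c)
         \<cdot>\<^bsub>E\<^esub> (Mu G (OMap F a) (OMap F b) \<odot>\<^bsub>E\<^esub> Ide E (OMap G (OMap F c)))
       = Mu G (OMap F a) (OMap F b \<otimes>\<^bsub>D\<^esub> OMap F c) \<cdot>\<^bsub>E\<^esub> (Ide E (OMap G (OMap F a)) \<odot>\<^bsub>E\<^esub> Mu G (OMap F b) (OMap F c))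
         \<cdot>\<^bsub>E\<^esub> Assoc E (OMap G (OMap F a)) (OMap G (OMap F b)) (OMap G (OMap F c))"
      by (rule G.Mu_Assoc) simp_all
    have 4: "Mu G (OMap F a) (OMap F (b \<otimes>\<^bsub>C\<^esub> c)) \<cdot>\<^bsub>E\<^esub> (AMap G (Ide D (OMap F a)) \<odot>\<^bsub>E\<^esub> AMap G (Mu F b c))
       = AMap G (Ide D (OMap F a) \<odot>\<^bsub>D\<^esub> Mu F b c) \<cdot>\<^bsub>E\<^esub> Mu G (OMap F a) (OMap F b \<otimes>\<^bsub>D\<^esub> OMap F c)"
      by (subst G.Mu_natural_arr) (simp_all del: G.AMap_Ide)
    have 5: "Ide E (OMap G (OMap F a)) \<odot>\<^bsub>E\<^esub> (AMap G (Mu F b c) \<cdot>\<^bsub>E\<^esub> Mu G (OMap F b) (OMap F c))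
      = (AMap G (Ide D (OMap F a)) \<odot>\<^bsub>E\<^esub> AMap G (Mu F b c)) \<cdot>\<^bsub>E\<^esub>
        (Ide E (OMap G (OMap F a)) \<odot>\<^bsub>E\<^esub> Mu G (OMap F b) (OMap F c))"
      by (subst G.D.interchange_arr) simp_all
    let ?r = "Mu G (OMap F a \<otimes>\<^bsub>D\<^esub> OMap F b) (OMap F c)
         \<cdot>\<^bsub>E\<^esub> (Mu G (OMap F a) (OMap F b) \<odot>\<^bsub>E\<^esub> Ide E (OMap G (OMap F c)))"
    have "AMap (Cmp MarCat G F) (Assoc C a b c) \<cdot>\<^bsub>E\<^esub> ?M (a \<otimes>\<^bsub>C\<^esub> b) c
         \<cdot>\<^bsub>E\<^esub> (?M a b \<odot>\<^bsub>E\<^esub> Ide E (OMap (Cmp MarCat G F) c))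
      = AMap G (AMap F (Assoc C a b c)) \<cdot>\<^bsub>E\<^esub> AMap G (Mu F (a \<otimes>\<^bsub>C\<^esub> b) c)
        \<cdot>\<^bsub>E\<^esub> AMap G (Mu F a b \<odot>\<^bsub>D\<^esub> Ide D (OMap F c)) \<cdot>\<^bsub>E\<^esub> ?r"
      using 0 G.D.Cmp_reassoc[OF 1] by simp
    also have "\<dots> = (AMap G (AMap F (Assoc C a b c)) \<cdot>\<^bsub>E\<^esub> AMap G (Mu F (a \<otimes>\<^bsub>C\<^esub> b) c)
        \<cdot>\<^bsub>E\<^esub> AMap G (Mu F a b \<odot>\<^bsub>D\<^esub> Ide D (OMap F c))) \<cdot>\<^bsub>E\<^esub> ?r" by simp
    also have "\<dots> = AMap G (Mu F a (b \<otimes>\<^bsub>C\<^esub> c)) \<cdot>\<^bsub>E\<^esub> AMap G (Ide D (OMap F a) \<odot>\<^bsub>D\<^esub> Mu F b c)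
         \<cdot>\<^bsub>E\<^esub> AMap G (Assoc D (OMap F a) (OMap F b) (OMap F c)) \<cdot>\<^bsub>E\<^esub> ?r"
      unfolding 2 by simp
    also have "\<dots> = ?M a (b \<otimes>\<^bsub>C\<^esub> c) \<cdot>\<^bsub>E\<^esub> (Ide E (OMap (Cmp MarCat G F) a) \<odot>\<^bsub>E\<^esub> ?M b c)
         \<cdot>\<^bsub>E\<^esub> Assoc E (OMap (Cmp MarCat G F) a) (OMap (Cmp MarCat G F) b) (OMap (Cmp MarCat G F) c)"
      unfolding 3 using 5 G.D.Cmp_reassoc[OF 4] by simp
    finally show "AMap (Cmp MarCat G F) (Assoc C a b c) \<cdot>\<^bsub>E\<^esub> ?M (a \<otimes>\<^bsub>C\<^esub> b) c
         \<cdot>\<^bsub>E\<^esub> (?M a b \<odot>\<^bsub>E\<^esub> Ide E (OMap (Cmp MarCat G F) c))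
       = ?M a (b \<otimes>\<^bsub>C\<^esub> c) \<cdot>\<^bsub>E\<^esub> (Ide E (OMap (Cmp MarCat G F) a) \<odot>\<^bsub>E\<^esub> ?M b c)
         \<cdot>\<^bsub>E\<^esub> Assoc E (OMap (Cmp MarCat G F) a) (OMap (Cmp MarCat G F) b) (OMap (Cmp MarCat G F) c)" .
  next
    fix a assume [simp]: "a \<in> Obj C"
    let ?a = "OMap F a"
    have 0: "(AMap G (Eta F) \<cdot>\<^bsub>E\<^esub> Eta G) \<odot>\<^bsub>E\<^esub> Ide E (OMap G ?a)
      = (AMap G (Eta F) \<odot>\<^bsub>E\<^esub> AMap G (Ide D ?a)) \<cdot>\<^bsub>E\<^esub> (Eta G \<odot>\<^bsub>E\<^esub> Ide E (OMap G ?a))"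
      by (subst G.D.interchange_arr) simp_all
    have 1: "Mu G (OMap F (Unit C)) ?a \<cdot>\<^bsub>E\<^esub> (AMap G (Eta F) \<odot>\<^bsub>E\<^esub> AMap G (Ide D ?a))
      = AMap G (Eta F \<odot>\<^bsub>D\<^esub> Ide D ?a) \<cdot>\<^bsub>E\<^esub> Mu G (Unit D) ?a"
      by (subst G.Mu_natural_arr) (simp_all del: G.AMap_Ide)
    from arg_cong[OF F.Mu_LUnit[of a], of "AMap G"]
    have 2: "(AMap G (AMap F (LUnit C a)) \<cdot>\<^bsub>E\<^esub> AMap G (Mu F (Unit C) a) \<cdot>\<^bsub>E\<^esub> AMap G (Eta F \<odot>\<^bsub>D\<^esub> Ide D ?a))
      = AMap G (LUnit D ?a)" by simp
    have "AMap G (AMap F (LUnit C a)) \<cdot>\<^bsub>E\<^esub> AMap G (Mu F (Unit C) a) \<cdot>\<^bsub>E\<^esub> AMap G (Eta F \<odot>\<^bsub>D\<^esub> Ide D ?a)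
       \<cdot>\<^bsub>E\<^esub> Mu G (Unit D) ?a \<cdot>\<^bsub>E\<^esub> (Eta G \<odot>\<^bsub>E\<^esub> Ide E (OMap G ?a))
      = AMap G (LUnit D ?a) \<cdot>\<^bsub>E\<^esub> Mu G (Unit D) ?a \<cdot>\<^bsub>E\<^esub> (Eta G \<odot>\<^bsub>E\<^esub> Ide E (OMap G ?a))"
      unfolding 2[symmetric] by simp
    also have "\<dots> = LUnit E (OMap G ?a)" by (rule G.Mu_LUnit) simp
    finally show "AMap (Cmp MarCat G F) (LUnit C a) \<cdot>\<^bsub>E\<^esub> Mu (Cmp MarCat G F) (Unit C) a
        \<cdot>\<^bsub>E\<^esub> (Eta (Cmp MarCat G F) \<odot>\<^bsub>E\<^esub> Ide E (OMap (Cmp MarCat G F) a))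
       = LUnit E (OMap (Cmp MarCat G F) a)"
      using 0 G.D.Cmp_reassoc[OF 1] by simp
    have 0: "Ide E (OMap G ?a) \<odot>\<^bsub>E\<^esub> (AMap G (Eta F) \<cdot>\<^bsub>E\<^esub> Eta G)
      = (AMap G (Ide D ?a) \<odot>\<^bsub>E\<^esub> AMap G (Eta F)) \<cdot>\<^bsub>E\<^esub> (Ide E (OMap G ?a) \<odot>\<^bsub>E\<^esub> Eta G)"
      by (subst G.D.interchange_arr) simp_all
    have 1: "Mu G ?a (OMap F (Unit C)) \<cdot>\<^bsub>E\<^esub> (AMap G (Ide D ?a) \<odot>\<^bsub>E\<^esub> AMap G (Eta F))
      = AMap G (Ide D ?a \<odot>\<^bsub>D\<^esub> Eta F) \<cdot>\<^bsub>E\<^esub> Mu G ?a (Unit D)"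
      by (subst G.Mu_natural_arr) (simp_all del: G.AMap_Ide)
    from arg_cong[OF F.Mu_RUnit[of a], of "AMap G"]
    have 2: "(AMap G (AMap F (RUnit C a)) \<cdot>\<^bsub>E\<^esub> AMap G (Mu F a (Unit C)) \<cdot>\<^bsub>E\<^esub> AMap G (Ide D ?a \<odot>\<^bsub>D\<^esub> Eta F))
      = AMap G (RUnit D ?a)" by simp
    have "AMap G (AMap F (RUnit C a)) \<cdot>\<^bsub>E\<^esub> AMap G (Mu F a (Unit C)) \<cdot>\<^bsub>E\<^esub> AMap G (Ide D ?a \<odot>\<^bsub>D\<^esub> Eta F)
       \<cdot>\<^bsub>E\<^esub> Mu G ?a (Unit D) \<cdot>\<^bsub>E\<^esub> (Ide E (OMap G ?a) \<odot>\<^bsub>E\<^esub> Eta G)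
      = AMap G (RUnit D ?a) \<cdot>\<^bsub>E\<^esub> Mu G ?a (Unit D) \<cdot>\<^bsub>E\<^esub> (Ide E (OMap G ?a) \<odot>\<^bsub>E\<^esub> Eta G)"
      unfolding 2[symmetric] by simp
    also have "\<dots> = RUnit E (OMap G ?a)" by (rule G.Mu_RUnit) simp
    finally show "AMap (Cmp MarCat G F) (RUnit C a) \<cdot>\<^bsub>E\<^esub> Mu (Cmp MarCat G F) a (Unit C)
        \<cdot>\<^bsub>E\<^esub> (Ide E (OMap (Cmp MarCat G F) a) \<odot>\<^bsub>E\<^esub> Eta (Cmp MarCat G F))
       = RUnit E (OMap (Cmp MarCat G F) a)"
      using 0 G.D.Cmp_reassoc[OF 1] by simp
    show "AMap (Cmp MarCat G F) (Dup C a)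
      = Mu (Cmp MarCat G F) a a \<cdot>\<^bsub>E\<^esub> Dup E (OMap (Cmp MarCat G F) a)"
      by (simp add: F.AMap_Dup G.AMap_Dup)
    show "AMap (Cmp MarCat G F) (Disc C a)
      = Eta (Cmp MarCat G F) \<cdot>\<^bsub>E\<^esub> Disc E (OMap (Cmp MarCat G F) a)"
      by (simp add: F.AMap_Disc G.AMap_Disc)
  next
    fix a b assume [simp]: "a \<in> Obj C" "b \<in> Obj C"
    from arg_cong[OF F.Mu_Swap[of a b], of "AMap G"]
    have 2: "AMap G (AMap F (Swap C a b)) \<cdot>\<^bsub>E\<^esub> AMap G (Mu F a b)
      = AMap G (Mu F b a) \<cdot>\<^bsub>E\<^esub> AMap G (Swap D (OMap F a) (OMap F b))" by simp
    show "AMap (Cmp MarCat G F) (Swap C a b) \<cdot>\<^bsub>E\<^esub> Mu (Cmp MarCat G F) a b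
      = Mu (Cmp MarCat G F) b a \<cdot>\<^bsub>E\<^esub> Swap E (OMap (Cmp MarCat G F) a) (OMap (Cmp MarCat G F) b)"
      by (simp add: G.D.Cmp_reassoc[OF 2] G.Mu_Swap)
  qed (simp_all add: hom_def G.D.is_iso_Cmp F.markov_C G.markov_D)
qed

lemma category_MarCat: "category (MarCat :: (('o, 'a) markov, ('o, 'a, 'o, 'a) mfunctor) cat)"
proof
  show "Dom MarCat F \<in> Obj MarCat" "Cod MarCat F \<in> Obj MarCat" if "F \<in> Arr MarCat"
    for F :: "('o, 'a, 'o, 'a) mfunctor"
    using that by (auto simp: markov_functor_def)
  show "Ide MarCat C \<in> hom MarCat C C" if "C \<in> Obj MarCat" for C :: "('o, 'a) markov"
    using that by (simp add: hom_def markov_functor_Ide)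
  fix A B C D :: "('o, 'a) markov" and F G H :: "('o, 'a, 'o, 'a) mfunctor"
  assume F: "F \<in> hom MarCat A B"
  then have sF: "Src F = A" "Tgt F = B" and F: "markov_functor A B F" by (auto simp: hom_def)
  interpret F: markov_functor A B F by fact
  note ext = F.OMap_ext F.AMap_ext F.Mu_ext
  \<comment> \<open>Equality of functor records also compares the component functions off their
    domains, where both sides have the value \<open>undefined\<close>.\<close>
  have ext': "OMap F a = undefined" "Mu F a b = undefined" "Mu F b a = undefined"
    if "a \<notin> Obj A" for a b
    using ext that by (auto simp: extensional_def)
  have ext'': "AMap F f = undefined" if "f \<notin> Arr A" for f
    using ext that by (auto simp: extensional_def)
  show "Cmp MarCat (Ide MarCat B) F = F"
    by (rule mfunctor.equality)
      (auto simp: sF fun_eq_iff compose_def F.Mu_arr F.C.TensO_in F.OMap_in F.AMap_arr ext' ext''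
          F.D.cat_simps F.Eta_arr F.D.Unit_in F.D.TensO_in curry_def)
  show "Cmp MarCat F (Ide MarCat A) = F"
    by (rule mfunctor.equality)
      (auto simp: sF fun_eq_iff compose_def F.Mu_arr F.C.TensO_in F.OMap_in F.AMap_arr ext' ext''
          F.D.cat_simps F.Eta_arr F.D.Unit_in F.AMap_Ide F.C.Unit_in F.D.TensO_in curry_def)
  assume G: "G \<in> hom MarCat B C"
  then have sG: "Src G = B" "Tgt G = C" and G: "markov_functor B C G" by (auto simp: hom_def)
  show "Cmp MarCat G F \<in> hom MarCat A C"
    using markov_functor_Cmp[OF F G] by (simp add: hom_def sF sG)
  assume H: "H \<in> hom MarCat C D"
  then have sH: "Src H = C" "Tgt H = D" and H: "markov_functor C D H" by (auto simp: hom_def)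
  interpret G: markov_functor B C G by fact
  interpret H: markov_functor C D H by fact
  show "Cmp MarCat (Cmp MarCat H G) F = Cmp MarCat H (Cmp MarCat G F)"
    by (rule mfunctor.equality)
      (auto simp: sF sG sH fun_eq_iff compose_def F.Mu_arr G.Mu_arr H.Mu_arr F.OMap_in G.OMap_in
          F.AMap_arr G.AMap_arr H.AMap_arr G.AMap_Cmp_arr H.AMap_Cmp_arr F.C.TensO_in F.D.TensO_in G.D.TensO_in
          H.D.cat_simps F.Eta_arr G.Eta_arr H.Eta_arr G.D.Unit_in curry_def)
qed

section \<open>The free Markov category of an ordered graph\<close>

lemma set_listing [simp]: "set (listing G X) = X \<inter> set (verts G)"
  by (auto simp: listing_def)

lemma set_pa: "set (pa G v) = parents G v \<inter> set (verts G)"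
  by (simp add: pa_def)

lemma wt_lists: "wt G t \<Longrightarrow> tdom G t \<in> lists (set (verts G)) \<and> tcod G t \<in> lists (set (verts G))"
  by (induction t) (auto simp: set_pa)

text \<open>Hence \<open>tdom\<close> and \<open>tcod\<close> are constant on classes, and
  \<open>the_elem\<close> in \<open>Dom\<close> and \<open>Cod\<close> of \<open>Fm\<close> picks
  their only value.\<close>

lemma meq_wt: "meq G s t \<Longrightarrow> wt G s \<and> wt G t \<and> tdom G s = tdom G t \<and> tcod G s = tcod G t"
proof (induction rule: meq.induct)
qed (auto simp: set_pa dest!: wt_lists)

lemma cls_eqI: "meq G s t \<Longrightarrow> cls G s = cls G t"
  by (auto simp: cls_def intro: meq.sym meq.trans)

lemma in_cls: "wt G t \<Longrightarrow> t \<in> cls G t"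
  by (simp add: cls_def meq.refl)

lemma cls_eqD: "cls G s = cls G t \<Longrightarrow> wt G t \<Longrightarrow> meq G s t"
  using in_cls by (fastforce simp: cls_def)

lemma cls_Arr: "wt G t \<Longrightarrow> cls G t \<in> Arr (Fm G)"
  by (auto simp: Fm_def)

lemma cls_Dom: "wt G t \<Longrightarrow> Dom (Fm G) (cls G t) = tdom G t"
proof -
  assume t: "wt G t"
  have "tdom G ` cls G t = {tdom G t}"
    using in_cls[OF t] by (auto simp: cls_def dest: meq_wt)
  then show ?thesis by (simp add: Fm_def)
qed

lemma cls_Cod: "wt G t \<Longrightarrow> Cod (Fm G) (cls G t) = tcod G t"
proof -
  assume t: "wt G t"
  have "tcod G ` cls G t = {tcod G t}"
    using in_cls[OF t] by (auto simp: cls_def dest: meq_wt)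
  then show ?thesis by (simp add: Fm_def)
qed

lemma Fm_ArrE:
  assumes "f \<in> Arr (Fm G)" obtains t where "wt G t" "f = cls G t"
  using assms by (auto simp: Fm_def)

lemma Fm_homE:
  assumes "f \<in> hom (Fm G) a b"
  obtains t where "wt G t" "f = cls G t" "tdom G t = a" "tcod G t = b"
  using assms by (auto simp: hom_def cls_Dom cls_Cod elim!: Fm_ArrE)

lemma cls_hom: "wt G t \<Longrightarrow> cls G t \<in> hom (Fm G) a b \<longleftrightarrow> tdom G t = a \<and> tcod G t = b"
  by (simp add: hom_def cls_Arr cls_Dom cls_Cod)

text \<open>Composition in \<open>Fm\<close> ranges over all representatives of both classes; the
  congruence rules make the result the class of a single term.\<close>

lemma cls_Cmp:
  assumes "wt G (Seq t s)" shows "Cmp (Fm G) (cls G t) (cls G s) = cls G (Seq t s)"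
proof -
  have "meq G (Seq t s) u" if "meq G t t'" "meq G s s'" "meq G (Seq t' s') u" for t' s' u
    using meq.trans[OF meq.Seq_cong[OF that(2,1) assms] that(3)] .
  then show ?thesis
    using assms meq.refl[of G t] meq.refl[of G s] by (auto simp: Fm_def cls_def)
qed

lemma cls_TensA:
  assumes "wt G s" "wt G t" shows "TensA (Fm G) (cls G s) (cls G t) = cls G (Par s t)"
proof -
  have "meq G (Par s t) u" if "meq G t t'" "meq G s s'" "meq G (Par s' t') u" for t' s' u
    using meq.trans[OF meq.Par_cong[OF that(2,1)] that(3)] .
  then show ?thesis
    using assms meq.refl[of G t] meq.refl[of G s] by (auto simp: Fm_def cls_def)
qed

lemma Fm_sel:
  "Obj (Fm G) = lists (set (verts G))" "Ide (Fm G) a = cls G (Idn a)"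
  "TensO (Fm G) = (@)" "Unit (Fm G) = []"
  "Assoc (Fm G) a b c = cls G (Idn (a @ b @ c))" "LUnit (Fm G) a = cls G (Idn a)"
  "RUnit (Fm G) a = cls G (Idn a)" "Swap (Fm G) a b = cls G (Braid a b)"
  "Dup (Fm G) a = cls G (Copy a)" "Disc (Fm G) a = cls G (Delete a)"
  by (simp_all add: Fm_def)

lemma category_Fm: "category (Fm G)"
proof
  show "Dom (Fm G) f \<in> Obj (Fm G)" "Cod (Fm G) f \<in> Obj (Fm G)" if "f \<in> Arr (Fm G)" for f
    using that by (metis Fm_ArrE cls_Dom Fm_sel(1) wt_lists, metis Fm_ArrE cls_Cod Fm_sel(1) wt_lists)
  show "Ide (Fm G) a \<in> hom (Fm G) a a" if "a \<in> Obj (Fm G)" for a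
    using that by (simp add: Fm_sel cls_hom)
  fix f g h and a b c d assume "f \<in> hom (Fm G) a b"
  then obtain t where t: "wt G t" "f = cls G t" "tdom G t = a" "tcod G t = b" by (rule Fm_homE)
  show "Ide (Fm G) b \<cdot>\<^bsub>Fm G\<^esub> f = f" "f \<cdot>\<^bsub>Fm G\<^esub> Ide (Fm G) a = f"
    using t cls_eqI[OF meq.Id_left[OF t(1)]] cls_eqI[OF meq.Id_right[OF t(1)]] wt_lists[OF t(1)]
    by (auto simp: Fm_sel cls_Cmp)
  assume "g \<in> hom (Fm G) b c"
  then obtain s where s: "wt G s" "g = cls G s" "tdom G s = b" "tcod G s = c" by (rule Fm_homE)
  show "g \<cdot>\<^bsub>Fm G\<^esub> f \<in> hom (Fm G) a c" using t s by (simp add: cls_Cmp cls_hom)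
  assume "h \<in> hom (Fm G) c d"
  then obtain u where u: "wt G u" "h = cls G u" "tdom G u = c" "tcod G u = d" by (rule Fm_homE)
  show "(h \<cdot>\<^bsub>Fm G\<^esub> g) \<cdot>\<^bsub>Fm G\<^esub> f = h \<cdot>\<^bsub>Fm G\<^esub> (g \<cdot>\<^bsub>Fm G\<^esub> f)"
    using t s u cls_eqI[OF meq.Seq_assoc[of G u s t]] by (simp add: cls_Cmp)
qed

text \<open>All coherence arrows are classes of identities, so every axiom either becomes trivial or
  turns into one of the generating equations of \<open>meq\<close>.\<close>

lemma symmetric_monoidal_category_Fm: "symmetric_monoidal_category (Fm G)"
proof -
  interpret category "Fm G" by (rule category_Fm)
  note [simp] = cls_hom cls_Cmp cls_TensA Fm_sel cls_Arr cls_Dom cls_Cod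
  have [simp]: "is_iso (Fm G) (cls G (Idn a))" if "a \<in> lists (set (verts G))" for a
    using is_iso_Ide[of a] that by simp
  have [simp]: "cls G (Seq t (Idn a)) = cls G t" if "wt G t" "tdom G t = a" for t a
    using cls_eqI[OF meq.Id_right[OF that(1)]] that(2) by simp
  have [simp]: "cls G (Seq (Idn a) t) = cls G t" if "wt G t" "tcod G t = a" for t a
    using cls_eqI[OF meq.Id_left[OF that(1)]] that(2) by simp
  have [simp]: "cls G (Par (Idn a) (Idn b)) = cls G (Idn (a @ b))"
    if "a \<in> lists (set (verts G))" "b \<in> lists (set (verts G))" for a b
    using cls_eqI[OF meq.Par_Id[of G a b]] that by simp
  show ?thesis
  proof unfold_locales
    fix f g h and a b c a' b' c' assume f: "f \<in> hom (Fm G) a b"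
    obtain t where t: "wt G t" "f = cls G t" "tdom G t = a" "tcod G t = b" using f by (rule Fm_homE)
    note wl = wt_lists[OF t(1), unfolded t(3,4)]
    show "LUnit (Fm G) b \<cdot>\<^bsub>Fm G\<^esub> (Ide (Fm G) (Unit (Fm G)) \<odot>\<^bsub>Fm G\<^esub> f) = f \<cdot>\<^bsub>Fm G\<^esub> LUnit (Fm G) a"
      using t wl cls_eqI[OF meq.Par_unit_left[OF t(1)]] by simp
    show "RUnit (Fm G) b \<cdot>\<^bsub>Fm G\<^esub> (f \<odot>\<^bsub>Fm G\<^esub> Ide (Fm G) (Unit (Fm G))) = f \<cdot>\<^bsub>Fm G\<^esub> RUnit (Fm G) a"
      using t wl cls_eqI[OF meq.Par_unit_right[OF t(1)]] by simp
    { assume "g \<in> hom (Fm G) a' b'"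
      then obtain s where s: "wt G s" "g = cls G s" "tdom G s = a'" "tcod G s = b'" by (rule Fm_homE)
      note ws = wt_lists[OF s(1), unfolded s(3,4)]
      show "f \<odot>\<^bsub>Fm G\<^esub> g \<in> hom (Fm G) (a \<otimes>\<^bsub>Fm G\<^esub> a') (b \<otimes>\<^bsub>Fm G\<^esub> b')" using t s by simp
      show "Swap (Fm G) b b' \<cdot>\<^bsub>Fm G\<^esub> (f \<odot>\<^bsub>Fm G\<^esub> g) = (g \<odot>\<^bsub>Fm G\<^esub> f) \<cdot>\<^bsub>Fm G\<^esub> Swap (Fm G) a a'"
        using t s wl ws cls_eqI[OF meq.Braid_natural[OF t(1) s(1)]] by simp
      assume "h \<in> hom (Fm G) c c'"
      then obtain u where u: "wt G u" "h = cls G u" "tdom G u = c" "tcod G u = c'" by (rule Fm_homE)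
      note wu = wt_lists[OF u(1), unfolded u(3,4)]
      show "Assoc (Fm G) b b' c' \<cdot>\<^bsub>Fm G\<^esub> ((f \<odot>\<^bsub>Fm G\<^esub> g) \<odot>\<^bsub>Fm G\<^esub> h)
         = (f \<odot>\<^bsub>Fm G\<^esub> (g \<odot>\<^bsub>Fm G\<^esub> h)) \<cdot>\<^bsub>Fm G\<^esub> Assoc (Fm G) a a' c"
        using t s u wl ws wu cls_eqI[OF meq.Par_assoc[OF t(1) s(1) u(1)]] by simp }
    { fix f' g' assume "g \<in> hom (Fm G) b c" "f' \<in> hom (Fm G) a' b'" "g' \<in> hom (Fm G) b' c'"
      then show "(g \<cdot>\<^bsub>Fm G\<^esub> f) \<odot>\<^bsub>Fm G\<^esub> (g' \<cdot>\<^bsub>Fm G\<^esub> f') = (g \<odot>\<^bsub>Fm G\<^esub> g') \<cdot>\<^bsub>Fm G\<^esub> (f \<odot>\<^bsub>Fm G\<^esub> f')"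
        using t by (elim Fm_homE) (simp add: cls_eqI[OF meq.Par_Seq]) }
  next
    fix a b c assume "a \<in> Obj (Fm G)" "b \<in> Obj (Fm G)" "c \<in> Obj (Fm G)"
    then show "(Ide (Fm G) b \<odot>\<^bsub>Fm G\<^esub> Swap (Fm G) a c) \<cdot>\<^bsub>Fm G\<^esub> Assoc (Fm G) b a c
        \<cdot>\<^bsub>Fm G\<^esub> (Swap (Fm G) a b \<odot>\<^bsub>Fm G\<^esub> Ide (Fm G) c)
      = Assoc (Fm G) b c a \<cdot>\<^bsub>Fm G\<^esub> Swap (Fm G) a (b \<otimes>\<^bsub>Fm G\<^esub> c) \<cdot>\<^bsub>Fm G\<^esub> Assoc (Fm G) a b c"
      using cls_eqI[OF meq.Braid_hexagon[of G a b c]] by simp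
  next
    fix a b assume "a \<in> Obj (Fm G)" "b \<in> Obj (Fm G)"
    then show "Swap (Fm G) b a \<cdot>\<^bsub>Fm G\<^esub> Swap (Fm G) a b = Ide (Fm G) (a \<otimes>\<^bsub>Fm G\<^esub> b)"
      using cls_eqI[OF meq.Braid_Braid[of G a b]] by simp
  qed simp_all
qed

lemma markov_category_Fm: "markov_category (Fm G)"
proof -
  interpret symmetric_monoidal_category "Fm G" by (rule symmetric_monoidal_category_Fm)
  note sim = cls_hom cls_Cmp cls_TensA Fm_sel cls_Arr cls_Dom cls_Cod
  have id1: "cls G (Seq t (Idn a)) = cls G t" if "wt G t" "tdom G t = a" for t a
    using cls_eqI[OF meq.Id_right[OF that(1)]] that(2) by simp
  have id2: "cls G (Seq (Idn a) t) = cls G t" if "wt G t" "tcod G t = a" for t a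
    using cls_eqI[OF meq.Id_left[OF that(1)]] that(2) by simp
  have inv: "Inv (Fm G) (cls G (Idn a)) = cls G (Idn a)" if "a \<in> lists (set (verts G))" for a
    using Inv_eq[OF inverse_arrows_Ide[of a]] that by (simp add: Fm_sel)
  show ?thesis
  proof unfold_locales
    fix a assume a: "a \<in> Obj (Fm G)"
    then have w: "wt G (Idn a)" by (simp add: sim)
    note a = a[unfolded Fm_sel]
    show "Dup (Fm G) a \<in> hom (Fm G) a (a \<otimes>\<^bsub>Fm G\<^esub> a)" "Disc (Fm G) a \<in> hom (Fm G) a (Unit (Fm G))"
      using a by (simp_all add: sim)
    show "Assoc (Fm G) a a a \<cdot>\<^bsub>Fm G\<^esub> (Dup (Fm G) a \<odot>\<^bsub>Fm G\<^esub> Ide (Fm G) a) \<cdot>\<^bsub>Fm G\<^esub> Dup (Fm G) a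
       = (Ide (Fm G) a \<odot>\<^bsub>Fm G\<^esub> Dup (Fm G) a) \<cdot>\<^bsub>Fm G\<^esub> Dup (Fm G) a"
      using a cls_eqI[OF meq.Copy_coassoc[OF w]] by (simp add: sim id2)
    show "LUnit (Fm G) a \<cdot>\<^bsub>Fm G\<^esub> (Disc (Fm G) a \<odot>\<^bsub>Fm G\<^esub> Ide (Fm G) a) \<cdot>\<^bsub>Fm G\<^esub> Dup (Fm G) a = Ide (Fm G) a"
      using a cls_eqI[OF meq.Copy_counit_left[OF w]] by (simp add: sim id2)
    show "RUnit (Fm G) a \<cdot>\<^bsub>Fm G\<^esub> (Ide (Fm G) a \<odot>\<^bsub>Fm G\<^esub> Disc (Fm G) a) \<cdot>\<^bsub>Fm G\<^esub> Dup (Fm G) a = Ide (Fm G) a"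
      using a cls_eqI[OF meq.Copy_counit_right[OF w]] by (simp add: sim id2)
    show "Swap (Fm G) a a \<cdot>\<^bsub>Fm G\<^esub> Dup (Fm G) a = Dup (Fm G) a"
      using a cls_eqI[OF meq.Copy_cocomm[OF w]] by (simp add: sim)
    fix b assume b: "b \<in> Obj (Fm G)"
    then have wb: "wt G (Idn b)" by (simp add: sim)
    note b = b[unfolded Fm_sel]
    \<comment> \<open>With identities as coherence arrows, only the braid is left of the middle
      swap.\<close>
    have "middle_swap (Fm G) a b = cls G (Par (Idn a) (Par (Braid a b) (Idn b)))"
      using a b by (simp add: middle_swap_def sim inv id1 id2)
    then show "Dup (Fm G) (a \<otimes>\<^bsub>Fm G\<^esub> b) = middle_swap (Fm G) a b \<cdot>\<^bsub>Fm G\<^esub> (Dup (Fm G) a \<odot>\<^bsub>Fm G\<^esub> Dup (Fm G) b)"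
      using a b cls_eqI[OF meq.Copy_append[OF w wb]] by (simp add: sim)
    show "Disc (Fm G) (a \<otimes>\<^bsub>Fm G\<^esub> b) = LUnit (Fm G) (Unit (Fm G)) \<cdot>\<^bsub>Fm G\<^esub> (Disc (Fm G) a \<odot>\<^bsub>Fm G\<^esub> Disc (Fm G) b)"
      using a b cls_eqI[OF meq.Delete_append[OF w wb]] by (simp add: sim id2)
  next
    fix f a b assume "f \<in> hom (Fm G) a b"
    then obtain t where t: "wt G t" "f = cls G t" "tdom G t = a" "tcod G t = b" by (rule Fm_homE)
    then show "Disc (Fm G) b \<cdot>\<^bsub>Fm G\<^esub> f = Disc (Fm G) a"
      using cls_eqI[OF meq.Delete_natural[OF t(1)]] wt_lists[OF t(1)] by (simp add: sim)
  qed
qed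

section \<open>Ordered graphs\<close>

lemma category_FinODAG: "category (FinODAG :: ('v odag, 'v odag_mor) cat)"
proof
  fix f g h :: "'v odag_mor" and A B C D :: "'v odag"
  show "A \<in> Obj FinODAG \<Longrightarrow> Ide FinODAG A \<in> hom FinODAG A A"
    by (auto simp: FinODAG_def hom_def odag_mor_def odag_def vle_def)
  assume f: "f \<in> hom FinODAG A B"
  then have f': "odag_mor f" "osrc f = A" "otgt f = B" by (auto simp: FinODAG_def hom_def)
  then have vf: "vmap f \<in> set (verts A) \<rightarrow>\<^sub>E set (verts B)" by (auto simp: odag_mor_def)
  show "Cmp FinODAG (Ide FinODAG B) f = f" "Cmp FinODAG f (Ide FinODAG A) = f"
    using f' vf by (auto simp: FinODAG_def compose_def fun_eq_iff PiE_def extensional_def Pi_def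
        intro!: odag_mor.equality)
  assume g: "g \<in> hom FinODAG B C"
  then have g': "odag_mor g" "osrc g = B" "otgt g = C" by (auto simp: FinODAG_def hom_def)
  \<comment> \<open>Arcs and the order relate only vertices, and there \<open>compose\<close> agrees
    with plain composition.\<close>
  have in1: "u \<in> set (verts A)" "v \<in> set (verts A)" if "(u, v) \<in> arcs A" for u v
    using f' that by (auto simp: odag_mor_def odag_def)
  have in2: "u \<in> set (verts A)" "v \<in> set (verts A)" if "vle A u v" for u v
    using that by (auto simp: vle_def)
  show "Cmp FinODAG g f \<in> hom FinODAG A C"
    using f' g' by (auto simp: FinODAG_def hom_def odag_mor_def compose_def in1 in2)
  assume h: "h \<in> hom FinODAG C D"
  then have h': "osrc h = C" "otgt h = D" by (auto simp: FinODAG_def hom_def)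
  show "Cmp FinODAG (Cmp FinODAG h g) f = Cmp FinODAG h (Cmp FinODAG g f)"
    using f' g' h' vf by (auto simp: FinODAG_def compose_def fun_eq_iff intro!: odag_mor.equality)
qed (auto simp: FinODAG_def odag_mor_def)

section \<open>Projections in a Markov category of words\<close>

text \<open>Strictness is expressed by coherence arrows that are identities, so the axioms of
  general Markov categories stay applicable. Objects are words, so that a letter can serve as the
  name of a wire.\<close>

locale word_markov = markov_category C
  for C :: "('v list, 'a) markov" (structure) and V :: "'v set" +
  assumes Obj_eq: "Obj C = lists V"
    and TensO_eq: "TensO C = (@)"
    and Unit_eq: "Unit C = []"
    and Assoc_eq: "\<lbrakk>a \<in> Obj C; b \<in> Obj C; c \<in> Obj C\<rbrakk> \<Longrightarrow> Assoc C a b c = Ide C (a @ b @ c)"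
    and LUnit_eq: "a \<in> Obj C \<Longrightarrow> LUnit C a = Ide C a"
    and RUnit_eq: "a \<in> Obj C \<Longrightarrow> RUnit C a = Ide C a"
begin

lemma Obj_iff [simp]: "a \<in> Obj C \<longleftrightarrow> set a \<subseteq> V"
  by (auto simp: Obj_eq)

declare TensO_eq [simp] Unit_eq [simp]

lemma Dom_subset: "f \<in> Arr C \<Longrightarrow> set (Dom C f) \<subseteq> V"
  and Cod_subset: "f \<in> Arr C \<Longrightarrow> set (Cod C f) \<subseteq> V"
  using Dom_in[of f] Cod_in[of f] by simp_all

lemmas [simp] = Dom_subset Cod_subset Cmp_arr Ide_arr assoc_arr Ide_left_arr Ide_right_arr TensA_arr

lemma TensA_Ide_append [simp]: "set a \<subseteq> V \<Longrightarrow> set b \<subseteq> V \<Longrightarrow> Ide C a \<odot> Ide C b = Ide C (a @ b)"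
  using TensA_Ide[of a b] by simp

lemma word_arrs [simp]:
  assumes "set a \<subseteq> V"
  shows "Dup C a \<in> Arr C" "Dom C (Dup C a) = a" "Cod C (Dup C a) = a @ a"
    "Disc C a \<in> Arr C" "Dom C (Disc C a) = a" "Cod C (Disc C a) = []"
  using Dup_in[of a] Disc_in[of a] assms by (simp_all add: hom_def)

lemma Swap_arr [simp]:
  assumes "set a \<subseteq> V" "set b \<subseteq> V"
  shows "Swap C a b \<in> Arr C" "Dom C (Swap C a b) = a @ b" "Cod C (Swap C a b) = b @ a"
  using Swap_in[of a b] assms by (simp_all add: hom_def)

text \<open>This is naturality of the associator, whose components are identities here.\<close>

lemma TensA_assoc [simp]:
  assumes "f \<in> Arr C" "g \<in> Arr C" "h \<in> Arr C" shows "(f \<odot> g) \<odot> h = f \<odot> g \<odot> h"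
  using Assoc_natural[OF arr_hom arr_hom arr_hom, of f g h] assms by (simp add: Assoc_eq)

lemma TensA_Nil [simp]:
  assumes "f \<in> Arr C" shows "Ide C [] \<odot> f = f" "f \<odot> Ide C [] = f"
  using LUnit_natural[OF arr_hom, of f] RUnit_natural[OF arr_hom, of f] assms
  by (simp_all add: LUnit_eq RUnit_eq)

lemma Disc_nat:
  assumes "f \<in> Arr C" "Cod C f = b" shows "Disc C b \<cdot> f = Disc C (Dom C f)"
  using Disc_natural[OF arr_hom, of f] assms by simp

lemma Swap_nat:
  assumes "f \<in> Arr C" "g \<in> Arr C" "a = Cod C f" "b = Cod C g"
  shows "Swap C a b \<cdot> (f \<odot> g) = (g \<odot> f) \<cdot> Swap C (Dom C f) (Dom C g)"
  using Swap_natural[OF arr_hom arr_hom, of f g] assms by simp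

lemma coassoc:
  assumes "set a \<subseteq> V"
  shows "(Dup C a \<odot> Ide C a) \<cdot> Dup C a = (Ide C a \<odot> Dup C a) \<cdot> Dup C a"
  using Dup_coassoc[of a] assms by (simp add: Assoc_eq)

lemma counit:
  assumes "set a \<subseteq> V"
  shows "(Disc C a \<odot> Ide C a) \<cdot> Dup C a = Ide C a" "(Ide C a \<odot> Disc C a) \<cdot> Dup C a = Ide C a"
  using Dup_counit_left[of a] Dup_counit_right[of a] assms by (simp_all add: LUnit_eq RUnit_eq)

lemma cocomm: "set a \<subseteq> V \<Longrightarrow> Swap C a a \<cdot> Dup C a = Dup C a"
  using Dup_cocomm[of a] by simp

text \<open>The counit law at the empty word makes \<open>Disc C [] \<cdot> Dup C []\<close> an
  identity, while naturality of discarding makes it \<open>Disc C []\<close>.\<close>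

lemma Disc_Nil [simp]: "Disc C [] = Ide C []" and Dup_Nil [simp]: "Dup C [] = Ide C []"
proof -
  have 1: "Disc C [] \<cdot> Dup C [] = Ide C []" using counit(1)[of "[]"] by simp
  then show "Disc C [] = Ide C []" using Disc_nat[of "Dup C []" "[]"] by simp
  then show "Dup C [] = Ide C []" using 1 by simp
qed

lemma Disc_append: "set a \<subseteq> V \<Longrightarrow> set b \<subseteq> V \<Longrightarrow> Disc C (a @ b) = Disc C a \<odot> Disc C b"
  using Disc_tens[of a b] by (simp add: LUnit_eq)

lemma Dup_append:
  assumes "set a \<subseteq> V" "set b \<subseteq> V"
  shows "Dup C (a @ b) = (Ide C a \<odot> Swap C a b \<odot> Ide C b) \<cdot> (Dup C a \<odot> Dup C b)"
proof -
  have "Inv C (Ide C c) = Ide C c" if "set c \<subseteq> V" for c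
    using that by (simp add: Inv_eq inverse_arrows_Ide)
  then show ?thesis using Dup_tens[of a b] assms by (simp add: middle_swap_def Assoc_eq)
qed

section \<open>Pairing of arrows, and the arrows that commute with copying\<close>

definition pair :: "'a \<Rightarrow> 'a \<Rightarrow> 'a" where
  "pair f g = (f \<odot> g) \<cdot> Dup C (Dom C f)"

text \<open>These are the deterministic arrows in the usual terminology of Markov categories.
  Mechanisms are not assumed to be among them.\<close>

definition copyable :: "'a \<Rightarrow> bool" where
  "copyable f \<longleftrightarrow> f \<in> Arr C \<and> Dup C (Cod C f) \<cdot> f = (f \<odot> f) \<cdot> Dup C (Dom C f)"

lemma pair_arr [simp]:
  assumes "f \<in> Arr C" "g \<in> Arr C" "Dom C g = Dom C f"
  shows "pair f g \<in> Arr C" "Dom C (pair f g) = Dom C f" "Cod C (pair f g) = Cod C f @ Cod C g"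
  using assms by (simp_all add: pair_def)

lemma TensA_pair:
  assumes "f \<in> Arr C" "g \<in> Arr C" "Dom C g = Dom C f" "f' \<in> Arr C" "g' \<in> Arr C"
    "Dom C f' = Cod C f" "Dom C g' = Cod C g"
  shows "(f' \<odot> g') \<cdot> pair f g = pair (f' \<cdot> f) (g' \<cdot> g)"
proof -
  have "(f' \<odot> g') \<cdot> pair f g = ((f' \<odot> g') \<cdot> (f \<odot> g)) \<cdot> Dup C (Dom C f)"
    using assms by (simp add: pair_def)
  also have "(f' \<odot> g') \<cdot> (f \<odot> g) = (f' \<cdot> f) \<odot> (g' \<cdot> g)"
    using assms by (simp add: interchange_arr)
  finally show ?thesis using assms by (simp add: pair_def)
qed

text \<open>Copying the output of \<open>h\<close> agrees with copying its input and applying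
  \<open>h\<close> twice because \<open>h\<close> is copyable. This is how selections, which are
  copyable, get inside a pair.\<close>

lemma pair_Cmp:
  assumes "f \<in> Arr C" "g \<in> Arr C" "Dom C g = Dom C f" "copyable h" "Cod C h = Dom C f"
  shows "pair f g \<cdot> h = pair (f \<cdot> h) (g \<cdot> h)"
proof -
  have h: "h \<in> Arr C" using assms(4) by (simp add: copyable_def)
  have "pair f g \<cdot> h = (f \<odot> g) \<cdot> (Dup C (Cod C h) \<cdot> h)"
    using assms h by (simp add: pair_def)
  also have "\<dots> = ((f \<odot> g) \<cdot> (h \<odot> h)) \<cdot> Dup C (Dom C h)"
    using assms h by (simp add: copyable_def)
  also have "(f \<odot> g) \<cdot> (h \<odot> h) = (f \<cdot> h) \<odot> (g \<cdot> h)"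
    using assms h by (simp add: interchange_arr)
  finally show ?thesis using assms h by (simp add: pair_def)
qed

lemma pair_assoc:
  assumes "f \<in> Arr C" "g \<in> Arr C" "h \<in> Arr C" "Dom C g = Dom C f" "Dom C h = Dom C f"
  shows "pair (pair f g) h = pair f (pair g h)"
proof -
  let ?a = "Dom C f"
  have "pair (pair f g) h = ((f \<odot> g) \<odot> h) \<cdot> pair (Dup C ?a) (Ide C ?a)"
    using assms by (subst TensA_pair) (simp_all add: pair_def)
  also have "pair (Dup C ?a) (Ide C ?a) = pair (Ide C ?a) (Dup C ?a)"
    using assms by (simp add: pair_def coassoc)
  also have "((f \<odot> g) \<odot> h) \<cdot> pair (Ide C ?a) (Dup C ?a) = (f \<odot> (g \<odot> h)) \<cdot> pair (Ide C ?a) (Dup C ?a)"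
    using assms by simp
  also have "\<dots> = pair f (pair g h)"
    using assms by (subst TensA_pair) (simp_all add: pair_def)
  finally show ?thesis .
qed

lemma Swap_pair:
  assumes "f \<in> Arr C" "g \<in> Arr C" "Dom C g = Dom C f" "b = Cod C f" "c = Cod C g"
  shows "Swap C b c \<cdot> pair f g = pair g f"
proof -
  let ?a = "Dom C f"
  have "Swap C b c \<cdot> pair f g = (Swap C b c \<cdot> (f \<odot> g)) \<cdot> Dup C ?a"
    using assms by (simp add: pair_def)
  also have "\<dots> = (g \<odot> f) \<cdot> Swap C ?a ?a \<cdot> Dup C ?a"
    using assms by (simp add: Swap_nat)
  also have "\<dots> = pair g f" using assms by (simp add: cocomm pair_def)
  finally show ?thesis .
qed

lemma pair_Disc:
  assumes "f \<in> Arr C" "Dom C f = a"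
  shows "pair (Disc C a) f = f" "pair f (Disc C a) = f"
proof -
  have a: "set a \<subseteq> V" using assms Dom_subset[of f] by simp
  have "pair (Disc C a) f = (Ide C [] \<odot> f) \<cdot> pair (Disc C a) (Ide C a)"
    using assms a by (subst TensA_pair) simp_all
  then show "pair (Disc C a) f = f" using assms a by (simp add: pair_def counit)
  have "pair f (Disc C a) = (f \<odot> Ide C []) \<cdot> pair (Ide C a) (Disc C a)"
    using assms a by (subst TensA_pair) simp_all
  then show "pair f (Disc C a) = f" using assms a by (simp add: pair_def counit)
qed

text \<open>The middle swap of \<open>Dup C (a @ b)\<close> acts on the two inner factors, and
  exactly these are discarded. Naturality of discarding absorbs the swap, and the counit laws finish
  on each side.\<close>

lemma pair_projections:
  assumes "set a \<subseteq> V" "set b \<subseteq> V"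
  shows "pair (Ide C a \<odot> Disc C b) (Disc C a \<odot> Ide C b) = Ide C (a @ b)"
proof -
  have "pair (Ide C a \<odot> Disc C b) (Disc C a \<odot> Ide C b)
      = ((Ide C a \<odot> (Disc C b \<odot> Disc C a) \<odot> Ide C b) \<cdot> (Ide C a \<odot> Swap C a b \<odot> Ide C b)) \<cdot> (Dup C a \<odot> Dup C b)"
    using assms by (simp add: pair_def Dup_append)
  also have "(Ide C a \<odot> (Disc C b \<odot> Disc C a) \<odot> Ide C b) \<cdot> (Ide C a \<odot> Swap C a b \<odot> Ide C b)
      = Ide C a \<odot> ((Disc C b \<odot> Disc C a) \<cdot> Swap C a b) \<odot> Ide C b"
    using assms by (simp add: interchange_arr del: TensA_assoc)
  also have "(Disc C b \<odot> Disc C a) \<cdot> Swap C a b = Disc C a \<odot> Disc C b"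
    using assms by (simp add: Disc_append[symmetric] Disc_nat)
  also have "(Ide C a \<odot> (Disc C a \<odot> Disc C b) \<odot> Ide C b) \<cdot> (Dup C a \<odot> Dup C b)
     = ((Ide C a \<odot> Disc C a) \<odot> (Disc C b \<odot> Ide C b)) \<cdot> (Dup C a \<odot> Dup C b)"
    using assms by simp
  also have "\<dots> = Ide C (a @ b)"
    using assms by (subst interchange_arr) (simp_all add: counit del: TensA_assoc)
  finally show ?thesis .
qed

lemma copyable_arr: "copyable f \<Longrightarrow> f \<in> Arr C"
  by (simp add: copyable_def)

lemma copyable_Ide: "set a \<subseteq> V \<Longrightarrow> copyable (Ide C a)"
  by (simp add: copyable_def)

lemma copyable_Disc: "set a \<subseteq> V \<Longrightarrow> copyable (Disc C a)"
  by (simp add: copyable_def Disc_append[symmetric] Disc_nat)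

text \<open>Both sides are fourfold copies of \<open>a\<close>. Coassociativity gives the form (1),
  in which the two inner copies come from one duplicate; cocommutativity of that duplicate absorbs
  the middle swap in \<open>Dup C (a @ a)\<close>.\<close>

lemma copyable_Dup:
  assumes a: "set a \<subseteq> V" shows "copyable (Dup C a)"
proof -
  let ?D = "Dup C a" and ?I = "Ide C a"
  have "pair ?D ?D = (?D \<odot> Ide C (a @ a)) \<cdot> pair ?I ?D"
    using a by (subst TensA_pair) simp_all
  also have "pair ?I ?D = pair ?D ?I"
    using a by (simp add: pair_def coassoc)
  also have "(?D \<odot> Ide C (a @ a)) \<cdot> pair ?D ?I = ((?D \<odot> ?I) \<odot> ?I) \<cdot> pair ?D ?I"
    using a by simp
  also have "\<dots> = pair ((?D \<odot> ?I) \<cdot> ?D) ?I"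
    using a by (subst TensA_pair) simp_all
  also have "\<dots> = pair ((?I \<odot> ?D) \<cdot> ?D) ?I" using a by (simp add: coassoc)
  also have "\<dots> = ((?I \<odot> ?D) \<odot> ?I) \<cdot> pair ?D ?I"
    using a by (subst TensA_pair) simp_all
  finally have 1: "pair ?D ?D = (?I \<odot> ?D \<odot> ?I) \<cdot> pair ?D ?I" using a by simp
  have "Dup C (a @ a) \<cdot> ?D = (?I \<odot> Swap C a a \<odot> ?I) \<cdot> pair ?D ?D"
    using a by (simp add: Dup_append pair_def)
  also have "\<dots> = ((?I \<odot> Swap C a a \<odot> ?I) \<cdot> (?I \<odot> ?D \<odot> ?I)) \<cdot> pair ?D ?I"
    using a by (simp add: 1)
  also have "\<dots> = (?I \<odot> (Swap C a a \<cdot> ?D) \<odot> ?I) \<cdot> pair ?D ?I"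
    using a by (simp add: interchange_arr)
  also have "\<dots> = pair ?D ?D" using a by (simp add: cocomm 1)
  finally show ?thesis using a by (simp add: copyable_def pair_def)
qed

lemma copyable_Cmp:
  assumes "copyable f" "copyable g" "Dom C g = Cod C f" shows "copyable (g \<cdot> f)"
proof -
  note [simp] = assms(1,2)[THEN copyable_arr] assms(3)
  have "Dup C (Cod C g) \<cdot> g \<cdot> f = (Dup C (Cod C g) \<cdot> g) \<cdot> f" by simp
  also have "\<dots> = (g \<odot> g) \<cdot> (Dup C (Cod C f) \<cdot> f)"
    using assms(2) by (simp add: copyable_def)
  also have "\<dots> = ((g \<odot> g) \<cdot> (f \<odot> f)) \<cdot> Dup C (Dom C f)"
    using assms(1) by (simp add: copyable_def)
  finally show ?thesis by (simp add: copyable_def interchange_arr)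
qed

text \<open>Duplicating a tensor product is duplicating the factors followed by a middle swap, and
  that swap is natural.\<close>

lemma copyable_TensA:
  assumes "copyable f" "copyable g" shows "copyable (f \<odot> g)"
proof -
  note [simp] = assms[THEN copyable_arr]
  let ?a = "Dom C f" and ?b = "Dom C g" and ?c = "Cod C f" and ?d = "Cod C g"
  have "Dup C (?c @ ?d) \<cdot> (f \<odot> g)
     = (Ide C ?c \<odot> Swap C ?c ?d \<odot> Ide C ?d) \<cdot> ((Dup C ?c \<odot> Dup C ?d) \<cdot> (f \<odot> g))"
    by (simp add: Dup_append)
  also have "(Dup C ?c \<odot> Dup C ?d) \<cdot> (f \<odot> g) = ((f \<odot> f) \<odot> (g \<odot> g)) \<cdot> (Dup C ?a \<odot> Dup C ?b)"
    using assms by (simp add: interchange_arr copyable_def del: TensA_assoc)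
  also have "(Ide C ?c \<odot> Swap C ?c ?d \<odot> Ide C ?d) \<cdot> \<dots>
     = ((Ide C ?c \<odot> Swap C ?c ?d \<odot> Ide C ?d) \<cdot> (f \<odot> (f \<odot> g) \<odot> g)) \<cdot> (Dup C ?a \<odot> Dup C ?b)"
    by simp
  also have "(Ide C ?c \<odot> Swap C ?c ?d \<odot> Ide C ?d) \<cdot> (f \<odot> (f \<odot> g) \<odot> g)
     = f \<odot> (Swap C ?c ?d \<cdot> (f \<odot> g)) \<odot> g"
    by (simp add: interchange_arr del: TensA_assoc)
  also have "\<dots> = (f \<odot> (g \<odot> f) \<odot> g) \<cdot> (Ide C ?a \<odot> Swap C ?a ?b \<odot> Ide C ?b)"
    by (simp add: interchange_arr Swap_nat del: TensA_assoc)
  also have "(\<dots>) \<cdot> (Dup C ?a \<odot> Dup C ?b) = ((f \<odot> g) \<odot> (f \<odot> g)) \<cdot> Dup C (?a @ ?b)"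
    by (simp add: Dup_append)
  finally show ?thesis by (simp add: copyable_def)
qed

lemma copyable_pair:
  assumes "copyable f" "copyable g" "Dom C g = Dom C f" shows "copyable (pair f g)"
  unfolding pair_def using assms
  by (intro copyable_Cmp copyable_TensA copyable_Dup) (auto simp: copyable_arr)

text \<open>The value at the empty word is a default, reached only if \<open>x\<close> does not
  occur; all typing facts assume that it does.\<close>

primrec proj :: "'v list \<Rightarrow> 'v \<Rightarrow> 'a" where
  "proj [] x = Ide C []"
| "proj (y # a) x = (if y = x then Ide C [x] \<odot> Disc C a else Disc C [y] \<odot> proj a x)"

text \<open>Entries of \<open>b\<close> refer to their first occurrence in \<open>a\<close>.\<close>

primrec sel :: "'v list \<Rightarrow> 'v list \<Rightarrow> 'a" where
  "sel a [] = Disc C a"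
| "sel a (x # b) = pair (proj a x) (sel a b)"

lemma proj_arr [simp]:
  assumes "set a \<subseteq> V" "x \<in> set a"
  shows "proj a x \<in> Arr C" "Dom C (proj a x) = a" "Cod C (proj a x) = [x]"
proof -
  have "proj a x \<in> Arr C \<and> Dom C (proj a x) = a \<and> Cod C (proj a x) = [x]"
    using assms by (induction a) auto
  then show "proj a x \<in> Arr C" "Dom C (proj a x) = a" "Cod C (proj a x) = [x]" by auto
qed

lemma sel_arr [simp]:
  assumes "set a \<subseteq> V" "set b \<subseteq> set a"
  shows "sel a b \<in> Arr C" "Dom C (sel a b) = a" "Cod C (sel a b) = b"
proof -
  have "sel a b \<in> Arr C \<and> Dom C (sel a b) = a \<and> Cod C (sel a b) = b"
    using assms by (induction b) auto
  then show "sel a b \<in> Arr C" "Dom C (sel a b) = a" "Cod C (sel a b) = b" by auto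
qed

lemma copyable_proj: "set a \<subseteq> V \<Longrightarrow> x \<in> set a \<Longrightarrow> copyable (proj a x)"
  by (induction a) (auto intro!: copyable_TensA copyable_Ide copyable_Disc)

lemma copyable_sel: "set a \<subseteq> V \<Longrightarrow> set b \<subseteq> set a \<Longrightarrow> copyable (sel a b)"
  by (induction b) (auto intro!: copyable_pair copyable_proj copyable_Disc)

lemma sel_append:
  assumes "set a \<subseteq> V" "set b \<subseteq> set a" "set c \<subseteq> set a"
  shows "sel a (b @ c) = pair (sel a b) (sel a c)"
  using assms by (induction b) (simp_all add: pair_Disc pair_assoc)

text \<open>Entries are found by name. Letters repeated in \<open>b\<close> do no harm: equal
  letters of \<open>b\<close> carry copies of the same entry of \<open>a\<close>, and taking the
  first of them loses nothing.\<close>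

lemma proj_sel:
  assumes "set a \<subseteq> V" "set b \<subseteq> set a" "x \<in> set b"
  shows "proj b x \<cdot> sel a b = proj a x"
  using assms(2,3)
proof (induction b)
  case (Cons y b)
  then have "set b \<subseteq> V" "y \<in> V" using assms(1) by auto
  moreover have "x \<in> set b \<Longrightarrow> x \<in> set a" using Cons by auto
  ultimately show ?case using Cons assms(1)
    by (auto simp: TensA_pair Disc_nat pair_Disc)
qed simp

lemma sel_sel:
  assumes "set a \<subseteq> V" "set b \<subseteq> set a" "set c \<subseteq> set b"
  shows "sel b c \<cdot> sel a b = sel a c"
  using assms(3)
proof (induction c)
  case Nil
  then show ?case using assms by (simp add: Disc_nat)
next
  case (Cons x c)
  have "set b \<subseteq> V" using assms by auto
  then show ?case using Cons assms by (simp add: pair_Cmp copyable_sel proj_sel)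
qed

lemma sel_append_left:
  assumes "set a \<subseteq> V" "set b \<subseteq> V" "set c \<subseteq> set a"
  shows "sel (a @ b) c = sel a c \<cdot> (Ide C a \<odot> Disc C b)"
proof -
  have p: "proj (a @ b) x = proj a x \<odot> Disc C b" if "x \<in> set a" for x
    using assms(1,2) that by (induction a) (auto simp: Disc_append)
  have "proj (a @ b) x = proj a x \<cdot> (Ide C a \<odot> Disc C b)" if "x \<in> set a" for x
    using interchange_arr[of "Ide C a" "proj a x" "Disc C b" "Ide C []"] that assms by (simp add: p)
  then show ?thesis using assms(3)
  proof (induction c)
    case Nil
    then show ?case using assms by (simp add: Disc_nat Disc_append)
  next
    case (Cons x c)
    then show ?case using assms
      by (simp add: pair_Cmp copyable_TensA copyable_Disc copyable_Ide)
  qed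
qed

text \<open>A letter is read at its first occurrence, so a later block is visible only for letters
  that do not occur in an earlier one.\<close>

lemma sel_append_right:
  assumes "set a \<subseteq> V" "set b \<subseteq> V" "set c \<subseteq> set b" "set a \<inter> set c = {}"
  shows "sel (a @ b) c = sel b c \<cdot> (Disc C a \<odot> Ide C b)"
proof -
  have p: "proj (a @ b) x = Disc C a \<odot> proj b x" if "x \<in> set b" "x \<notin> set a" for x
    using assms(1,2) that
  proof (induction a)
    case (Cons y a)
    then show ?case using Disc_append[of "[y]" a] by auto
  qed simp
  have "proj (a @ b) x = proj b x \<cdot> (Disc C a \<odot> Ide C b)" if "x \<in> set b" "x \<notin> set a" for x
    using interchange_arr[of "Disc C a" "Ide C []" "Ide C b" "proj b x"] that assms by (simp add: p)
  then show ?thesis using assms(3,4)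
  proof (induction c)
    case Nil
    then show ?case using assms by (simp add: Disc_nat Disc_append)
  next
    case (Cons x c)
    then show ?case using assms
      by (simp add: pair_Cmp copyable_TensA copyable_Disc copyable_Ide)
  qed
qed

text \<open>Distinctness matters: with a repeated letter, the first occurrence would be selected
  twice.\<close>

lemma sel_self: "set a \<subseteq> V \<Longrightarrow> distinct a \<Longrightarrow> sel a a = Ide C a"
proof (induction a)
  case (Cons x a)
  then show ?case
    using sel_append_right[of "[x]" a a] pair_projections[of "[x]" a] by simp
qed simp

lemma sel_append_append:
  assumes "set a \<subseteq> V" "set b \<subseteq> V" "set c \<subseteq> set a" "set d \<subseteq> set b" "set a \<inter> set d = {}"
  shows "sel (a @ b) (c @ d) = sel a c \<odot> sel b d"
proof -
  have "sel (a @ b) (c @ d) = pair (sel (a @ b) c) (sel (a @ b) d)"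
    using assms by (intro sel_append) auto
  also have "\<dots> = (sel a c \<odot> sel b d) \<cdot> pair (Ide C a \<odot> Disc C b) (Disc C a \<odot> Ide C b)"
    using assms by (subst TensA_pair) (simp_all add: sel_append_left sel_append_right)
  finally show ?thesis using assms by (simp add: pair_projections)
qed

text \<open>Here \<open>k\<close> computes new values while \<open>a\<close> is kept. If only old
  values are selected, \<open>k\<close> meets a discard and vanishes by naturality; this is what
  later removes mechanisms.\<close>

lemma sel_pair_Ide:
  assumes "set a \<subseteq> V" "k \<in> Arr C" "Dom C k = a" "Cod C k = b" "set c \<subseteq> set a"
  shows "sel (a @ b) c \<cdot> pair (Ide C a) k = sel a c"
    "set d \<subseteq> set b \<Longrightarrow> set a \<inter> set d = {} \<Longrightarrow>
      sel (a @ b) (c @ d) \<cdot> pair (Ide C a) k = pair (sel a c) (sel b d \<cdot> k)"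
proof -
  have b: "set b \<subseteq> V" using assms Cod_subset[of k] by simp
  show 1: "sel (a @ b) (c @ d) \<cdot> pair (Ide C a) k = pair (sel a c) (sel b d \<cdot> k)"
    if "set d \<subseteq> set b" "set a \<inter> set d = {}" for d
    using assms b that by (simp add: sel_append_append TensA_pair)
  from 1[of "[]"] show "sel (a @ b) c \<cdot> pair (Ide C a) k = sel a c"
    using assms b by (simp add: Disc_nat pair_Disc)
qed

text \<open>A diagram puts the outputs of a component in front of the remaining wires, whereas a run
  appends new values at the end; this form bridges the two orders.\<close>

lemma sel_pair_Ide_swap:
  assumes "set a \<subseteq> V" "k \<in> Arr C" "Dom C k = a" "Cod C k = b" "set c \<subseteq> set a"
    "set d \<subseteq> set b" "set a \<inter> set d = {}"
  shows "sel (a @ b) (d @ c) \<cdot> pair (Ide C a) k = pair (sel b d \<cdot> k) (sel a c)"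
proof -
  have b: "set b \<subseteq> V" using assms Cod_subset[of k] by simp
  then have sub: "set c \<subseteq> V" "set d \<subseteq> V" using assms by auto
  have "sel (a @ b) (d @ c) = Swap C c d \<cdot> sel (a @ b) (c @ d)"
    using assms b sub by (simp add: sel_append Swap_pair le_supI1 le_supI2)
  then have "sel (a @ b) (d @ c) \<cdot> pair (Ide C a) k
     = Swap C c d \<cdot> (sel (a @ b) (c @ d) \<cdot> pair (Ide C a) k)"
    using assms b sub by (simp add: le_supI1 le_supI2)
  then show ?thesis
    using assms b sub by (simp add: sel_pair_Ide(2) Swap_pair)
qed

text \<open>Copies of a word are a selection with repetitions; the case \<open>m = 0\<close> is the
  empty selection, which is discarding.\<close>

lemma iterated_dup_sel:
  assumes "set a \<subseteq> V" "distinct a"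
  shows "iterated_dup C a m = sel a (concat (replicate m a))"
proof (induction m rule: induct_nat_012)
  case (ge2 n)
  have "set (concat (replicate n a)) \<subseteq> set a" by auto
  then have "sel a (a @ a @ concat (replicate n a)) = pair (Ide C a) (sel a (a @ concat (replicate n a)))"
    using assms by (simp add: sel_append sel_self del: set_concat)
  then show ?case using ge2 assms by (simp add: pair_def)
qed (simp_all add: assms sel_self)

end

lemma word_markov_Fm: "word_markov (Fm G) (set (verts G))"
proof -
  interpret markov_category "Fm G" by (rule markov_category_Fm)
  show ?thesis by unfold_locales (auto simp: Fm_sel)
qed

interpretation Fm: word_markov "Fm G" "set (verts G)" for G
  by (rule word_markov_Fm)

section \<open>Running a sequence of mechanisms\<close>

text \<open>Indices and letters are kept apart: an index \<open>i\<close> will be a vertex of the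
  source graph of a functor, and the word \<open>ty i\<close> holds its value. For the identity
  functor this word is the vertex itself, for a refinement it is the listing of the fibre.\<close>

locale mechanisms = word_markov C V
  for C :: "('v list, 'a) markov" (structure) and V :: "'v set" +
  fixes I :: "'i set" and ty :: "'i \<Rightarrow> 'v list" and inp :: "'i \<Rightarrow> 'v list" and mech :: "'i \<Rightarrow> 'a"
  assumes mech_arr: "i \<in> I \<Longrightarrow> mech i \<in> Arr C" "i \<in> I \<Longrightarrow> Dom C (mech i) = inp i"
    "i \<in> I \<Longrightarrow> Cod C (mech i) = ty i"
begin

declare mech_arr [simp]

lemma ty_subset [simp]: "i \<in> I \<Longrightarrow> set (ty i) \<subseteq> V"
  using Cod_subset[of "mech i"] by simp

definition tys :: "'i list \<Rightarrow> 'v list" where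
  "tys N = concat (map ty N)"

lemma tys_simps [simp]: "tys [] = []" "tys (i # N) = ty i @ tys N" "tys (M @ N) = tys M @ tys N"
  by (simp_all add: tys_def)

primrec runnable :: "'v list \<Rightarrow> 'i list \<Rightarrow> bool" where
  "runnable a [] \<longleftrightarrow> True"
| "runnable a (i # N) \<longleftrightarrow> i \<in> I \<and> set (inp i) \<subseteq> set a \<and> runnable (a @ ty i) N"

definition step :: "'v list \<Rightarrow> 'i \<Rightarrow> 'a" where
  "step a i = pair (Ide C a) (mech i \<cdot> sel a (inp i))"

text \<open>All values computed on the way, and the inputs, are kept.\<close>

primrec run :: "'v list \<Rightarrow> 'i list \<Rightarrow> 'a" where
  "run a [] = Ide C a"
| "run a (i # N) = run (a @ ty i) N \<cdot> step a i"

lemma runnable_append [simp]: "runnable a (M @ N) \<longleftrightarrow> runnable a M \<and> runnable (a @ tys M) N"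
  by (induction M arbitrary: a) auto

lemma runnable_mono: "runnable a N \<Longrightarrow> set a \<subseteq> set b \<Longrightarrow> runnable b N"
proof (induction N arbitrary: a b)
  case (Cons i N)
  then show ?case using Cons.IH[of "a @ ty i" "b @ ty i"] by auto
qed simp

lemma runnable_subset: "runnable a N \<Longrightarrow> set (tys N) \<subseteq> V"
  by (induction N arbitrary: a) auto

lemma step_arr [simp]:
  assumes "set a \<subseteq> V" "i \<in> I" "set (inp i) \<subseteq> set a"
  shows "step a i \<in> Arr C" "Dom C (step a i) = a" "Cod C (step a i) = a @ ty i"
  using assms by (simp_all add: step_def)

lemma run_arr [simp]:
  assumes "set a \<subseteq> V" "runnable a N"
  shows "run a N \<in> Arr C" "Dom C (run a N) = a" "Cod C (run a N) = a @ tys N"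
proof -
  have "run a N \<in> Arr C \<and> Dom C (run a N) = a \<and> Cod C (run a N) = a @ tys N"
    using assms by (induction N arbitrary: a) auto
  then show "run a N \<in> Arr C" "Dom C (run a N) = a" "Cod C (run a N) = a @ tys N" by auto
qed

lemma run_append:
  assumes "set a \<subseteq> V" "runnable a (M @ N)"
  shows "run a (M @ N) = run (a @ tys M) N \<cdot> run a M"
  using assms
proof (induction M arbitrary: a)
  case Nil
  then show ?case by simp
next
  case (Cons i M)
  then have "set (tys M) \<subseteq> V" using runnable_subset[of "a @ ty i" M] by simp
  then show ?case using Cons by simp
qed

lemma run_snoc:
  assumes "set a \<subseteq> V" "runnable a (M @ [i])"
  shows "run a (M @ [i]) = step (a @ tys M) i \<cdot> run a M"
proof -
  have "set (tys M) \<subseteq> V" "i \<in> I" using assms runnable_subset[of a M] by auto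
  then show ?thesis using run_append[OF assms] assms by simp
qed

text \<open>Naturality of discarding removes the mechanisms whose values are not used.\<close>

lemma sel_run_filter:
  assumes "set a \<subseteq> V" "runnable a M" "runnable a (filter p M)" "distinct (a @ tys M)"
  shows "sel (a @ tys M) (a @ tys (filter p M)) \<cdot> run a M = run a (filter p M)"
  using assms(2-4)
\<comment> \<open>The induction is from the end because no mechanism of the list reads the values of
  the last one.\<close>
proof (induction M rule: rev_induct)
  case Nil
  then show ?case using assms(1) by (simp add: sel_self)
next
  case (snoc i M)
  let ?N = "filter p M"
  have sub: "set (tys ?N) \<subseteq> set (tys M)" by (auto simp: tys_def)
  have M: "set (tys M) \<subseteq> V" using snoc.prems runnable_subset[of a M] by auto
  then have N: "set (tys ?N) \<subseteq> V" using sub by auto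
  have i: "i \<in> I" "set (inp i) \<subseteq> set (a @ tys M)" using snoc.prems by auto
  have IH: "sel (a @ tys M) (a @ tys ?N) \<cdot> run a M = run a ?N"
    using snoc by (simp add: Int_Un_distrib split: if_splits)
  have sub': "set (a @ tys ?N) \<subseteq> set (a @ tys M)" using sub by auto
  have V: "set (a @ tys M) \<subseteq> V" "set (a @ tys ?N) \<subseteq> V" using assms(1) M N by auto
  have d: "set (a @ tys M) \<inter> set (ty i) = {}" using snoc.prems by auto
  let ?k = "mech i \<cdot> sel (a @ tys M) (inp i)"
  show ?case
  proof (cases "p i")
    case False
    have "sel ((a @ tys M) @ ty i) (a @ tys ?N) \<cdot> step (a @ tys M) i = sel (a @ tys M) (a @ tys ?N)"
      unfolding step_def using V i sub' by (intro sel_pair_Ide(1)) simp_all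
    then have "(sel ((a @ tys M) @ ty i) (a @ tys ?N) \<cdot> step (a @ tys M) i) \<cdot> run a M = run a ?N"
      using IH by simp
    moreover have "set (a @ tys ?N) \<subseteq> set ((a @ tys M) @ ty i)" using sub' by auto
    moreover have "set ((a @ tys M) @ ty i) \<subseteq> V" using V i by simp
    ultimately show ?thesis
      using False snoc.prems assms(1) V i by (simp add: run_snoc del: set_append)
  next
    case True
    have Ni: "set (inp i) \<subseteq> set (a @ tys ?N)" using snoc.prems True by simp
    have "sel ((a @ tys M) @ ty i) ((a @ tys ?N) @ ty i) \<cdot> step (a @ tys M) i
        = pair (sel (a @ tys M) (a @ tys ?N)) (sel (ty i) (ty i) \<cdot> ?k)"
      unfolding step_def using V i sub' d by (intro sel_pair_Ide(2)) simp_all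
    also have "sel (ty i) (ty i) \<cdot> ?k = ?k"
      using snoc.prems i V by (simp add: sel_self)
    \<comment> \<open>The inputs of \<open>i\<close> are found among the values kept by the filtered
      run, and they are the same values there, so the selection can be moved before the
      step.\<close>
    also have "pair (sel (a @ tys M) (a @ tys ?N)) ?k
       = step (a @ tys ?N) i \<cdot> sel (a @ tys M) (a @ tys ?N)"
      unfolding step_def using V sub' i Ni
      by (simp add: pair_Cmp copyable_sel sel_sel del: set_append)
    finally have 1: "sel ((a @ tys M) @ ty i) ((a @ tys ?N) @ ty i) \<cdot> step (a @ tys M) i
       = step (a @ tys ?N) i \<cdot> sel (a @ tys M) (a @ tys ?N)" .
    have sub'': "set ((a @ tys ?N) @ ty i) \<subseteq> set ((a @ tys M) @ ty i)" using sub' by auto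
    have V': "set ((a @ tys M) @ ty i) \<subseteq> V" using V i by simp
    have "sel ((a @ tys M) @ ty i) ((a @ tys ?N) @ ty i) \<cdot> (step (a @ tys M) i \<cdot> run a M)
      = (sel ((a @ tys M) @ ty i) ((a @ tys ?N) @ ty i) \<cdot> step (a @ tys M) i) \<cdot> run a M"
      using snoc.prems assms(1) V V' i sub'' by (intro assoc_arr[symmetric]) (simp_all del: set_append)
    also have "\<dots> = step (a @ tys ?N) i \<cdot> (sel (a @ tys M) (a @ tys ?N) \<cdot> run a M)"
      unfolding 1
      using snoc.prems assms(1) V i sub' Ni by (intro assoc_arr) (simp_all del: set_append)
    finally show ?thesis
      using snoc.prems True assms(1) by (simp add: run_snoc IH)
  qed
qed

text \<open>A run is not copyable in general, so it cannot simply be taken out of the pair. Instead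
  its steps are moved across one at a time: a step reads its inputs by name, and reading them from
  the copy \<open>b\<close> or from \<open>a\<close> gives the same values.\<close>

lemma run_copied_inputs:
  assumes "set a \<subseteq> V" "set b \<subseteq> set a" "runnable b N" "distinct (a @ tys N)"
  shows "pair (Ide C a) (run b N \<cdot> sel a b) = sel (a @ tys N) (a @ b @ tys N) \<cdot> run a N"
  using assms(3,4)
proof (induction N rule: rev_induct)
  case Nil
  have "set b \<subseteq> V" using assms by auto
  then show ?case using assms by (simp add: sel_append sel_self)
next
  case (snoc i N)
  have b: "set b \<subseteq> V" using assms by auto
  have N: "set (tys N) \<subseteq> V" using snoc.prems runnable_subset[of b N] by auto
  have i: "i \<in> I" "set (inp i) \<subseteq> set (b @ tys N)" "runnable b N" using snoc.prems by auto
  have i': "set (inp i) \<subseteq> set (a @ tys N)" using i(2) assms(2) by auto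
  have ra: "runnable a (N @ [i])" "runnable a N"
    using runnable_mono[OF snoc.prems(1) assms(2)] by auto
  have s: "set (b @ tys N) \<subseteq> set (a @ tys N)" "set (a @ b @ tys N) \<subseteq> set (a @ tys N)"
    using assms(2) by auto
  have V: "set (a @ tys N) \<subseteq> V" "set (b @ tys N) \<subseteq> V" "set (a @ b @ tys N) \<subseteq> V" using assms(1) N b by auto
  have d: "set (a @ tys N) \<inter> set (ty i) = {}" using snoc.prems by auto
  let ?s = "sel (a @ tys N)" and ?st = "step (b @ tys N) i"
  let ?k = "mech i \<cdot> ?s (inp i)"
  have st: "?st \<in> Arr C" "Dom C ?st = b @ tys N" "Cod C ?st = (b @ tys N) @ ty i"
    using V i by (simp_all only: step_arr)
  have rb: "run b N \<in> Arr C" "Dom C (run b N) = b" "Cod C (run b N) = b @ tys N"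
    using b i by (simp_all only: run_arr)
  have ran: "run a N \<in> Arr C" "Dom C (run a N) = a" "Cod C (run a N) = a @ tys N"
    using assms(1) ra by (simp_all only: run_arr)
  have "pair (Ide C a) (run b (N @ [i]) \<cdot> sel a b) = pair (Ide C a) (?st \<cdot> run b N \<cdot> sel a b)"
    using run_snoc[OF b snoc.prems(1)] assms(1,2) st rb by simp
  also have "\<dots> = (Ide C a \<odot> ?st) \<cdot> pair (Ide C a) (run b N \<cdot> sel a b)"
    using assms(1,2) st rb by (subst TensA_pair) simp_all
  also have "\<dots> = (Ide C a \<odot> ?st) \<cdot> (?s (a @ b @ tys N) \<cdot> run a N)"
    using snoc by (simp add: Int_Un_distrib)
  also have "\<dots> = ((Ide C a \<odot> ?st) \<cdot> ?s (a @ b @ tys N)) \<cdot> run a N"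
    using assms(1) V s st ran by (intro assoc_arr[symmetric]) (simp_all del: set_append)
  also have "(Ide C a \<odot> ?st) \<cdot> ?s (a @ b @ tys N) = (Ide C a \<odot> ?st) \<cdot> pair (?s a) (?s (b @ tys N))"
    using sel_append[of "a @ tys N" a "b @ tys N"] V s by simp
  also have "\<dots> = pair (?s a) (?st \<cdot> ?s (b @ tys N))"
    using assms(1) V s st by (subst TensA_pair) (simp_all del: set_append add: set_append[of a])
  \<comment> \<open>The selection is copyable, so it enters both halves of the step.\<close>
  also have "?st \<cdot> ?s (b @ tys N) = pair (?s (b @ tys N)) ?k"
    unfolding step_def using V s i
    by (simp add: pair_Cmp copyable_sel sel_sel del: set_append)
  also have "pair (?s a) (pair (?s (b @ tys N)) ?k) = pair (pair (?s a) (?s (b @ tys N))) ?k"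
    using V s i i' by (subst pair_assoc) (simp_all del: set_append add: set_append[of a])
  also have "pair (?s a) (?s (b @ tys N)) = ?s (a @ b @ tys N)"
    using sel_append[of "a @ tys N" a "b @ tys N"] V s by simp
  \<comment> \<open>The inserted \<open>sel (ty i) (ty i)\<close> is an identity by distinctness; it
    gives the shape expected by \<open>sel_pair_Ide\<close>.\<close>
  also have "pair (?s (a @ b @ tys N)) ?k = pair (?s (a @ b @ tys N)) (sel (ty i) (ty i) \<cdot> ?k)"
    using snoc.prems i i' V by (simp add: sel_self del: set_append)
  also have "\<dots> = sel ((a @ tys N) @ ty i) ((a @ b @ tys N) @ ty i) \<cdot> step (a @ tys N) i"
    unfolding step_def using V s i i' d
    by (intro sel_pair_Ide(2)[symmetric]) (simp_all del: set_append)
  also have "(\<dots>) \<cdot> run a N = sel ((a @ tys N) @ ty i) ((a @ b @ tys N) @ ty i) \<cdot> (step (a @ tys N) i \<cdot> run a N)"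
  proof (intro assoc_arr)
    have "set ((a @ b @ tys N) @ ty i) \<subseteq> set ((a @ tys N) @ ty i)" "set ((a @ tys N) @ ty i) \<subseteq> V"
      using s V i by auto
    then show "sel ((a @ tys N) @ ty i) ((a @ b @ tys N) @ ty i) \<in> Arr C"
      "Dom C (sel ((a @ tys N) @ ty i) ((a @ b @ tys N) @ ty i)) = Cod C (step (a @ tys N) i)"
      using V i i' by (simp_all del: set_append append_assoc)
  qed (use V i i' ran in \<open>simp_all del: set_append\<close>)
  finally show ?case
    using run_snoc[OF assms(1) ra(1)] by simp
qed

text \<open>The left side is the step of a mechanism that is itself a run of \<open>N\<close>
  followed by forgetting its copy of the inputs \<open>b\<close>, which is the form of an evaluated
  causal effect. Such a mechanism can be unfolded in place.\<close>

lemma run_block: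
  assumes "set a \<subseteq> V" "set b \<subseteq> set a" "runnable b N" "distinct (a @ tys N)"
  shows "pair (Ide C a) ((sel (b @ tys N) (tys N) \<cdot> run b N) \<cdot> sel a b) = run a N"
proof -
  have b: "set b \<subseteq> V" using assms by auto
  have N: "set (tys N) \<subseteq> V" using assms runnable_subset[of b N] by auto
  have ra: "runnable a N" using runnable_mono[OF assms(3,2)] .
  have s: "set (b @ tys N) \<subseteq> set (a @ tys N)" "set (a @ b @ tys N) \<subseteq> set (a @ tys N)"
    using assms(2) by auto
  have V: "set (a @ tys N) \<subseteq> V" "set (b @ tys N) \<subseteq> V" "set (a @ b @ tys N) \<subseteq> V" using assms(1) N b by auto
  let ?s = "sel (a @ tys N)" and ?p = "sel (b @ tys N) (tys N)"
  have p: "?p \<in> Arr C" "Dom C ?p = b @ tys N" "Cod C ?p = tys N" using b N by simp_all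
  have rb: "run b N \<in> Arr C" "Dom C (run b N) = b" "Cod C (run b N) = b @ tys N"
    using b assms by (simp_all only: run_arr)
  have "pair (Ide C a) ((?p \<cdot> run b N) \<cdot> sel a b) = (Ide C a \<odot> ?p) \<cdot> pair (Ide C a) (run b N \<cdot> sel a b)"
    using assms(1,2) p rb by (subst TensA_pair) simp_all
  also have "\<dots> = (Ide C a \<odot> ?p) \<cdot> (?s (a @ b @ tys N) \<cdot> run a N)"
    using run_copied_inputs[OF assms] by simp
  also have "\<dots> = ((Ide C a \<odot> ?p) \<cdot> ?s (a @ b @ tys N)) \<cdot> run a N"
    using assms(1) V s p ra by (intro assoc_arr[symmetric]) (simp_all del: set_append)
  also have "(Ide C a \<odot> ?p) \<cdot> ?s (a @ b @ tys N) = (Ide C a \<odot> ?p) \<cdot> pair (?s a) (?s (b @ tys N))"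
    using sel_append[of "a @ tys N" a "b @ tys N"] V s by simp
  also have "\<dots> = pair (?s a) (?s (tys N))"
    using assms(1) V s p by (subst TensA_pair) (simp_all add: sel_sel del: set_append add: set_append[of a] set_append[of b])
  also have "\<dots> = Ide C (a @ tys N)"
    using sel_append[of "a @ tys N" a "tys N"] sel_self[of "a @ tys N"] V assms(4) by simp
  finally show ?thesis using ra assms(1) by simp
qed

end

section \<open>The graph of a causal effect\<close>

text \<open>An arc orders its ends by \<open>vle\<close>, and distinctness of \<open>verts\<close>
  makes their positions unique, so no arc can lead back. Listings thereby become topological
  orders.\<close>

lemma odag_sorted:
  assumes "odag G" shows "sorted_wrt (\<lambda>u v. (v, u) \<notin> proper_arcs G) (verts G)"
  unfolding sorted_wrt_iff_nth_less
proof (intro allI impI notI)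
  fix i j assume ij: "i < j" "j < length (verts G)" "(verts G ! j, verts G ! i) \<in> proper_arcs G"
  then have "vle G (verts G ! j) (verts G ! i)" using assms unfolding odag_def by blast
  then obtain i' j' where "i' \<le> j'" "j' < length (verts G)" "verts G ! i' = verts G ! j" "verts G ! j' = verts G ! i"
    by (auto simp: vle_def)
  moreover have "distinct (verts G)" using assms by (simp add: odag_def)
  ultimately show False using ij by (auto simp: nth_eq_iff_index_eq)
qed

lemma listing_sorted:
  "odag G \<Longrightarrow> sorted_wrt (\<lambda>u v. (v, u) \<notin> proper_arcs G) (listing G X)"
  unfolding listing_def by (intro sorted_wrt_filter odag_sorted)

lemma distinct_listing: "odag G \<Longrightarrow> distinct (listing G X)"
  by (simp add: listing_def odag_def)

lemma proper_arcs_verts: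
  "odag G \<Longrightarrow> (u, v) \<in> proper_arcs G \<Longrightarrow> u \<in> set (verts G) \<and> v \<in> set (verts G) \<and> u \<noteq> v"
  by (auto simp: odag_def proper_arcs_def)

lemma successively_in_verts:
  assumes "odag G" "successively (\<lambda>u v. (u, v) \<in> proper_arcs G) p" "last p \<in> set (verts G)" "p \<noteq> []"
  shows "set p \<subseteq> set (verts G)"
  using assms(2-)
proof (induction p)
  case (Cons x p)
  then show ?case using proper_arcs_verts[OF assms(1)]
    by (cases p) (auto split: if_splits)
qed simp

lemma effect_verts_subset:
  assumes "odag G" "X \<subseteq> set (verts G)" "Y \<subseteq> set (verts G)"
  shows "effect_verts G X Y \<subseteq> set (verts G)"
proof -
  have "set p \<subseteq> set (verts G)" if "effect_path G X Y p" for p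
    using that assms by (intro successively_in_verts) (auto simp: effect_path_def)
  then show ?thesis using assms by (auto simp: effect_verts_def)
qed

text \<open>Avoiding \<open>X\<close> is required of the tail only, and the tail of a suffix lies in
  the tail of the path.\<close>

lemma effect_path_suffix:
  assumes "effect_path G X Y (p @ q)" "q \<noteq> []" shows "effect_path G X Y q"
  using assms
proof (induction p)
  case (Cons u p)
  have "effect_path G X Y (p @ q)"
    using Cons.prems by (cases p; cases q) (auto simp: effect_path_def successively_Cons)
  then show ?case using Cons by blast
qed simp

text \<open>For a vertex of \<open>Y\<close> the path is the vertex alone. The assumption on
  \<open>X\<close> excludes vertices that belong to the graph only as inputs, with no path leaving
  them.\<close>

lemma effect_verts_path:
  assumes "i \<in> effect_verts G X Y" "i \<notin> X"
  obtains q where "effect_path G X Y (i # q)"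
proof (cases "i \<in> Y")
  case True
  then show ?thesis using assms that[of "[]"] by (simp add: effect_path_def)
next
  case False
  with assms obtain p where p: "effect_path G X Y p" "i \<in> set p"
    by (auto simp: effect_verts_def)
  then obtain r q where "p = r @ i # q" by (meson split_list)
  then show ?thesis using that[of q] effect_path_suffix[of G X Y r "i # q"] p assms by auto
qed

lemma zip_tl_split: "(u, v) \<in> set (zip p (tl p)) \<Longrightarrow> \<exists>r q. p = r @ u # v # q"
proof (induction p)
  case (Cons x p)
  then show ?case
  proof (cases p)
    case (Cons y p')
    then consider "u = x" "v = y" | "(u, v) \<in> set (zip p (tl p))" using Cons.prems by auto
    then show ?thesis
    proof cases
      case 1
      then show ?thesis using Cons by (intro exI[of _ "[]"] exI[of _ p']) auto
    next
      case 2
      then obtain r q where "p = r @ u # v # q" using Cons.IH by blast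
      then show ?thesis by (intro exI[of _ "x # r"] exI[of _ q]) auto
    qed
  qed simp
qed simp

text \<open>A path from \<open>v\<close> to \<open>Y\<close> can be prolonged backwards to any
  parent \<open>u\<close>, even one in \<open>X\<close>, provided that \<open>v\<close> is not in
  \<open>X\<close>. So all parents of a vertex of the graph outside \<open>X\<close> are present, as
  the inputs of its mechanism require.\<close>

lemma effect_arcs_iff:
  "(u, v) \<in> effect_arcs G X Y \<longleftrightarrow> (u, v) \<in> proper_arcs G \<and> v \<notin> X \<and> v \<in> effect_verts G X Y"
proof
  assume "(u, v) \<in> effect_arcs G X Y"
  then obtain p where p: "effect_path G X Y p" "(u, v) \<in> set (zip p (tl p))"
    by (auto simp: effect_arcs_def)
  then obtain r q where pr: "p = r @ u # v # q" using zip_tl_split by metis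
  then have "effect_path G X Y (u # v # q)" using effect_path_suffix[of G X Y r "u # v # q"] p by simp
  then have "(u, v) \<in> proper_arcs G" "v \<notin> X" by (auto simp: effect_path_def)
  moreover have "v \<in> effect_verts G X Y" using p(1) pr by (auto simp: effect_verts_def)
  ultimately show "(u, v) \<in> proper_arcs G \<and> v \<notin> X \<and> v \<in> effect_verts G X Y" by blast
next
  assume a: "(u, v) \<in> proper_arcs G \<and> v \<notin> X \<and> v \<in> effect_verts G X Y"
  then obtain q where "effect_path G X Y (v # q)" using effect_verts_path by metis
  then have "effect_path G X Y (u # v # q)" using a by (auto simp: effect_path_def)
  then show "(u, v) \<in> effect_arcs G X Y" by (force simp: effect_arcs_def)
qed

lemma effect_arcs_source: "(u, v) \<in> effect_arcs G X Y \<Longrightarrow> u \<in> effect_verts G X Y"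
  unfolding effect_arcs_def effect_verts_def using set_zip_leftD by fastforce

section \<open>Wires and components of the diagram of a causal effect\<close>

primrec wire_name :: "'v wire \<Rightarrow> 'v" where
  "wire_name (In i) = i"
| "wire_name (Edge i k) = i"
| "wire_name (Out i) = i"

lemma wire_ty_name: "wire_ty w = [wire_name w]"
  by (cases w) auto

text \<open>The wires present after the components of the vertices in \<open>D\<close> have been applied.\<close>

definition open_wires :: "'v odag \<Rightarrow> 'v set \<Rightarrow> 'v set \<Rightarrow> 'v set \<Rightarrow> 'v wire set" where
  "open_wires G X Y D = In ` (X - D) \<union> {Edge i k |i k. i \<in> D \<and> k \<notin> D \<and> (i, k) \<in> effect_arcs G X Y} \<union> Out ` (Y \<inter> D)"

lemma wires_obj_names: "wires_obj (Fm G) wire_ty ws = map wire_name ws"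
  unfolding wires_obj_def by (induction ws) (simp_all add: wire_ty_name Fm_sel)

lemma kappa_arr [simp]:
  assumes "v \<in> set (verts G)"
  shows "kappa G v \<in> Arr (Fm G)" "Dom (Fm G) (kappa G v) = pa G v" "Cod (Fm G) (kappa G v) = [v]"
  using assms by (simp_all add: kappa_def cls_Arr cls_Dom cls_Cod)

lemma set_pa_verts [simp]: "set (pa G v) \<subseteq> set (verts G)"
  by (simp add: set_pa)

definition comp_ins :: "'v odag \<Rightarrow> 'v set \<Rightarrow> 'v \<Rightarrow> 'v wire list" where
  "comp_ins G X i = (if i \<in> X then [In i] else map (\<lambda>p. Edge p i) (pa G i))"

definition comp_outs :: "'v odag \<Rightarrow> 'v set \<Rightarrow> 'v set \<Rightarrow> 'v \<Rightarrow> 'v wire list" where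
  "comp_outs G X Y i = map (Edge i) (effect_children G X Y i) @ (if i \<in> Y then [Out i] else [])"

lemma component_eq: "component G X Y i = (comp_ins G X i, Gamma G X Y i, comp_outs G X Y i)"
  by (simp add: component_def comp_ins_def comp_outs_def)

text \<open>The summand 1 for \<open>i\<close> in \<open>Y\<close> accounts for the wire
  \<open>Out i\<close>, so in all four cases the number of copies is the number of output
  wires.\<close>

lemma Gamma_eq:
  "Gamma G X Y i = (let d = iterated_dup (Fm G) [i] (length (comp_outs G X Y i)) in
     if i \<in> X then d else d \<cdot>\<^bsub>Fm G\<^esub> kappa G i)"
  by (auto simp: Gamma_def comp_outs_def Let_def)

lemma names_comp_ins: "map wire_name (comp_ins G X i) = (if i \<in> X then [i] else pa G i)"
  by (simp add: comp_ins_def comp_def)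

lemma names_comp_outs: "map wire_name (comp_outs G X Y i) = replicate (length (comp_outs G X Y i)) i"
  by (auto simp: comp_outs_def comp_def map_replicate_const replicate_append_same)

lemma iterated_dup_arr:
  assumes "i \<in> set (verts G)"
  shows "iterated_dup (Fm G) [i] m \<in> Arr (Fm G)" "Dom (Fm G) (iterated_dup (Fm G) [i] m) = [i]"
    "Cod (Fm G) (iterated_dup (Fm G) [i] m) = replicate m i"
proof -
  have c: "concat (replicate m [i]) = replicate m i" by (induction m) auto
  show "iterated_dup (Fm G) [i] m \<in> Arr (Fm G)" "Dom (Fm G) (iterated_dup (Fm G) [i] m) = [i]"
    "Cod (Fm G) (iterated_dup (Fm G) [i] m) = replicate m i"
    using assms by (simp_all add: Fm.iterated_dup_sel[of "[i]"] c set_replicate_conv_if)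
qed

lemma Gamma_arr:
  assumes "i \<in> set (verts G)"
  shows "Gamma G X Y i \<in> Arr (Fm G)" "Dom (Fm G) (Gamma G X Y i) = map wire_name (comp_ins G X i)"
    "Cod (Fm G) (Gamma G X Y i) = map wire_name (comp_outs G X Y i)"
  using assms by (simp_all add: Gamma_eq Let_def names_comp_ins names_comp_outs iterated_dup_arr)

text \<open>The situation at one stage of evaluation: the components of \<open>L0\<close> have been
  applied, that of \<open>i\<close> is next, those of \<open>L\<close> follow.\<close>

locale effect_listing =
  fixes G :: "'v odag" and X Y :: "'v set" and L0 :: "'v list" and i :: 'v and L :: "'v list"
  assumes odag: "odag G" and X: "X \<subseteq> set (verts G)" and Y: "Y \<subseteq> set (verts G)"
    and split: "listing G (effect_verts G X Y) = L0 @ i # L"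
begin

lemma vert: "i \<in> set (verts G)" "i \<in> effect_verts G X Y"
proof -
  have "i \<in> set (listing G (effect_verts G X Y))" unfolding split by simp
  then show "i \<in> set (verts G)" "i \<in> effect_verts G X Y" by simp_all
qed

lemma fresh: "i \<notin> set L0" "i \<notin> set L"
  using distinct_listing[OF odag, of "effect_verts G X Y"] unfolding split by auto

text \<open>A parent of \<open>i\<close> cannot come after \<open>i\<close> in the listing, and
  \<open>effect_arcs_iff\<close> puts it into the graph. So the input wires of the component of
  \<open>i\<close> are already open.\<close>

lemma parent_before:
  assumes "(u, i) \<in> proper_arcs G" "i \<notin> X" shows "u \<in> set L0" "(u, i) \<in> effect_arcs G X Y"
proof -
  show e: "(u, i) \<in> effect_arcs G X Y" using assms vert by (simp add: effect_arcs_iff)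
  have "u \<in> set (listing G (effect_verts G X Y))" "u \<noteq> i"
    using effect_arcs_source[OF e] proper_arcs_verts[OF odag assms(1)] by auto
  moreover have "u \<notin> set L"
    using listing_sorted[OF odag, of "effect_verts G X Y"] assms(1)
    unfolding split by (auto simp: sorted_wrt_append)
  ultimately show "u \<in> set L0" unfolding split by auto
qed

lemma child_after:
  assumes "(i, k) \<in> effect_arcs G X Y" shows "k \<notin> set L0" "k \<noteq> i"
proof -
  have a: "(i, k) \<in> proper_arcs G" using assms by (simp add: effect_arcs_iff)
  then show "k \<noteq> i" by (auto simp: proper_arcs_def)
  show "k \<notin> set L0"
    using listing_sorted[OF odag, of "effect_verts G X Y"] a
    unfolding split by (auto simp: sorted_wrt_append)
qed

lemma set_comp_outs:
  "set (comp_outs G X Y i) = {Edge i k |k. (i, k) \<in> effect_arcs G X Y} \<union> Out ` (Y \<inter> {i})"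
proof -
  have "set (effect_children G X Y i) = {k. (i, k) \<in> effect_arcs G X Y}"
    using proper_arcs_verts[OF odag] by (auto simp: effect_children_def effect_arcs_iff)
  then show ?thesis by (auto simp: comp_outs_def)
qed

lemma comp_ins_open: "set (comp_ins G X i) \<subseteq> open_wires G X Y (set L0)"
  using fresh parent_before by (auto simp: comp_ins_def open_wires_def set_pa parents_def)

text \<open>The inputs of the component of \<open>i\<close> are exactly the open wires that end at
  \<open>i\<close>, and its outputs lead only to later vertices or to the outside.\<close>

lemma open_wires_step:
  "set (comp_outs G X Y i) \<union> (open_wires G X Y (set L0) - set (comp_ins G X i)) = open_wires G X Y (insert i (set L0))"
proof -
  have pa: "Edge p i \<in> set (comp_ins G X i)" if "(p, i) \<in> effect_arcs G X Y" for p
    using that proper_arcs_verts[OF odag] by (auto simp: comp_ins_def effect_arcs_iff set_pa parents_def)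
  have ii: "(i, i) \<notin> effect_arcs G X Y" by (auto simp: effect_arcs_iff proper_arcs_def)
  have ins: "w \<in> set (comp_ins G X i) \<Longrightarrow> w = In i \<or> (\<exists>p. w = Edge p i)" for w
    by (auto simp: comp_ins_def split: if_splits)
  have inX: "i \<in> X \<Longrightarrow> In i \<in> set (comp_ins G X i)" by (simp add: comp_ins_def)
  show ?thesis
    unfolding set_comp_outs
    using pa ii ins inX child_after fresh by (auto simp: open_wires_def)
qed

lemma comp_outs_fresh: "set (comp_outs G X Y i) \<inter> open_wires G X Y (set L0) = {}"
  unfolding set_comp_outs using fresh by (auto simp: open_wires_def)

lemma distinct_comp: "distinct (comp_outs G X Y i)" "distinct (comp_ins G X i)"
  using distinct_listing[OF odag]
  by (auto simp: comp_outs_def comp_ins_def effect_children_def pa_def distinct_map inj_on_def)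

end

section \<open>Images of causal effects under strict functors\<close>

text \<open>Distinctness of the image of the vertex list says that the words assigned to vertices
  have no repeated letters and are pairwise disjoint, so that letters name values
  unambiguously.\<close>

locale word_functor = strict_markov_functor "Fm G" C F + word_markov C V
  for G :: "'u odag" and C :: "('v list, 'a) markov" (structure)
    and F :: "('u list, 'u mterm set, 'v list, 'a) mfunctor" and V :: "'v set" +
  assumes odag: "odag G" and distinct_OMap: "distinct (OMap F (verts G))"
begin

lemma AMap_TensA:
  assumes "f \<in> Arr (Fm G)" "g \<in> Arr (Fm G)"
  shows "AMap F (f \<odot>\<^bsub>Fm G\<^esub> g) = AMap F f \<odot> AMap F g"
  using Mu_natural_arr[of f g "Cod (Fm G) f" "Cod (Fm G) g"] assms OMap_TensO
  by (simp add: Mu_strict AMap_arr)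

lemma OMap_append:
  "set a \<subseteq> set (verts G) \<Longrightarrow> set b \<subseteq> set (verts G) \<Longrightarrow> OMap F (a @ b) = OMap F a @ OMap F b"
  using OMap_TensO[of a b] by simp

lemma OMap_subset [simp]: "set a \<subseteq> set (verts G) \<Longrightarrow> set (OMap F a) \<subseteq> V"
  using OMap_in[of a] by simp

definition vty :: "'u \<Rightarrow> 'v list" where
  "vty i = OMap F [i]"

sublocale mechanisms C V "set (verts G)" vty "\<lambda>i. OMap F (pa G i)" "\<lambda>i. AMap F (kappa G i)"
  by unfold_locales (simp_all add: AMap_arr vty_def)

lemma OMap_word: "set a \<subseteq> set (verts G) \<Longrightarrow> OMap F a = tys a"
proof (induction a)
  case Nil
  then show ?case using OMap_Unit by simp
next
  case (Cons x a)
  then show ?case using OMap_append[of "[x]" a] by (simp add: vty_def[symmetric])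
qed

lemma tys_subset [simp]: "set a \<subseteq> set (verts G) \<Longrightarrow> set (tys a) \<subseteq> V"
  using OMap_subset[of a] by (simp add: OMap_word)

lemma set_tys: "set (tys a) = (\<Union>i\<in>set a. set (vty i))"
  by (simp add: tys_def)

lemma AMap_Swap:
  assumes "set a \<subseteq> set (verts G)" "set b \<subseteq> set (verts G)"
  shows "AMap F (Swap (Fm G) a b) = Swap C (tys a) (tys b)"
  using Mu_Swap[of a b] assms by (simp add: Mu_strict OMap_append OMap_word AMap_arr)

lemma AMap_iterated_dup:
  assumes "i \<in> set (verts G)"
  shows "AMap F (iterated_dup (Fm G) [i] m) = iterated_dup C (vty i) m"
proof (induction m rule: induct_nat_012)
  case 0
  then show ?case using AMap_Disc[of "[i]"] assms OMap_Unit by (simp add: Eta_strict OMap_word)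
next
  case 1
  then show ?case using AMap_Ide[of "[i]"] assms by (simp add: OMap_word)
next
  case (ge2 m)
  have "AMap F (Dup (Fm G) [i]) = Dup C (vty i)"
    using AMap_Dup[of "[i]"] assms by (simp add: Mu_strict OMap_word)
  then show ?case
    using ge2 assms iterated_dup_arr[OF assms, of "Suc m"]
    by (simp add: AMap_Cmp_arr AMap_TensA AMap_Ide OMap_word)
qed

lemma distinct_tys_verts: "distinct (tys (verts G))"
  using distinct_OMap by (simp add: OMap_word)

lemma distinct_ty: "i \<in> set (verts G) \<Longrightarrow> distinct (vty i)"
  using distinct_tys_verts split_list[of i "verts G"] by auto

lemma disjoint_ty:
  assumes "i \<in> set (verts G)" "j \<in> set (verts G)" "i \<noteq> j"
  shows "set (vty i) \<inter> set (vty j) = {}"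
proof -
  obtain us vs where v: "verts G = us @ i # vs" using split_list[OF assms(1)] by blast
  then have "j \<in> set us \<or> j \<in> set vs" using assms by auto
  then have "set (vty j) \<subseteq> set (tys us) \<union> set (tys vs)" by (auto simp: set_tys)
  moreover have "set (vty i) \<inter> (set (tys us) \<union> set (tys vs)) = {}"
    using distinct_tys_verts unfolding v by auto
  ultimately show ?thesis by blast
qed

lemma distinct_tys:
  assumes "distinct a" "set a \<subseteq> set (verts G)" shows "distinct (tys a)"
  using assms
proof (induction a)
  case (Cons i a)
  then have "set (vty i) \<inter> set (tys a) = {}"
    using disjoint_ty by (fastforce simp: set_tys)
  then show ?case using Cons distinct_ty by simp
qed simp

lemma tys_disjoint:
  assumes "set b \<subseteq> set (verts G)" "i \<in> set (verts G)" "i \<notin> set b"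
  shows "set (vty i) \<inter> set (tys b) = {}"
  using assms disjoint_ty by (fastforce simp: set_tys)

text \<open>A symmetry is evaluated only after a selection, where every swap exchanges the halves of
  a pair and the result is again a selection. Wires are distinct, but several of them may carry the
  same vertex; selections tolerate these repetitions.\<close>

lemma permute_wires_arr:
  assumes "distinct ws" "distinct ws'" "set ws' = set ws" "wire_name ` set ws \<subseteq> set (verts G)"
  shows "permute_wires (Fm G) wire_ty ws ws' \<in> Arr (Fm G)"
    "Dom (Fm G) (permute_wires (Fm G) wire_ty ws ws') = map wire_name ws"
    "Cod (Fm G) (permute_wires (Fm G) wire_ty ws ws') = map wire_name ws'"
    "\<lbrakk>set a \<subseteq> V; set (tys (map wire_name ws)) \<subseteq> set a\<rbrakk> \<Longrightarrow>
      AMap F (permute_wires (Fm G) wire_ty ws ws') \<cdot> sel a (tys (map wire_name ws)) = sel a (tys (map wire_name ws'))"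
proof -
  have "permute_wires (Fm G) wire_ty ws ws' \<in> Arr (Fm G) \<and>
    Dom (Fm G) (permute_wires (Fm G) wire_ty ws ws') = map wire_name ws \<and>
    Cod (Fm G) (permute_wires (Fm G) wire_ty ws ws') = map wire_name ws' \<and>
    (\<forall>a. set a \<subseteq> V \<longrightarrow> set (tys (map wire_name ws)) \<subseteq> set a \<longrightarrow>
      AMap F (permute_wires (Fm G) wire_ty ws ws') \<cdot> sel a (tys (map wire_name ws)) = sel a (tys (map wire_name ws')))"
    using assms
  proof (induction ws' arbitrary: ws)
    case Nil
    then show ?case using OMap_Unit by (simp add: wires_obj_names AMap_Ide Disc_nat)
  next
    case (Cons w ws')
    define as bs where "as = takeWhile (\<lambda>x. x \<noteq> w) ws" and "bs = tl (dropWhile (\<lambda>x. x \<noteq> w) ws)"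
    have "w \<in> set ws" using Cons.prems by auto
    then have "dropWhile (\<lambda>x. x \<noteq> w) ws = w # bs"
      unfolding bs_def by (induction ws) auto
    then have ws: "ws = as @ w # bs" unfolding as_def by (metis takeWhile_dropWhile_id)
    let ?p = "permute_wires (Fm G) wire_ty (as @ bs) ws'"
    let ?A = "map wire_name as" and ?B = "map wire_name bs" and ?w = "wire_name w"
    have V: "set ?A \<subseteq> set (verts G)" "set ?B \<subseteq> set (verts G)" "?w \<in> set (verts G)"
      using Cons.prems(4) unfolding ws by auto
    have "set ws' = set (as @ bs)" using Cons.prems unfolding ws by auto
    then have IH: "?p \<in> Arr (Fm G)" "Dom (Fm G) ?p = ?A @ ?B" "Cod (Fm G) ?p = map wire_name ws'"
      "\<And>a. set a \<subseteq> V \<Longrightarrow> set (tys (?A @ ?B)) \<subseteq> set a \<Longrightarrow>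
        AMap F ?p \<cdot> sel a (tys (?A @ ?B)) = sel a (tys (map wire_name ws'))"
      using Cons.IH[of "as @ bs"] Cons.prems unfolding ws by auto
    have p: "permute_wires (Fm G) wire_ty ws (w # ws') =
      (Ide (Fm G) [?w] \<odot>\<^bsub>Fm G\<^esub> ?p) \<cdot>\<^bsub>Fm G\<^esub> (Swap (Fm G) ?A [?w] \<odot>\<^bsub>Fm G\<^esub> Ide (Fm G) ?B)"
      by (simp add: Let_def as_def[symmetric] bs_def[symmetric] wires_obj_names wire_ty_name)
    have "AMap F (permute_wires (Fm G) wire_ty ws (w # ws')) \<cdot> sel a (tys (map wire_name ws))
        = sel a (tys (map wire_name (w # ws')))"
      if a: "set a \<subseteq> V" "set (tys (map wire_name ws)) \<subseteq> set a" for a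
    proof -
      let ?tA = "tys ?A" and ?tB = "tys ?B" and ?tw = "vty ?w"
      have sub: "set ?tA \<subseteq> set a" "set ?tB \<subseteq> set a" "set ?tw \<subseteq> set a"
        using a(2) unfolding ws by auto
      have sV: "set ?tA \<subseteq> V" "set ?tB \<subseteq> V" "set ?tw \<subseteq> V" using V by simp_all
      have tp: "AMap F ?p \<in> Arr C" "Dom C (AMap F ?p) = ?tA @ ?tB"
          "Cod C (AMap F ?p) = tys (map wire_name ws')"
        using IH(1-3) V C.Cod_in[OF IH(1)] by (simp_all add: AMap_arr OMap_word)
      have "AMap F (permute_wires (Fm G) wire_ty ws (w # ws'))
         = (Ide C ?tw \<odot> AMap F ?p) \<cdot> (Swap C ?tA ?tw \<odot> Ide C ?tB)"
        unfolding p using V IH by (simp add: AMap_Cmp_arr AMap_TensA AMap_Ide AMap_Swap OMap_word)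
      moreover have "sel a (tys (map wire_name ws)) = pair (pair (sel a ?tA) (sel a ?tw)) (sel a ?tB)"
        using a sub by (simp add: ws sel_append pair_assoc)
      moreover have "(Swap C ?tA ?tw \<odot> Ide C ?tB) \<cdot> pair (pair (sel a ?tA) (sel a ?tw)) (sel a ?tB)
         = pair (pair (sel a ?tw) (sel a ?tA)) (sel a ?tB)"
        using a sub sV by (simp add: TensA_pair Swap_pair)
      moreover have "\<dots> = pair (sel a ?tw) (sel a (tys (?A @ ?B)))"
        using a sub by (simp add: sel_append pair_assoc)
      moreover have "(Ide C ?tw \<odot> AMap F ?p) \<cdot> \<dots> = pair (sel a ?tw) (AMap F ?p \<cdot> sel a (tys (?A @ ?B)))"
        using a sub sV tp by (subst TensA_pair) simp_all
      moreover have "\<dots> = sel a (tys (map wire_name (w # ws')))"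
      proof -
        have "set (tys (map wire_name ws')) \<subseteq> set a"
          using a(2) Cons.prems(3) by (auto simp: set_tys)
        then show ?thesis using a sub IH(4)[OF a(1)] by (simp add: sel_append)
      qed
      ultimately show ?thesis using a sub sV tp by simp
    qed
    moreover have "map wire_name ws = ?A @ ?w # ?B" unfolding ws by simp
    ultimately show ?case using V IH by (simp only: p) simp
  qed
  then show "permute_wires (Fm G) wire_ty ws ws' \<in> Arr (Fm G)"
    "Dom (Fm G) (permute_wires (Fm G) wire_ty ws ws') = map wire_name ws"
    "Cod (Fm G) (permute_wires (Fm G) wire_ty ws ws') = map wire_name ws'"
    "\<lbrakk>set a \<subseteq> V; set (tys (map wire_name ws)) \<subseteq> set a\<rbrakk> \<Longrightarrow>
      AMap F (permute_wires (Fm G) wire_ty ws ws') \<cdot> sel a (tys (map wire_name ws)) = sel a (tys (map wire_name ws'))"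
    by blast+
qed

text \<open>The copies made by a component are a selection from one block of letters. This separates
  the single value, an input or the result of a mechanism, from its distribution to the output
  wires.\<close>

lemma AMap_Gamma_sel:
  assumes "i \<in> set (verts G)" "set a \<subseteq> V" "set (tys (map wire_name (comp_ins G X i))) \<subseteq> set a"
  shows "AMap F (Gamma G X Y i) \<cdot> sel a (tys (map wire_name (comp_ins G X i))) =
    sel (vty i) (tys (map wire_name (comp_outs G X Y i))) \<cdot>
      (if i \<in> X then sel a (vty i) else AMap F (kappa G i) \<cdot> sel a (OMap F (pa G i)))"
proof -
  let ?m = "length (comp_outs G X Y i)"
  have t: "tys (replicate m i) = concat (replicate m (vty i))" for m by (simp add: tys_def)
  have d: "AMap F (iterated_dup (Fm G) [i] ?m) = sel (vty i) (tys (map wire_name (comp_outs G X Y i)))"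
    unfolding names_comp_outs using assms(1)
    by (simp add: AMap_iterated_dup iterated_dup_sel distinct_ty t)
  have s: "set (tys (map wire_name (comp_outs G X Y i))) \<subseteq> set (vty i)"
    unfolding names_comp_outs by (auto simp: set_tys split: if_splits)
  have V: "set (vty i) \<subseteq> V" using assms(1) by simp
  show ?thesis
  proof (cases "i \<in> X")
    case True
    then show ?thesis using d by (simp add: Gamma_eq Let_def names_comp_ins)
  next
    case False
    then have i: "tys (map wire_name (comp_ins G X i)) = OMap F (pa G i)"
      by (simp add: names_comp_ins OMap_word)
    have "AMap F (Gamma G X Y i) = sel (vty i) (tys (map wire_name (comp_outs G X Y i))) \<cdot> AMap F (kappa G i)"
      using False assms(1) iterated_dup_arr[OF assms(1), of ?m] d
      by (simp add: Gamma_eq Let_def AMap_Cmp_arr)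
    then show ?thesis using False i assms V s by simp
  qed
qed

text \<open>The invariant is that the wires present are a selection from the word \<open>a\<close>
  of values kept so far. A component of a vertex in \<open>X\<close> only copies, so
  \<open>a\<close> stays; any other one appends its value to \<open>a\<close>, which is why
  \<open>a\<close> is quantified in the induction. Values still to be computed must have letters
  outside \<open>a\<close>, since otherwise an old value would be read in their place.\<close>

lemma diagram_run:
  assumes "X \<subseteq> set (verts G)" "Y \<subseteq> set (verts G)"
    "listing G (effect_verts G X Y) = L0 @ L" "distinct ws" "set ws = open_wires G X Y (set L0)"
  shows "diagram (Fm G) wire_ty ws (map (component G X Y) L) (map Out (listing G Y)) \<in> Arr (Fm G) \<and>
    Dom (Fm G) (diagram (Fm G) wire_ty ws (map (component G X Y) L) (map Out (listing G Y))) = map wire_name ws \<and>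
    Cod (Fm G) (diagram (Fm G) wire_ty ws (map (component G X Y) L) (map Out (listing G Y))) = listing G Y \<and>
    (\<forall>a. set a \<subseteq> V \<longrightarrow> set (tys (map wire_name ws)) \<subseteq> set a \<longrightarrow>
      (\<forall>i\<in>set L - X. set (vty i) \<inter> set a = {}) \<longrightarrow>
      runnable a (filter (\<lambda>i. i \<notin> X) L) \<and>
      set (tys (listing G Y)) \<subseteq> set (a @ tys (filter (\<lambda>i. i \<notin> X) L)) \<and>
      AMap F (diagram (Fm G) wire_ty ws (map (component G X Y) L) (map Out (listing G Y))) \<cdot> sel a (tys (map wire_name ws))
      = sel (a @ tys (filter (\<lambda>i. i \<notin> X) L)) (tys (listing G Y)) \<cdot> run a (filter (\<lambda>i. i \<notin> X) L))"
  using assms(3-)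
proof (induction L arbitrary: L0 ws)
  case Nil
  \<comment> \<open>With all components applied, no input and no edge is left open, and only a
    permutation of the output wires remains.\<close>
  have E: "set L0 = effect_verts G X Y"
  proof -
    have "set (listing G (effect_verts G X Y)) = set L0" unfolding Nil(1) by simp
    then show ?thesis using effect_verts_subset[OF odag assms(1,2)] by auto
  qed
  have "open_wires G X Y (set L0) = Out ` Y"
    unfolding E by (auto simp: open_wires_def effect_arcs_iff effect_verts_def)
  then have ws: "set (map Out (listing G Y)) = set ws" using Nil assms(2) by auto
  have n: "map wire_name (map Out (listing G Y)) = listing G Y" by (simp add: comp_def)
  have d: "distinct (map Out (listing G Y))" using distinct_listing[OF odag] by (simp add: distinct_map inj_on_def)
  have nv: "wire_name ` set ws \<subseteq> set (verts G)"
    using assms(2) unfolding ws[symmetric] by auto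
  have "set (map wire_name ws) = set (map wire_name (map Out (listing G Y)))"
    unfolding set_map[of wire_name] ws ..
  then have s: "set (tys (map wire_name ws)) = set (tys (listing G Y))"
    unfolding set_tys n by (simp only:)
  note p = permute_wires_arr[OF Nil(2) d ws nv, unfolded n]
  show ?case
    using p(1-3) p(4) s by (simp del: set_listing)
next
  case (Cons i L)
  interpret effect_listing G X Y L0 i L
    using odag assms(1,2) Cons.prems(1) by unfold_locales
  let ?is = "comp_ins G X i" and ?os = "comp_outs G X Y i" and ?outs = "map Out (listing G Y)"
  define rest where "rest = filter (\<lambda>w. w \<notin> set ?is) ws"
  have isub: "set ?is \<subseteq> set ws" using comp_ins_open Cons.prems(3) by simp
  have d1: "distinct (?is @ rest)" using distinct_comp Cons.prems(2) by (auto simp: rest_def)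
  have s1: "set (?is @ rest) = set ws" using isub by (auto simp: rest_def)
  have d2: "distinct (?os @ rest)"
  proof -
    have "set rest \<subseteq> open_wires G X Y (set L0)" unfolding rest_def Cons.prems(3)[symmetric] by auto
    then have "set ?os \<inter> set rest = {}" using comp_outs_fresh by blast
    then show ?thesis using distinct_comp(1) Cons.prems(2) by (simp add: rest_def)
  qed
  have s2: "set (?os @ rest) = open_wires G X Y (set (L0 @ [i]))"
  proof -
    have "set rest = open_wires G X Y (set L0) - set ?is" unfolding rest_def Cons.prems(3)[symmetric] by auto
    then show ?thesis using open_wires_step by simp
  qed
  have nv: "wire_name ` set ws \<subseteq> set (verts G)"
  proof -
    have "i \<in> set (verts G)" if "(i, k) \<in> effect_arcs G X Y" for i k
      using that proper_arcs_verts[OF odag] unfolding effect_arcs_iff by blast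
    then show ?thesis
      unfolding Cons.prems(3) open_wires_def using assms(1,2) by auto
  qed
  have rv: "set (map wire_name rest) \<subseteq> set (verts G)" using nv by (auto simp: rest_def)
  let ?p = "permute_wires (Fm G) wire_ty ws (?is @ rest)"
  let ?d = "diagram (Fm G) wire_ty (?os @ rest) (map (component G X Y) L) ?outs"
  let ?D = "diagram (Fm G) wire_ty ws (map (component G X Y) (i # L)) ?outs"
  let ?R = "map wire_name rest" and ?I = "map wire_name ?is" and ?O = "map wire_name ?os"
  have D: "?D = ?d \<cdot>\<^bsub>Fm G\<^esub> (Gamma G X Y i \<odot>\<^bsub>Fm G\<^esub> Ide (Fm G) ?R) \<cdot>\<^bsub>Fm G\<^esub> ?p"
    by (simp add: component_eq Let_def rest_def[symmetric] wires_obj_names)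
  note p = permute_wires_arr[OF Cons.prems(2) d1 s1 nv]
  have IH: "?d \<in> Arr (Fm G)" "Dom (Fm G) ?d = ?O @ ?R" "Cod (Fm G) ?d = listing G Y"
    and IH4: "\<And>a. \<lbrakk>set a \<subseteq> V; set (tys (?O @ ?R)) \<subseteq> set a; \<forall>i\<in>set L - X. set (vty i) \<inter> set a = {}\<rbrakk> \<Longrightarrow>
      runnable a (filter (\<lambda>i. i \<notin> X) L) \<and>
      set (tys (listing G Y)) \<subseteq> set (a @ tys (filter (\<lambda>i. i \<notin> X) L)) \<and>
      AMap F ?d \<cdot> sel a (tys (?O @ ?R))
      = sel (a @ tys (filter (\<lambda>i. i \<notin> X) L)) (tys (listing G Y)) \<cdot> run a (filter (\<lambda>i. i \<notin> X) L)"
    using Cons.IH[of "L0 @ [i]" "?os @ rest"] Cons.prems(1) d2 s2 by simp_all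
  note g = Gamma_arr[OF vert(1), of X Y]
  have Ov: "set ?O \<subseteq> set (verts G)" using g(3) C.Cod_in[OF g(1)] by simp
  have Iv: "set ?I \<subseteq> set (verts G)" using g(2) C.Dom_in[OF g(1)] by simp
  have ty: "?D \<in> Arr (Fm G)" "Dom (Fm G) ?D = map wire_name ws" "Cod (Fm G) ?D = listing G Y"
    unfolding D using p(1-3) IH g rv by simp_all
  have AD: "AMap F ?D = AMap F ?d \<cdot> (AMap F (Gamma G X Y i) \<odot> Ide C (tys ?R)) \<cdot> AMap F ?p"
    unfolding D using p(1-3) IH g rv
    by (simp add: AMap_Cmp_arr AMap_TensA AMap_Ide OMap_word)
  have tg: "AMap F (Gamma G X Y i) \<in> Arr C" "Dom C (AMap F (Gamma G X Y i)) = tys ?I"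
      "Cod C (AMap F (Gamma G X Y i)) = tys ?O"
    using g Ov Iv by (simp_all add: AMap_arr OMap_word)
  have td: "AMap F ?d \<in> Arr C" "Dom C (AMap F ?d) = tys ?O @ tys ?R"
      "Cod C (AMap F ?d) = tys (listing G Y)"
    using IH Ov rv by (simp_all add: AMap_arr OMap_word)
  have nws: "set (map wire_name ws) \<subseteq> set (verts G)" using nv by auto
  have tp: "AMap F ?p \<in> Arr C" "Dom C (AMap F ?p) = tys (map wire_name ws)"
      "Cod C (AMap F ?p) = tys ?I @ tys ?R"
    using p nws Iv rv by (simp_all add: AMap_arr OMap_word)
  have Oi: "set (tys ?O) \<subseteq> set (vty i)"
    unfolding names_comp_outs by (auto simp: set_tys split: if_splits)
  have iV: "set (vty i) \<subseteq> V" using vert by simp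
  show ?case
  proof (intro conjI ty allI impI)
    fix a assume a: "set a \<subseteq> V" "set (tys (map wire_name ws)) \<subseteq> set a"
      "\<forall>j\<in>set (i # L) - X. set (vty j) \<inter> set a = {}"
    have sI: "set (tys ?I) \<subseteq> set a" and sR: "set (tys ?R) \<subseteq> set a"
      using a(2) isub unfolding set_tys by (auto simp: rest_def)
    let ?N = "filter (\<lambda>i. i \<notin> X) L" and ?N' = "filter (\<lambda>i. i \<notin> X) (i # L)"
    let ?g = "AMap F (Gamma G X Y i)"
    have "AMap F ?D \<cdot> sel a (tys (map wire_name ws))
      = AMap F ?d \<cdot> (?g \<odot> Ide C (tys ?R)) \<cdot> (AMap F ?p \<cdot> sel a (tys (map wire_name ws)))"
      unfolding AD using a(1,2) td tg tp rv by simp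
    also have "AMap F ?p \<cdot> sel a (tys (map wire_name ws)) = pair (sel a (tys ?I)) (sel a (tys ?R))"
      using p(4)[OF a(1,2)] a(1) sI sR by (simp add: sel_append)
    also have "(?g \<odot> Ide C (tys ?R)) \<cdot> \<dots> = pair (?g \<cdot> sel a (tys ?I)) (sel a (tys ?R))"
      using a(1) sI sR tg rv by (simp add: TensA_pair)
    finally have 1: "AMap F ?D \<cdot> sel a (tys (map wire_name ws)) = AMap F ?d \<cdot> pair (?g \<cdot> sel a (tys ?I)) (sel a (tys ?R))" .
    have "runnable a ?N' \<and> set (tys (listing G Y)) \<subseteq> set (a @ tys ?N') \<and>
      AMap F ?d \<cdot> pair (?g \<cdot> sel a (tys ?I)) (sel a (tys ?R)) = sel (a @ tys ?N') (tys (listing G Y)) \<cdot> run a ?N'"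
    proof (cases "i \<in> X")
      case True
      then have I: "tys ?I = vty i" by (simp add: names_comp_ins)
      have sO: "set (tys ?O) \<subseteq> set a" using Oi sI I by auto
      have "?g \<cdot> sel a (tys ?I) = sel (vty i) (tys ?O) \<cdot> sel a (vty i)"
        using AMap_Gamma_sel[OF vert(1) a(1) sI] True by simp
      also have "\<dots> = sel a (tys ?O)" using sel_sel[OF a(1) _ Oi] sI I by simp
      finally have "pair (?g \<cdot> sel a (tys ?I)) (sel a (tys ?R)) = sel a (tys (?O @ ?R))"
        using a(1) sO sR by (simp add: sel_append)
      then show ?thesis using IH4[of a] a sO sR True by simp
    next
      case False
      then have I: "tys ?I = OMap F (pa G i)" by (simp add: names_comp_ins OMap_word)
      let ?k = "AMap F (kappa G i) \<cdot> sel a (OMap F (pa G i))" and ?a = "a @ vty i"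
      have k: "?k \<in> Arr C" "Dom C ?k = a" "Cod C ?k = vty i"
        using sI a(1) vert I by simp_all
      have di: "set a \<inter> set (vty i) = {}" using a(3) False by auto
      have "?g \<cdot> sel a (tys ?I) = sel (vty i) (tys ?O) \<cdot> ?k"
        using AMap_Gamma_sel[OF vert(1) a(1) sI] False by simp
      moreover have "set a \<inter> set (tys ?O) = {}" using di Oi by blast
      \<comment> \<open>The copies \<open>?O\<close> come from the new value and \<open>?R\<close>
        from old ones, which turns the pair into a selection after one step of the run.\<close>
      ultimately have 2: "pair (?g \<cdot> sel a (tys ?I)) (sel a (tys ?R)) = sel ?a (tys (?O @ ?R)) \<cdot> step a i"
        using sel_pair_Ide_swap[OF a(1) k sR Oi] by (simp only: step_def tys_simps)
      have s: "set (tys (?O @ ?R)) \<subseteq> set ?a" using Oi sR by auto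
      have aV: "set ?a \<subseteq> V" using a(1) iV by simp
      have "\<forall>j\<in>set L - X. set (vty j) \<inter> set ?a = {}"
      proof
        fix j assume j: "j \<in> set L - X"
        have "j \<in> set (listing G (effect_verts G X Y))" unfolding split using j by simp
        then have "set (vty j) \<inter> set (vty i) = {}"
          using disjoint_ty[of j i] vert fresh j by auto
        then show "set (vty j) \<inter> set ?a = {}" using a(3) j by auto
      qed
      from IH4[OF aV s this]
      have r: "runnable ?a ?N" "set (tys (listing G Y)) \<subseteq> set (?a @ tys ?N)"
        and e: "AMap F ?d \<cdot> sel ?a (tys (?O @ ?R)) = sel (?a @ tys ?N) (tys (listing G Y)) \<cdot> run ?a ?N"
        by blast+
      have st: "step a i \<in> Arr C" "Dom C (step a i) = a" "Cod C (step a i) = ?a"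
        using a(1) vert sI I by simp_all
      have rn: "run ?a ?N \<in> Arr C" "Dom C (run ?a ?N) = ?a" "Cod C (run ?a ?N) = ?a @ tys ?N"
        using aV r by (simp_all only: run_arr)
      have aV': "set (?a @ tys ?N) \<subseteq> V" using aV runnable_subset[OF r(1)] by simp
      have "AMap F ?d \<cdot> (sel ?a (tys (?O @ ?R)) \<cdot> step a i) = (AMap F ?d \<cdot> sel ?a (tys (?O @ ?R))) \<cdot> step a i"
        using td st aV s by (intro D.assoc_arr[symmetric]) (simp_all del: set_append)
      also have "\<dots> = sel (?a @ tys ?N) (tys (listing G Y)) \<cdot> (run ?a ?N \<cdot> step a i)"
        unfolding e using st rn aV' r(2) by (intro D.assoc_arr) (simp_all only: sel_arr)
      finally show ?thesis
        using 2 r sI I False vert by simp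
    qed
    with 1 show "runnable a ?N'" "set (tys (listing G Y)) \<subseteq> set (a @ tys ?N')"
      "AMap F ?D \<cdot> sel a (tys (map wire_name ws)) = sel (a @ tys ?N') (tys (listing G Y)) \<cdot> run a ?N'"
      by simp_all
  qed
qed

lemma causal_effect_run:
  assumes "X \<subseteq> set (verts G)" "Y \<subseteq> set (verts G)"
  defines "N \<equiv> listing G (effect_verts G X Y - X)"
  shows "causal_effect G Y X \<in> Arr (Fm G)"
    "Dom (Fm G) (causal_effect G Y X) = listing G X"
    "Cod (Fm G) (causal_effect G Y X) = listing G Y"
    "runnable (tys (listing G X)) N"
    "set (tys (listing G Y)) \<subseteq> set (tys (listing G X) @ tys N)"
    "AMap F (causal_effect G Y X) = sel (tys (listing G X) @ tys N) (tys (listing G Y)) \<cdot> run (tys (listing G X)) N"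
proof -
  let ?L = "listing G (effect_verts G X Y)" and ?ws = "map In (listing G X)" and ?a = "tys (listing G X)"
  have N: "filter (\<lambda>i. i \<notin> X) ?L = N" unfolding N_def listing_def by (auto intro: filter_cong)
  have n: "map wire_name ?ws = listing G X" by (simp add: comp_def)
  have d: "distinct ?ws" using distinct_listing[OF odag] by (simp add: distinct_map inj_on_def)
  have s: "set ?ws = open_wires G X Y (set [])" using assms(1) by (auto simp: open_wires_def)
  have aV: "set ?a \<subseteq> V" using assms(1) by simp
  have disj: "\<forall>i\<in>set ?L - X. set (vty i) \<inter> set ?a = {}"
    using tys_disjoint[of "listing G X"] by auto
  \<comment> \<open>At the start no component has been applied and the kept word is that of
    \<open>X\<close> itself, whose selection from itself is an identity.\<close>
  note r = diagram_run[OF assms(1,2) _ d s, of ?L, simplified, folded causal_effect_def, unfolded N n comp_def]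
  have self: "sel ?a ?a = Ide C ?a"
    using sel_self[OF aV distinct_tys] distinct_listing[OF odag] assms(1) by simp
  show ce: "causal_effect G Y X \<in> Arr (Fm G)" "Dom (Fm G) (causal_effect G Y X) = listing G X"
    "Cod (Fm G) (causal_effect G Y X) = listing G Y"
    using r by simp_all
  have "AMap F (causal_effect G Y X) \<cdot> sel ?a ?a = AMap F (causal_effect G Y X)"
    using ce self assms(1) by (simp add: AMap_arr OMap_word)
  then show "runnable ?a N" "set (tys (listing G Y)) \<subseteq> set (?a @ tys N)"
    "AMap F (causal_effect G Y X) = sel (?a @ tys N) (tys (listing G Y)) \<cdot> run ?a N"
    using r aV disj by auto
qed

end

section \<open>Preimages of words\<close>

lemma filter_prefix:
  assumes "sorted_wrt (\<lambda>u v. P v \<longrightarrow> P u) xs"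
  shows "xs = filter P xs @ filter (\<lambda>x. \<not> P x) xs"
  using assms
proof (induction xs)
  case (Cons x xs)
  show ?case
  proof (cases "P x")
    case True
    then show ?thesis using Cons by simp
  next
    case False
    then have "filter P xs = []" using Cons.prems by (auto simp: filter_empty_conv)
    then show ?thesis using False Cons by simp
  qed
qed simp

text \<open>By monotonicity the elements sent to the first entry \<open>g\<close> form an initial
  segment of \<open>hs\<close>; it is split off and the rest is treated by induction.\<close>

lemma concat_fibres:
  assumes "distinct gs" "f ` set hs \<subseteq> set gs"
    "sorted_wrt (\<lambda>u v. \<exists>i j. i \<le> j \<and> j < length gs \<and> gs ! i = f u \<and> gs ! j = f v) hs"
  shows "concat (map (\<lambda>v. filter (\<lambda>u. f u = v) hs) (filter P gs)) = filter (\<lambda>u. P (f u)) hs"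
  using assms
proof (induction gs arbitrary: hs)
  case (Cons g gs)
  let ?h1 = "filter (\<lambda>u. f u = g) hs" and ?h2 = "filter (\<lambda>u. f u \<noteq> g) hs"
  have "sorted_wrt (\<lambda>u v. f v = g \<longrightarrow> f u = g) hs"
  proof (rule sorted_wrt_mono_rel[OF _ Cons.prems(3)], intro impI)
    fix u v assume *: "\<exists>i j. i \<le> j \<and> j < length (g # gs) \<and> (g # gs) ! i = f u \<and> (g # gs) ! j = f v" "f v = g"
    then obtain i j where ij: "i \<le> j" "j < length (g # gs)" "(g # gs) ! i = f u" "(g # gs) ! j = g" by auto
    \<comment> \<open>The head of a distinct list occurs at position 0 only, and
      \<open>i \<le> j\<close> then leaves no other position for \<open>f u\<close>.\<close>
    then have "j = 0" using Cons.prems(1) by (cases j) auto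
    then show "f u = g" using ij by simp
  qed
  from filter_prefix[OF this] have h: "hs = ?h1 @ ?h2" .
  have "sorted_wrt (\<lambda>u v. \<exists>i j. i \<le> j \<and> j < length gs \<and> gs ! i = f u \<and> gs ! j = f v) ?h2"
  proof (rule sorted_wrt_mono_rel[OF _ sorted_wrt_filter[OF Cons.prems(3)]])
    fix u v assume uv: "u \<in> set ?h2" "v \<in> set ?h2"
      "\<exists>i j. i \<le> j \<and> j < length (g # gs) \<and> (g # gs) ! i = f u \<and> (g # gs) ! j = f v"
    then obtain i j where ij: "i \<le> j" "j < length (g # gs)" "(g # gs) ! i = f u" "(g # gs) ! j = f v" by blast
    then obtain i' where i': "i = Suc i'" using uv(1) by (cases i) auto
    then obtain j' where j': "j = Suc j'" using ij(1) by (cases j) auto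
    show "\<exists>i j. i \<le> j \<and> j < length gs \<and> gs ! i = f u \<and> gs ! j = f v"
      using ij unfolding i' j' by (intro exI[of _ i'] exI[of _ j']) simp
  qed
  moreover have "f ` set ?h2 \<subseteq> set gs" using Cons.prems(2) by auto
  ultimately have IH: "concat (map (\<lambda>v. filter (\<lambda>u. f u = v) ?h2) (filter P gs)) = filter (\<lambda>u. P (f u)) ?h2"
    using Cons.IH[of ?h2] Cons.prems(1) by simp
  have "filter (\<lambda>u. f u = v) ?h2 = filter (\<lambda>u. f u = v) hs" if "v \<in> set gs" for v
    using that Cons.prems(1) by (auto simp: intro!: filter_cong)
  then have IH': "concat (map (\<lambda>v. filter (\<lambda>u. f u = v) hs) (filter P gs)) = filter (\<lambda>u. P (f u)) ?h2"
    unfolding IH[symmetric] by (auto intro!: arg_cong[of _ _ concat])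
  have "filter (\<lambda>u. P (f u)) hs = filter (\<lambda>u. P (f u)) (?h1 @ ?h2)" using h by simp
  also have "\<dots> = (if P g then ?h1 else []) @ filter (\<lambda>u. P (f u)) ?h2"
    by (auto simp: filter_empty_conv intro!: filter_cong)
  finally show ?case using IH' by simp
qed simp

lemma listing_fibre_single: "listing (osrc \<phi>) (fibre \<phi> {v}) = filter (\<lambda>u. vmap \<phi> u = v) (verts (osrc \<phi>))"
  by (auto simp: listing_def fibre_def intro!: filter_cong)

lemma preimage_word_simps [simp]:
  "preimage_word \<phi> [] = []" "preimage_word \<phi> (a @ b) = preimage_word \<phi> a @ preimage_word \<phi> b"
  by (simp_all add: preimage_word_def)

lemma preimage_word_Cons: "preimage_word \<phi> (v # a) = listing (osrc \<phi>) (fibre \<phi> {v}) @ preimage_word \<phi> a"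
  by (simp add: preimage_word_def)

lemma set_preimage_word [simp]: "set (preimage_word \<phi> a) \<subseteq> set (verts (osrc \<phi>))"
  by (auto simp: preimage_word_def)

lemma fibre_subset [simp]: "fibre \<phi> X \<subseteq> set (verts (osrc \<phi>))"
  by (auto simp: fibre_def)

text \<open>Weak monotonicity of the morphism makes the concatenated fibres appear in the order of
  the source graph.\<close>

lemma preimage_word_listing:
  assumes "odag_mor \<phi>"
  shows "preimage_word \<phi> (listing (otgt \<phi>) X) = listing (osrc \<phi>) (fibre \<phi> X)"
proof -
  let ?G = "otgt \<phi>" and ?H = "osrc \<phi>"
  have "sorted_wrt (\<lambda>u v. vle ?G (vmap \<phi> u) (vmap \<phi> v)) (verts ?H)"
    unfolding sorted_wrt_iff_nth_less
  proof (intro allI impI)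
    fix i j assume ij: "i < j" "j < length (verts ?H)"
    then have "vle ?H (verts ?H ! i) (verts ?H ! j)"
      unfolding vle_def by (intro exI[of _ i] exI[of _ j]) simp
    then show "vle ?G (vmap \<phi> (verts ?H ! i)) (vmap \<phi> (verts ?H ! j))"
      using assms unfolding odag_mor_def by blast
  qed
  then have "concat (map (\<lambda>v. filter (\<lambda>u. vmap \<phi> u = v) (verts ?H)) (filter (\<lambda>v. v \<in> X) (verts ?G)))
      = filter (\<lambda>u. vmap \<phi> u \<in> X) (verts ?H)"
    using assms unfolding vle_def by (intro concat_fibres) (auto simp: odag_mor_def odag_def)
  then show ?thesis
    unfolding preimage_word_def listing_fibre_single
    by (auto simp: listing_def fibre_def intro!: filter_cong)
qed

section \<open>Strict functors\<close>

lemma strict_markov_functor_Ide: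
  assumes "markov_category C" shows "strict_markov_functor C C (Ide MarCat C)"
proof -
  interpret markov_functor C C "Ide MarCat C" by (rule markov_functor_Ide[OF assms])
  show ?thesis by unfold_locales (simp_all add: C.Unit_in C.TensO_in)
qed

lemma strict_markov_functor_Cmp:
  assumes "strict_markov_functor C D F" "strict_markov_functor D E G"
  shows "strict_markov_functor C E (Cmp MarCat G F)"
proof -
  interpret F: strict_markov_functor C D F by fact
  interpret G: strict_markov_functor D E G by fact
  interpret GF: markov_functor C E "Cmp MarCat G F"
    by (rule markov_functor_Cmp) unfold_locales
  show ?thesis
    by unfold_locales
      (simp_all add: compose_def F.Src G.Tgt F.C.Unit_in F.C.TensO_in F.D.Unit_in F.D.TensO_in G.D.Unit_in G.D.TensO_in
        F.OMap_Unit G.OMap_Unit F.OMap_TensO G.OMap_TensO F.OMap_in G.OMap_in F.Mu_strict G.Mu_strict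
        F.Eta_strict G.Eta_strict G.AMap_Ide G.D.Ide_arr G.D.Ide_left_arr)
qed

text \<open>Strictness determines \<open>Mu\<close> and \<open>Eta\<close>, and extensionality
  covers arguments off the domains.\<close>

lemma strict_markov_functor_eqI:
  assumes "strict_markov_functor C D F" "strict_markov_functor C D F'"
    and o: "\<And>a. a \<in> Obj C \<Longrightarrow> OMap F a = OMap F' a" and a: "\<And>f. f \<in> Arr C \<Longrightarrow> AMap F f = AMap F' f"
  shows "F = F'"
proof -
  interpret F: strict_markov_functor C D F by fact
  interpret F': strict_markov_functor C D F' by fact
  have "case_prod (Mu F) = case_prod (Mu F')"
    by (rule extensionalityI[OF F.Mu_ext F'.Mu_ext]) (auto simp: F.Mu_strict F'.Mu_strict o)
  then have "Mu F = Mu F'" by (auto simp: fun_eq_iff)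
  moreover have "OMap F = OMap F'" by (rule extensionalityI[OF F.OMap_ext F'.OMap_ext o])
  moreover have "AMap F = AMap F'" by (rule extensionalityI[OF F.AMap_ext F'.AMap_ext a])
  ultimately show ?thesis
    by (intro mfunctor.equality) (simp_all add: F.Src F'.Src F.Tgt F'.Tgt F.Eta_strict F'.Eta_strict)
qed

text \<open>Through the identity functor, results on images of causal effects speak about the causal
  effects themselves.\<close>

lemma word_functor_Ide:
  assumes "odag G" shows "word_functor G (Fm G) (Ide MarCat (Fm G)) (set (verts G))"
proof -
  interpret strict_markov_functor "Fm G" "Fm G" "Ide MarCat (Fm G)"
    by (rule strict_markov_functor_Ide[OF markov_category_Fm])
  show ?thesis
    using assms by unfold_locales (simp_all add: odag_def)
qed

lemma causal_effect_arr:
  assumes "odag G" "X \<subseteq> set (verts G)" "Y \<subseteq> set (verts G)"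
  shows "causal_effect G Y X \<in> Arr (Fm G)" "Dom (Fm G) (causal_effect G Y X) = listing G X"
    "Cod (Fm G) (causal_effect G Y X) = listing G Y"
proof -
  interpret word_functor G "Fm G" "Ide MarCat (Fm G)" "set (verts G)" by (rule word_functor_Ide[OF assms(1)])
  show "causal_effect G Y X \<in> Arr (Fm G)" "Dom (Fm G) (causal_effect G Y X) = listing G X"
    "Cod (Fm G) (causal_effect G Y X) = listing G Y"
    by (rule causal_effect_run(1)[OF assms(2,3)], rule causal_effect_run(2)[OF assms(2,3)],
      rule causal_effect_run(3)[OF assms(2,3)])
qed

section \<open>Existence and uniqueness of refinements\<close>

lemma parents_subset: "odag G \<Longrightarrow> parents G v \<subseteq> set (verts G)"
  by (auto simp: parents_def dest: proper_arcs_verts)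

text \<open>A representing term is chosen so that the image of \<open>Mech v\<close> can be
  substituted by recursion on terms.\<close>

definition mech_term :: "'v odag_mor \<Rightarrow> 'v \<Rightarrow> 'v mterm" where
  "mech_term \<phi> v = (SOME t. wt (osrc \<phi>) t \<and>
     causal_effect (osrc \<phi>) (fibre \<phi> {v}) (fibre \<phi> (parents (otgt \<phi>) v)) = cls (osrc \<phi>) t)"

primrec refine_term :: "'v odag_mor \<Rightarrow> 'v mterm \<Rightarrow> 'v mterm" where
  "refine_term \<phi> (Idn a) = Idn (preimage_word \<phi> a)"
| "refine_term \<phi> (Braid a b) = Braid (preimage_word \<phi> a) (preimage_word \<phi> b)"
| "refine_term \<phi> (Copy a) = Copy (preimage_word \<phi> a)"
| "refine_term \<phi> (Delete a) = Delete (preimage_word \<phi> a)"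
| "refine_term \<phi> (Mech v) = mech_term \<phi> v"
| "refine_term \<phi> (Seq t s) = Seq (refine_term \<phi> t) (refine_term \<phi> s)"
| "refine_term \<phi> (Par s t) = Par (refine_term \<phi> s) (refine_term \<phi> t)"

definition refinement :: "'v odag_mor \<Rightarrow> ('v list, 'v mterm set, 'v list, 'v mterm set) mfunctor" where
  "refinement \<phi> =
    \<lparr> Src = Fm (otgt \<phi>), Tgt = Fm (osrc \<phi>),
      OMap = (\<lambda>a\<in>Obj (Fm (otgt \<phi>)). preimage_word \<phi> a),
      AMap = (\<lambda>f\<in>Arr (Fm (otgt \<phi>)).
        cls (osrc \<phi>) (refine_term \<phi> (SOME t. wt (otgt \<phi>) t \<and> f = cls (otgt \<phi>) t))),
      Mu = curry (\<lambda>(a, b)\<in>Obj (Fm (otgt \<phi>)) \<times> Obj (Fm (otgt \<phi>)).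
        Ide (Fm (osrc \<phi>)) (preimage_word \<phi> (a @ b))),
      Eta = Ide (Fm (osrc \<phi>)) [] \<rparr>"

lemma mech_term:
  assumes "odag_mor \<phi>" "v \<in> set (verts (otgt \<phi>))"
  shows "wt (osrc \<phi>) (mech_term \<phi> v)"
    "causal_effect (osrc \<phi>) (fibre \<phi> {v}) (fibre \<phi> (parents (otgt \<phi>) v)) = cls (osrc \<phi>) (mech_term \<phi> v)"
    "tdom (osrc \<phi>) (mech_term \<phi> v) = preimage_word \<phi> (pa (otgt \<phi>) v)"
    "tcod (osrc \<phi>) (mech_term \<phi> v) = preimage_word \<phi> [v]"
proof -
  let ?H = "osrc \<phi>" and ?c = "causal_effect (osrc \<phi>) (fibre \<phi> {v}) (fibre \<phi> (parents (otgt \<phi>) v))"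
  have H: "odag ?H" using assms by (simp add: odag_mor_def)
  note c = causal_effect_arr[OF H fibre_subset[of \<phi> "parents (otgt \<phi>) v"] fibre_subset[of \<phi> "{v}"]]
  obtain t where "wt ?H t" "?c = cls ?H t" using Fm_ArrE[OF c(1)] by blast
  then have "\<exists>t. wt ?H t \<and> ?c = cls ?H t" by blast
  from someI_ex[OF this] show m: "wt ?H (mech_term \<phi> v)" "?c = cls ?H (mech_term \<phi> v)"
    unfolding mech_term_def by blast+
  show "tdom ?H (mech_term \<phi> v) = preimage_word \<phi> (pa (otgt \<phi>) v)"
    using cls_Dom[OF m(1)] m(2) c(2) by (simp add: pa_def preimage_word_listing[OF assms(1)])
  show "tcod ?H (mech_term \<phi> v) = preimage_word \<phi> [v]"
    using cls_Cod[OF m(1)] m(2) c(3) by (simp add: preimage_word_Cons)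
qed

lemma wt_refine_term:
  assumes "odag_mor \<phi>" "wt (otgt \<phi>) t"
  shows "wt (osrc \<phi>) (refine_term \<phi> t) \<and>
    tdom (osrc \<phi>) (refine_term \<phi> t) = preimage_word \<phi> (tdom (otgt \<phi>) t) \<and>
    tcod (osrc \<phi>) (refine_term \<phi> t) = preimage_word \<phi> (tcod (otgt \<phi>) t)"
proof -
  have w: "preimage_word \<phi> a \<in> lists (set (verts (osrc \<phi>)))" for a
    using set_preimage_word[of \<phi> a] by blast
  show ?thesis using assms(2) by (induction t) (simp_all add: mech_term[OF assms(1)] w)
qed

text \<open>Swaps, copies and discards are generators at all words, so substituting words for
  letters stays within each family of equations. No equation singles out \<open>Mech\<close>, so
  only the type of its image matters.\<close>

lemma meq_refine_term:
  assumes "odag_mor \<phi>" "meq (otgt \<phi>) s t"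
  shows "meq (osrc \<phi>) (refine_term \<phi> s) (refine_term \<phi> t)"
proof -
  have w: "preimage_word \<phi> a \<in> lists (set (verts (osrc \<phi>)))" for a
    using set_preimage_word[of \<phi> a] by blast
  note wtr = wt_refine_term[OF assms(1)]
  show ?thesis using assms(2)
  proof (induction rule: meq.induct)
    case (trans s t u)
    show ?case by (rule meq.trans[OF trans.IH])
  next
    case (Seq_cong s s' t t')
    then show ?case using wtr by (auto intro!: meq.Seq_cong)
  next
    case (Id_left t)
    then show ?case using wtr[OF Id_left] meq.Id_left[of "osrc \<phi>" "refine_term \<phi> t"] by simp
  next
    case (Id_right t)
    then show ?case using wtr[OF Id_right] meq.Id_right[of "osrc \<phi>" "refine_term \<phi> t"] by simp
  next
    case (Braid_natural s t)
    then show ?case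
      using wtr[of s] wtr[of t] meq.Braid_natural[of "osrc \<phi>" "refine_term \<phi> s" "refine_term \<phi> t"] by simp
  next
    case (Delete_natural t)
    then show ?case
      using wtr[OF Delete_natural] meq.Delete_natural[of "osrc \<phi>" "refine_term \<phi> t"] by simp
  next
    case (sym s t)
    show ?case by (rule meq.sym[OF sym.IH])
  qed (simp_all add: wtr w meq.refl meq.Par_cong meq.Seq_assoc meq.Par_Id meq.Par_Seq
      meq.Par_assoc meq.Par_unit_left meq.Par_unit_right meq.Braid_hexagon meq.Braid_Braid meq.Copy_coassoc
      meq.Copy_counit_left meq.Copy_counit_right meq.Copy_cocomm meq.Copy_append meq.Delete_append)
qed

lemma AMap_refinement:
  assumes "odag_mor \<phi>" "wt (otgt \<phi>) t"
  shows "AMap (refinement \<phi>) (cls (otgt \<phi>) t) = cls (osrc \<phi>) (refine_term \<phi> t)"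
proof -
  let ?s = "SOME s. wt (otgt \<phi>) s \<and> cls (otgt \<phi>) t = cls (otgt \<phi>) s"
  have "wt (otgt \<phi>) ?s \<and> cls (otgt \<phi>) t = cls (otgt \<phi>) ?s"
    by (rule someI[of _ t]) (simp add: assms)
  then have "meq (otgt \<phi>) t ?s" using cls_eqD by blast
  from cls_eqI[OF meq_refine_term[OF assms(1) this]] show ?thesis
    using cls_Arr[OF assms(2)] by (simp add: refinement_def)
qed

lemma strict_markov_functor_refinement:
  assumes "odag_mor \<phi>"
  shows "strict_markov_functor (Fm (otgt \<phi>)) (Fm (osrc \<phi>)) (refinement \<phi>)"
proof -
  let ?G = "otgt \<phi>" and ?H = "osrc \<phi>" and ?F = "refinement \<phi>"
  note am = AMap_refinement[OF assms] and wtr = wt_refine_term[OF assms]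
  have o: "OMap ?F a = preimage_word \<phi> a" if "set a \<subseteq> set (verts ?G)" for a
    using that by (simp add: refinement_def)
  have m: "Mu ?F a b = Ide (Fm ?H) (preimage_word \<phi> a @ preimage_word \<phi> b)"
    if "set a \<subseteq> set (verts ?G)" "set b \<subseteq> set (verts ?G)" for a b
    using that by (simp add: refinement_def)
  have e: "Eta ?F = Ide (Fm ?H) []" by (simp add: refinement_def)
  have w: "wt ?G (Idn a) \<longleftrightarrow> set a \<subseteq> set (verts ?G)" "wt ?G (Braid a b) \<longleftrightarrow> set a \<subseteq> set (verts ?G) \<and> set b \<subseteq> set (verts ?G)"
    "wt ?G (Copy a) \<longleftrightarrow> set a \<subseteq> set (verts ?G)" "wt ?G (Delete a) \<longleftrightarrow> set a \<subseteq> set (verts ?G)" for a b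
    by auto
  have basic: "AMap ?F (Ide (Fm ?G) a) = Ide (Fm ?H) (preimage_word \<phi> a)"
    "AMap ?F (Dup (Fm ?G) a) = Dup (Fm ?H) (preimage_word \<phi> a)"
    "AMap ?F (Disc (Fm ?G) a) = Disc (Fm ?H) (preimage_word \<phi> a)" if "set a \<subseteq> set (verts ?G)" for a
    using that by (simp_all add: Fm_sel am w del: wt.simps)
  have swap: "AMap ?F (Swap (Fm ?G) a b) = Swap (Fm ?H) (preimage_word \<phi> a) (preimage_word \<phi> b)"
    if "set a \<subseteq> set (verts ?G)" "set b \<subseteq> set (verts ?G)" for a b
    using that by (simp add: Fm_sel am w del: wt.simps)
  have F_hom: "AMap ?F f \<in> hom (Fm ?H) (preimage_word \<phi> a) (preimage_word \<phi> b)"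
    if "f \<in> hom (Fm ?G) a b" for f a b
    using that by (elim Fm_homE) (simp add: am cls_hom wtr)
  have F_arr: "AMap ?F f \<in> Arr (Fm ?H)" "Dom (Fm ?H) (AMap ?F f) = preimage_word \<phi> (Dom (Fm ?G) f)"
    "Cod (Fm ?H) (AMap ?F f) = preimage_word \<phi> (Cod (Fm ?G) f)" if "f \<in> Arr (Fm ?G)" for f
    using F_hom[OF Fm.arr_hom[OF that]] by (simp_all add: hom_def)
  have F_Par: "AMap ?F (f \<odot>\<^bsub>Fm ?G\<^esub> g) = AMap ?F f \<odot>\<^bsub>Fm ?H\<^esub> AMap ?F g"
    if "f \<in> Arr (Fm ?G)" "g \<in> Arr (Fm ?G)" for f g
    using that by (elim Fm_ArrE) (simp add: am wtr cls_TensA)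
  have F_Seq: "AMap ?F (g \<cdot>\<^bsub>Fm ?G\<^esub> f) = AMap ?F g \<cdot>\<^bsub>Fm ?H\<^esub> AMap ?F f"
    if "f \<in> hom (Fm ?G) a b" "g \<in> hom (Fm ?G) b c" for f g a b c
    using that by (elim Fm_homE) (simp add: am wtr cls_Cmp)
  have str: "Assoc (Fm G) a b c = Ide (Fm G) (a @ b @ c)" "LUnit (Fm G) a = Ide (Fm G) a"
    "RUnit (Fm G) a = Ide (Fm G) a" for G :: "'a odag" and a b c
    by (simp_all add: Fm_sel)
  show ?thesis
  proof unfold_locales
    fix f g a a' b b' assume f: "f \<in> hom (Fm ?G) a a'" and g: "g \<in> hom (Fm ?G) b b'"
    have [simp]: "f \<in> Arr (Fm ?G)" "Dom (Fm ?G) f = a" "Cod (Fm ?G) f = a'"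
      "g \<in> Arr (Fm ?G)" "Dom (Fm ?G) g = b" "Cod (Fm ?G) g = b'" using f g by (auto simp: hom_def)
    have "set a \<subseteq> set (verts ?G)" "set a' \<subseteq> set (verts ?G)" "set b \<subseteq> set (verts ?G)" "set b' \<subseteq> set (verts ?G)"
      using Fm.Dom_subset[of f ?G] Fm.Cod_subset[of f ?G] Fm.Dom_subset[of g ?G] Fm.Cod_subset[of g ?G] by simp_all
    then show "Mu ?F a' b' \<cdot>\<^bsub>Fm ?H\<^esub> (AMap ?F f \<odot>\<^bsub>Fm ?H\<^esub> AMap ?F g)
       = AMap ?F (f \<odot>\<^bsub>Fm ?G\<^esub> g) \<cdot>\<^bsub>Fm ?H\<^esub> Mu ?F a b"
      by (simp add: m F_Par F_arr)
  next
    fix f a b assume f: "f \<in> hom (Fm ?G) a b"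
    then have "set a \<subseteq> set (verts ?G)" "set b \<subseteq> set (verts ?G)"
      using Fm.Dom_subset[of f ?G] Fm.Cod_subset[of f ?G] by (auto simp: hom_def)
    then show "AMap ?F f \<in> hom (Fm ?H) (OMap ?F a) (OMap ?F b)" using F_hom[OF f] by (simp add: o)
  next
    show "Src ?F = Fm ?G" "Tgt ?F = Fm ?H" "OMap ?F \<in> extensional (Obj (Fm ?G))"
      "AMap ?F \<in> extensional (Arr (Fm ?G))" "case_prod (Mu ?F) \<in> extensional (Obj (Fm ?G) \<times> Obj (Fm ?G))"
      by (simp_all add: refinement_def extensional_def)
  next
    fix f g a b c assume "f \<in> hom (Fm ?G) a b" "g \<in> hom (Fm ?G) b c"
    then show "AMap ?F (g \<cdot>\<^bsub>Fm ?G\<^esub> f) = AMap ?F g \<cdot>\<^bsub>Fm ?H\<^esub> AMap ?F f" by (rule F_Seq)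
  qed (simp_all add: o m e basic swap str hom_def Fm.is_iso_Ide)
qed

lemma refines_refinement:
  assumes "odag_mor \<phi>" shows "refines \<phi> (refinement \<phi>)"
proof -
  interpret strict_markov_functor "Fm (otgt \<phi>)" "Fm (osrc \<phi>)" "refinement \<phi>"
    by (rule strict_markov_functor_refinement[OF assms])
  have o: "OMap (refinement \<phi>) a = preimage_word \<phi> a" if "set a \<subseteq> set (verts (otgt \<phi>))" for a
    using that by (simp add: refinement_def)
  have "AMap (refinement \<phi>) (kappa (otgt \<phi>) v)
      = causal_effect (osrc \<phi>) (fibre \<phi> {v}) (fibre \<phi> (parents (otgt \<phi>) v))"
    if "v \<in> set (verts (otgt \<phi>))" for v
    using AMap_refinement[OF assms, of "Mech v"] mech_term[OF assms that] that by (simp add: kappa_def)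
  then show ?thesis
    using AMap_Disc AMap_Dup AMap_Ide
    by (simp add: refines_def Let_def strict_markov_functor_refinement[OF assms] o Mu_strict Eta_strict)
qed

text \<open>The whole vertex list is sent to a listing in \<open>osrc \<phi>\<close>, which has no
  repetitions. This encodes the disjointness of fibres.\<close>

lemma refines_word_functor:
  assumes "odag_mor \<phi>" "refines \<phi> F"
  shows "word_functor (otgt \<phi>) (Fm (osrc \<phi>)) F (set (verts (osrc \<phi>)))"
proof -
  interpret strict_markov_functor "Fm (otgt \<phi>)" "Fm (osrc \<phi>)" F
    using assms(2) by (simp add: refines_def Let_def)
  have G: "odag (otgt \<phi>)" and H: "odag (osrc \<phi>)" using assms(1) by (auto simp: odag_mor_def)
  have "verts (otgt \<phi>) = listing (otgt \<phi>) (set (verts (otgt \<phi>)))" by (simp add: listing_def)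
  then have "OMap F (verts (otgt \<phi>)) = listing (osrc \<phi>) (fibre \<phi> (set (verts (otgt \<phi>))))"
    using assms(2) preimage_word_listing[OF assms(1), of "set (verts (otgt \<phi>))"]
    by (simp add: refines_def Let_def)
  then have "distinct (OMap F (verts (otgt \<phi>)))" using distinct_listing[OF H] by simp
  then show ?thesis using G by unfold_locales
qed

text \<open>The laws of strict Markov functors determine the value on every term constructor except
  \<open>Mech\<close>, and there \<open>refines\<close> prescribes it.\<close>

lemma refines_AMap:
  assumes "odag_mor \<phi>" "refines \<phi> F" "wt (otgt \<phi>) t"
  shows "AMap F (cls (otgt \<phi>) t) = cls (osrc \<phi>) (refine_term \<phi> t)"
proof -
  let ?G = "otgt \<phi>" and ?H = "osrc \<phi>"
  interpret word_functor ?G "Fm ?H" F "set (verts ?H)" by (rule refines_word_functor[OF assms(1,2)])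
  have o: "OMap F a = preimage_word \<phi> a" if "set a \<subseteq> set (verts ?G)" for a
    using assms(2) that by (simp add: refines_def Let_def)
  have t: "tys a = preimage_word \<phi> a" if "set a \<subseteq> set (verts ?G)" for a
    using o[OF that] OMap_word[OF that] by simp
  have w: "a \<in> lists (set (verts ?G)) \<longleftrightarrow> set a \<subseteq> set (verts ?G)" for a by auto
  note wtr = wt_refine_term[OF assms(1)]
  show ?thesis using assms(3)
  proof (induction t)
    case (Idn a)
    then show ?case using AMap_Ide[of a] o[of a] by (simp add: Fm_sel(2) w)
  next
    case (Braid a b)
    then show ?case using AMap_Swap[of a b] t by (simp add: Fm_sel(8) w)
  next
    case (Copy a)
    then show ?case using AMap_Dup[of a] o[of a] by (simp add: Mu_strict Fm_sel(9)[symmetric] w)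
  next
    case (Delete a)
    then show ?case using AMap_Disc[of a] o[of a] by (simp add: Eta_strict Fm_sel(10)[symmetric] w)
  next
    case (Mech v)
    then show ?case
      using assms(2) mech_term(2)[OF assms(1), of v] by (simp add: refines_def Let_def kappa_def)
  next
    case (Seq t s)
    then have "AMap F (cls ?G t \<cdot>\<^bsub>Fm ?G\<^esub> cls ?G s) = AMap F (cls ?G t) \<cdot>\<^bsub>Fm ?H\<^esub> AMap F (cls ?G s)"
      by (intro AMap_Cmp_arr) (simp_all add: cls_Arr cls_Dom cls_Cod)
    then show ?case using Seq wtr[of t] wtr[of s] by (simp add: cls_Cmp)
  next
    case (Par s t)
    then have "AMap F (cls ?G s \<odot>\<^bsub>Fm ?G\<^esub> cls ?G t) = AMap F (cls ?G s) \<odot>\<^bsub>Fm ?H\<^esub> AMap F (cls ?G t)"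
      by (intro AMap_TensA) (simp_all add: cls_Arr)
    then show ?case using Par wtr[of t] wtr[of s] by (simp add: cls_TensA)
  qed
qed

lemma refines_unique:
  assumes "odag_mor \<phi>" "refines \<phi> F" "refines \<phi> F'" shows "F = F'"
proof (rule strict_markov_functor_eqI)
  show "strict_markov_functor (Fm (otgt \<phi>)) (Fm (osrc \<phi>)) F" "strict_markov_functor (Fm (otgt \<phi>)) (Fm (osrc \<phi>)) F'"
    using assms(2,3) by (simp_all add: refines_def Let_def)
  show "OMap F a = OMap F' a" if "a \<in> Obj (Fm (otgt \<phi>))" for a
    using assms(2,3) that by (simp add: refines_def Let_def)
  show "AMap F f = AMap F' f" if "f \<in> Arr (Fm (otgt \<phi>))" for f
    using that by (elim Fm_ArrE) (simp add: refines_AMap[OF assms(1,2)] refines_AMap[OF assms(1,3)])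
qed

section \<open>Refinement of causal effects\<close>

text \<open>The image of a directed path is a path once arcs inside fibres are collapsed, so the
  claim passes backwards from each vertex of the path to its predecessor. Only this inclusion is to
  be expected, since paths need not lift.\<close>

lemma effect_verts_preimage:
  assumes "odag_mor \<phi>" "u \<in> effect_verts (osrc \<phi>) (fibre \<phi> X) (fibre \<phi> Y)" "u \<notin> fibre \<phi> X"
  shows "vmap \<phi> u \<in> effect_verts (otgt \<phi>) X Y \<and> vmap \<phi> u \<notin> X"
proof -
  let ?G = "otgt \<phi>" and ?H = "osrc \<phi>"
  have H: "odag ?H" using assms(1) by (simp add: odag_mor_def)
  obtain q where "effect_path ?H (fibre \<phi> X) (fibre \<phi> Y) (u # q)"
    using effect_verts_path[OF assms(2,3)] by blast
  then show ?thesis using assms(3)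
  proof (induction q arbitrary: u)
    case Nil
    then show ?case by (auto simp: effect_path_def fibre_def effect_verts_def)
  next
    case (Cons v q)
    have p: "effect_path ?H (fibre \<phi> X) (fibre \<phi> Y) (v # q)"
      using effect_path_suffix[of ?H _ _ "[u]" "v # q"] Cons.prems(1) by simp
    have a: "(u, v) \<in> proper_arcs ?H" "v \<notin> fibre \<phi> X"
      using Cons.prems(1) by (auto simp: effect_path_def)
    have IH: "vmap \<phi> v \<in> effect_verts ?G X Y \<and> vmap \<phi> v \<notin> X" using Cons.IH[OF p a(2)] .
    have u: "u \<in> set (verts ?H)" using proper_arcs_verts[OF H a(1)] by blast
    have arc: "(vmap \<phi> u, vmap \<phi> v) \<in> arcs ?G"
      using a(1) assms(1) unfolding odag_mor_def proper_arcs_def by blast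
    show ?case
    proof (cases "vmap \<phi> u = vmap \<phi> v")
      case True
      then show ?thesis using IH by simp
    next
      case False
      then have "(vmap \<phi> u, vmap \<phi> v) \<in> effect_arcs ?G X Y"
        using arc IH by (simp add: effect_arcs_iff proper_arcs_def)
      then have "vmap \<phi> u \<in> effect_verts ?G X Y" by (rule effect_arcs_source)
      then show ?thesis using Cons.prems(2) u by (auto simp: fibre_def)
    qed
  qed
qed

text \<open>A path into \<open>i\<close> enters it through a parent, and a parent may only be the
  start of a path. So no vertex beyond the parents is reached.\<close>

lemma effect_verts_parents:
  assumes "i \<notin> parents G i"
  shows "effect_verts G (parents G i) {i} - parents G i = {i}"
proof -
  have "j = i" if "effect_path G (parents G i) {i} (j # q)" "j \<notin> parents G i" for j q
    using that
  proof (induction q arbitrary: j)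
    case Nil
    then show ?case by (simp add: effect_path_def)
  next
    case (Cons k q)
    have "effect_path G (parents G i) {i} (k # q)"
      using effect_path_suffix[of G _ _ "[j]" "k # q"] Cons.prems(1) by simp
    moreover have "k \<notin> parents G i" "(j, k) \<in> proper_arcs G"
      using Cons.prems(1) by (auto simp: effect_path_def)
    ultimately show ?case using Cons by (auto simp: parents_def)
  qed
  then have "j = i" if "j \<in> effect_verts G (parents G i) {i}" "j \<notin> parents G i" for j
    using effect_verts_path[OF that] that(2) by blast
  then show ?thesis using assms by (auto simp: effect_verts_def)
qed

lemma not_own_parent: "i \<notin> parents G i"
  by (simp add: parents_def proper_arcs_def)

lemma listing_single:
  assumes "odag G" "v \<in> set (verts G)" shows "listing G {v} = [v]"
proof -
  obtain us vs where v: "verts G = us @ v # vs" using split_list[OF assms(2)] by blast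
  then have "v \<notin> set us" "v \<notin> set vs" using assms(1) by (auto simp: odag_def)
  then have "filter (\<lambda>u. u = v) us = []" "filter (\<lambda>u. u = v) vs = []" by (auto simp: filter_empty_conv)
  then show ?thesis by (simp add: listing_def v)
qed

text \<open>This supplies the identity law on mechanisms. The graph of the effect has the single
  mechanism \<open>v\<close>, whose inputs are forgotten at the end.\<close>

lemma causal_effect_parents:
  assumes "odag G" "v \<in> set (verts G)" shows "causal_effect G {v} (parents G v) = kappa G v"
proof -
  interpret word_functor G "Fm G" "Ide MarCat (Fm G)" "set (verts G)" by (rule word_functor_Ide[OF assms(1)])
  have t: "tys a = a" if "set a \<subseteq> set (verts G)" for a using OMap_word[OF that] that by simp
  have v: "vty v = [v]" using t[of "[v]"] assms(2) by simp
  note l = listing_single[OF assms]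
  let ?P = "pa G v" and ?sel = "word_markov.sel (Fm G)" and ?pair = "word_markov.pair (Fm G)"
  have P: "listing G (parents G v) = ?P" "set ?P \<subseteq> set (verts G)" by (simp_all add: pa_def)
  have vP: "set ?P \<inter> set [v] = {}" using not_own_parent[of v G] by (auto simp: set_pa)
  have N: "listing G (effect_verts G (parents G v) {v} - parents G v) = [v]"
    using effect_verts_parents[OF not_own_parent, of G v] l assms(2) by simp
  note c = causal_effect_run[OF parents_subset[OF assms(1), of v], of "{v}", unfolded N l P(1)]
  let ?k = "kappa G v \<cdot>\<^bsub>Fm G\<^esub> ?sel ?P ?P"
  have k: "?k = kappa G v" "kappa G v \<in> Arr (Fm G)"
    using assms P distinct_listing[OF assms(1), of "parents G v"] by (simp_all add: Fm.sel_self pa_def)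
  have "causal_effect G {v} (parents G v) = ?sel (?P @ [v]) ([] @ [v]) \<cdot>\<^bsub>Fm G\<^esub> run ?P [v]"
    using c(1,6) assms(2) P(2) by (simp add: t v del: Fm.sel.simps)
  also have "run ?P [v] = ?pair (Ide (Fm G) ?P) ?k"
  proof -
    have "AMap (Ide MarCat (Fm G)) (kappa G v) = kappa G v" "OMap (Ide MarCat (Fm G)) ?P = ?P"
      using assms(2) by simp_all
    then show ?thesis
      using assms(2) P(2) by (simp add: step_def v del: Ide_MarCat_simps)
  qed
  also have "?sel (?P @ [v]) ([] @ [v]) \<cdot>\<^bsub>Fm G\<^esub> ?pair (Ide (Fm G) ?P) ?k = ?pair (?sel ?P []) (?sel [v] [v] \<cdot>\<^bsub>Fm G\<^esub> ?k)"
    using k assms(2) P(2) vP by (intro Fm.sel_pair_Ide(2)) simp_all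
  also have "\<dots> = kappa G v"
    using k(2) assms(2) by (simp add: k(1) Fm.sel_self Fm.pair_Disc del: Fm.sel.simps(2))
  finally show ?thesis .
qed

text \<open>Sets \<open>X\<close> and \<open>Y\<close> larger than a vertex and its parents arise in
  composites: the functor applied first already turns mechanisms into effects between
  fibres.\<close>

lemma refines_causal_effect:
  assumes mor: "odag_mor \<phi>" and ref: "refines \<phi> F"
    and X: "X \<subseteq> set (verts (otgt \<phi>))" and Y: "Y \<subseteq> set (verts (otgt \<phi>))"
  shows "AMap F (causal_effect (otgt \<phi>) Y X) = causal_effect (osrc \<phi>) (fibre \<phi> Y) (fibre \<phi> X)"
proof -
  let ?G = "otgt \<phi>" and ?H = "osrc \<phi>"
  have G: "odag ?G" and H: "odag ?H" using mor by (auto simp: odag_mor_def)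
  interpret R: word_functor ?G "Fm ?H" F "set (verts ?H)" by (rule refines_word_functor[OF mor ref])
  interpret I: word_functor ?H "Fm ?H" "Ide MarCat (Fm ?H)" "set (verts ?H)" by (rule word_functor_Ide[OF H])
  let ?sel = "word_markov.sel (Fm ?H)"
  let ?l = "\<lambda>S. listing ?H (fibre \<phi> S)"
  \<comment> \<open>The identity functor represents each vertex by itself, so words of values are
    words of vertices.\<close>
  have It: "I.tys a = a" if "set a \<subseteq> set (verts ?H)" for a using I.OMap_word[OF that] that by simp
  have IA: "AMap (Ide MarCat (Fm ?H)) f = f" if "f \<in> Arr (Fm ?H)" for f using that by simp
  note [simp del] = Ide_MarCat_simps
  have O: "OMap F a = preimage_word \<phi> a" if "set a \<subseteq> set (verts ?G)" for a
    using ref that by (simp add: refines_def Let_def)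
  have Rt: "R.tys (listing ?G S) = ?l S" for S
    using R.OMap_word[of "listing ?G S"] O[of "listing ?G S"] preimage_word_listing[OF mor] by simp
  have Rv: "R.vty i = ?l {i}" if "i \<in> set (verts ?G)" for i
    using O[of "[i]"] that by (simp add: R.vty_def preimage_word_Cons)
  \<comment> \<open>One mechanism of the target graph becomes a block of mechanisms of the source
    graph, namely those of its fibre in order.\<close>
  have step: "R.step a i = I.run a (?l {i}) \<and> I.runnable a (?l {i})"
    if i: "i \<in> set (verts ?G)" and a: "set a \<subseteq> set (verts ?H)" "set (?l (parents ?G i)) \<subseteq> set a"
      "distinct (a @ ?l {i})" for a i
  proof -
    let ?P = "?l (parents ?G i)" and ?B = "?l {i}"
    \<comment> \<open>Vertices of this graph outside the preimage of the parents map into the graph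
      of the effect of the parents on \<open>i\<close>, hence to \<open>i\<close>; conversely the
      fibre of \<open>i\<close> belongs to it as the set of outputs.\<close>
    have E: "effect_verts ?H (fibre \<phi> (parents ?G i)) (fibre \<phi> {i}) - fibre \<phi> (parents ?G i) = fibre \<phi> {i}"
    proof -
      have "vmap \<phi> u = i" if "u \<in> effect_verts ?H (fibre \<phi> (parents ?G i)) (fibre \<phi> {i})" "u \<notin> fibre \<phi> (parents ?G i)" for u
        using effect_verts_preimage[OF mor that] effect_verts_parents[OF not_own_parent, of ?G i] by blast
      moreover have "effect_verts ?H (fibre \<phi> (parents ?G i)) (fibre \<phi> {i}) \<subseteq> set (verts ?H)"
        by (rule effect_verts_subset[OF H fibre_subset fibre_subset])
      moreover have "fibre \<phi> {i} \<inter> fibre \<phi> (parents ?G i) = {}"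
        using not_own_parent[of i ?G] by (auto simp: fibre_def)
      moreover have "fibre \<phi> {i} \<subseteq> effect_verts ?H (fibre \<phi> (parents ?G i)) (fibre \<phi> {i})"
        by (auto simp: effect_verts_def)
      ultimately show ?thesis by (auto simp: fibre_def)
    qed
    have Bv: "set ?B \<subseteq> set (verts ?H)" "set ?P \<subseteq> set (verts ?H)" by simp_all
    note c = I.causal_effect_run[OF fibre_subset[of \<phi> "parents ?G i"] fibre_subset[of \<phi> "{i}"], unfolded E]
    have r: "I.runnable ?P ?B" using c(4) by (simp add: It)
    have "AMap F (kappa ?G i) = causal_effect ?H (fibre \<phi> {i}) (fibre \<phi> (parents ?G i))"
      using ref i by (simp add: refines_def Let_def)
    also have "\<dots> = ?sel (?P @ ?B) ?B \<cdot>\<^bsub>Fm ?H\<^esub> I.run ?P ?B"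
      using c(6) IA[OF c(1)] by (simp add: It)
    finally have k: "AMap F (kappa ?G i) = ?sel (?P @ I.tys ?B) (I.tys ?B) \<cdot>\<^bsub>Fm ?H\<^esub> I.run ?P ?B"
      by (simp add: It)
    have pa: "OMap F (pa ?G i) = ?P" using O[of "pa ?G i"] preimage_word_listing[OF mor] by (simp add: pa_def)
    have "R.step a i = I.run a ?B"
      unfolding R.step_def pa k using a r Bv by (intro I.run_block) (simp_all add: It)
    then show ?thesis using I.runnable_mono[OF r a(2)] by blast
  qed
  have run: "R.run a N = I.run a (R.tys N) \<and> I.runnable a (R.tys N)"
    if "R.runnable a N" "set a \<subseteq> set (verts ?H)" "distinct (a @ R.tys N)" for a N
    using that
  proof (induction N arbitrary: a)
    case (Cons i N)
    then have i: "i \<in> set (verts ?G)" by simp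
    have pa: "OMap F (pa ?G i) = ?l (parents ?G i)" using O[of "pa ?G i"] preimage_word_listing[OF mor] by (simp add: pa_def)
    have s: "R.step a i = I.run a (R.vty i)" "I.runnable a (R.vty i)"
      using step[OF i, of a] Cons.prems pa i by (simp_all add: Rv Int_Un_distrib)
    have v: "set (R.vty i) \<subseteq> set (verts ?H)" using R.ty_subset[OF i] .
    have "R.run (a @ R.vty i) N = I.run (a @ R.vty i) (R.tys N) \<and> I.runnable (a @ R.vty i) (R.tys N)"
      using Cons v by (simp add: Int_Un_distrib Int_Un_distrib2)
    moreover have "I.run a (R.vty i @ R.tys N) = I.run (a @ I.tys (R.vty i)) (R.tys N) \<cdot>\<^bsub>Fm ?H\<^esub> I.run a (R.vty i)"
      using calculation s(2) Cons.prems(2) It[OF v] by (intro I.run_append) simp_all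
    ultimately show ?case using s It[OF v] by simp
  qed simp
  let ?X = "?l X" and ?Y = "?l Y" and ?E = "effect_verts ?G X Y"
  let ?E' = "effect_verts ?H (fibre \<phi> X) (fibre \<phi> Y)"
  \<comment> \<open>\<open>?M\<close> lists the mechanisms that stem from running the diagram of the
    target graph, \<open>?N\<close> those run by the diagram of the source graph.\<close>
  let ?M = "?l (?E - X)" and ?N = "listing ?H (?E' - fibre \<phi> X)"
  note g = R.causal_effect_run[OF X Y, unfolded Rt]
  note h = I.causal_effect_run[OF fibre_subset[of \<phi> X] fibre_subset[of \<phi> Y]]
  have Xv: "set ?X \<subseteq> set (verts ?H)" "set ?M \<subseteq> set (verts ?H)" "set ?N \<subseteq> set (verts ?H)" "set ?Y \<subseteq> set (verts ?H)"
    by simp_all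
  have dXM: "distinct (?X @ ?M)"
    using distinct_listing[OF H] by (auto simp: fibre_def)
  have M: "R.run ?X (listing ?G (?E - X)) = I.run ?X ?M" "I.runnable ?X ?M"
    using run[OF g(4) Xv(1)] dXM by (simp_all add: Rt)
  have h': "I.runnable ?X ?N" "set ?Y \<subseteq> set (?X @ ?N)"
    "causal_effect ?H (fibre \<phi> Y) (fibre \<phi> X) = ?sel (?X @ ?N) ?Y \<cdot>\<^bsub>Fm ?H\<^esub> I.run ?X ?N"
    using h(4,5,6) IA[OF h(1)] by (simp_all add: It)
  \<comment> \<open>By \<open>effect_verts_preimage\<close>, every mechanism of \<open>?N\<close>
    occurs in \<open>?M\<close>; the others in \<open>?M\<close> lie outside the graph of the effect
    in the source, and their values can be discarded.\<close>
  have N: "filter (\<lambda>u. u \<in> ?E') ?M = ?N"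
  proof -
    have "u \<in> fibre \<phi> (?E - X) \<and> u \<in> ?E' \<longleftrightarrow> u \<in> ?E' - fibre \<phi> X" for u
      using effect_verts_preimage[OF mor, of u X Y] effect_verts_subset[OF H fibre_subset[of _ X] fibre_subset[of _ Y]]
      by (auto simp: fibre_def)
    then show ?thesis by (auto simp: listing_def intro: filter_cong)
  qed
  have sr: "?sel (?X @ ?M) (?X @ ?N) \<cdot>\<^bsub>Fm ?H\<^esub> I.run ?X ?M = I.run ?X ?N"
    using I.sel_run_filter[OF Xv(1) M(2), of "\<lambda>u. u \<in> ?E'"] h'(1) dXM Xv unfolding N by (simp add: It del: set_listing)
  have NM: "set (?X @ ?N) \<subseteq> set (?X @ ?M)" unfolding N[symmetric] by auto
  have XM: "set (?X @ ?M) \<subseteq> set (verts ?H)" by simp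
  have XN: "set (?X @ ?N) \<subseteq> set (verts ?H)" by simp
  have rM: "I.run ?X ?M \<in> Arr (Fm ?H)" "Cod (Fm ?H) (I.run ?X ?M) = ?X @ ?M"
    using I.run_arr[OF Xv(1) M(2)] Xv by (simp_all only: It)
  have "AMap F (causal_effect ?G Y X) = ?sel (?X @ ?M) ?Y \<cdot>\<^bsub>Fm ?H\<^esub> I.run ?X ?M"
    using g(6) M(1) by simp
  also have "?sel (?X @ ?M) ?Y = ?sel (?X @ ?N) ?Y \<cdot>\<^bsub>Fm ?H\<^esub> ?sel (?X @ ?M) (?X @ ?N)"
    using Fm.sel_sel[OF XM NM h'(2)] by simp
  also have "(\<dots>) \<cdot>\<^bsub>Fm ?H\<^esub> I.run ?X ?M = ?sel (?X @ ?N) ?Y \<cdot>\<^bsub>Fm ?H\<^esub> (?sel (?X @ ?M) (?X @ ?N) \<cdot>\<^bsub>Fm ?H\<^esub> I.run ?X ?M)"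
    using rM NM XM XN h'(2) by (intro Fm.assoc_arr) (simp_all only: Fm.sel_arr)
  finally show ?thesis using sr h'(3) by simp
qed

lemma FinODAG_simps:
  "Obj FinODAG = {G. odag G}" "Arr FinODAG = {\<phi>. odag_mor \<phi>}" "Dom FinODAG = osrc" "Cod FinODAG = otgt"
  "osrc (Ide FinODAG G) = G" "otgt (Ide FinODAG G) = G" "vmap (Ide FinODAG G) = (\<lambda>v\<in>set (verts G). v)"
  "osrc (Cmp FinODAG \<psi> \<phi>) = osrc \<phi>" "otgt (Cmp FinODAG \<psi> \<phi>) = otgt \<psi>"
  "vmap (Cmp FinODAG \<psi> \<phi>) = compose (set (verts (osrc \<phi>))) (vmap \<psi>) (vmap \<phi>)"
  by (simp_all add: FinODAG_def)

lemma refines_Ide: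
  assumes "odag G" shows "refines (Ide FinODAG G) (Ide MarCat (Fm G))"
proof -
  interpret word_functor G "Fm G" "Ide MarCat (Fm G)" "set (verts G)" by (rule word_functor_Ide[OF assms])
  have f: "fibre (Ide FinODAG G) X = X \<inter> set (verts G)" for X
    by (auto simp: fibre_def FinODAG_simps)
  note l = listing_single[OF assms]
  have p: "preimage_word (Ide FinODAG G) a = a" if "set a \<subseteq> set (verts G)" for a
    using that by (induction a) (simp_all add: preimage_word_Cons f l FinODAG_simps)
  have "parents G v \<inter> set (verts G) = parents G v" for v
    using parents_subset[OF assms, of v] by blast
  then show ?thesis
    using strict_markov_functor_Ide[OF markov_category_Fm, of G]
    by (simp add: refines_def Let_def FinODAG_simps(5,6) p f causal_effect_parents[OF assms])
qed

text \<open>On a mechanism the functor \<open>F'\<close> produces a causal effect, no longer a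
  mechanism; \<open>refines_causal_effect\<close> computes its image under \<open>F\<close>. Words
  compose because the fibre of a fibre is the fibre of the composite.\<close>

lemma refines_Cmp:
  assumes \<phi>: "odag_mor \<phi>" "refines \<phi> F" and \<psi>: "odag_mor \<psi>" "refines \<psi> F'" and src: "osrc \<psi> = otgt \<phi>"
  shows "refines (Cmp FinODAG \<psi> \<phi>) (Cmp MarCat F F')"
proof -
  let ?H = "osrc \<phi>" and ?G = "otgt \<phi>" and ?K = "otgt \<psi>" and ?c = "Cmp FinODAG \<psi> \<phi>" and ?F = "Cmp MarCat F F'"
  interpret F: strict_markov_functor "Fm ?G" "Fm ?H" F using \<phi>(2) by (simp add: refines_def Let_def)
  interpret F': strict_markov_functor "Fm ?K" "Fm ?G" F' using \<psi>(2) src by (simp add: refines_def Let_def)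
  interpret FF: strict_markov_functor "Fm ?K" "Fm ?H" ?F
    by (rule strict_markov_functor_Cmp) unfold_locales
  have v: "vmap \<phi> u \<in> set (verts ?G)" if "u \<in> set (verts ?H)" for u
    using \<phi>(1) that by (auto simp: odag_mor_def)
  have f: "fibre ?c X = fibre \<phi> (fibre \<psi> X)" for X
    using v src by (auto simp: fibre_def FinODAG_simps compose_def)
  have fs: "fibre \<psi> X \<subseteq> set (verts ?G)" for X using src by (auto simp: fibre_def)
  have p: "preimage_word ?c a = preimage_word \<phi> (preimage_word \<psi> a)" for a
    by (induction a)
      (simp_all add: preimage_word_Cons f FinODAG_simps src preimage_word_listing[OF \<phi>(1)])
  have ps: "set (preimage_word \<psi> a) \<subseteq> set (verts ?G)" for a using set_preimage_word[of \<psi> a] src by simp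
  have pc: "set (preimage_word ?c a) \<subseteq> set (verts ?H)" for a
    using set_preimage_word[of ?c a] by (simp add: FinODAG_simps)
  have O: "OMap ?F a = preimage_word ?c a" if "set a \<subseteq> set (verts ?K)" for a
    using \<phi>(2) \<psi>(2) that ps[of a] F'.Src by (simp add: refines_def Let_def compose_def p)
  have "AMap ?F (kappa ?K v) = causal_effect ?H (fibre ?c {v}) (fibre ?c (parents ?K v))"
    if v: "v \<in> set (verts ?K)" for v
  proof -
    have "AMap ?F (kappa ?K v) = AMap F (AMap F' (kappa ?K v))"
      using F'.Src v by (simp add: compose_def)
    also have "AMap F' (kappa ?K v) = causal_effect ?G (fibre \<psi> {v}) (fibre \<psi> (parents ?K v))"
      using \<psi>(2) v src by (simp add: refines_def Let_def)
    also have "AMap F \<dots> = causal_effect ?H (fibre \<phi> (fibre \<psi> {v})) (fibre \<phi> (fibre \<psi> (parents ?K v)))"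
      by (rule refines_causal_effect[OF \<phi> fs fs])
    finally show ?thesis by (simp add: f)
  qed
  moreover have "strict_markov_functor (Fm ?K) (Fm ?H) ?F" by unfold_locales
  ultimately show ?thesis
    using FF.AMap_Ide FF.AMap_Dup FF.AMap_Disc
    by (simp add: refines_def Let_def FinODAG_simps O pc FF.Mu_strict FF.Eta_strict
        del: Cmp_MarCat_simps)
qed

theorem theorem6p7:
  shows "\<exists>Ref :: 'v odag_mor \<Rightarrow> ('v list, 'v mterm set, 'v list, 'v mterm set) mfunctor.
    contravariant_functor FinODAG MarCat Fm Ref
    \<and> (\<forall>\<phi> \<in> Arr FinODAG. is_refinement \<phi> (Ref \<phi>))"
proof (intro exI conjI ballI)
  interpret O: category FinODAG by (rule category_FinODAG)
  interpret M: category MarCat by (rule category_MarCat)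
  show "contravariant_functor FinODAG MarCat Fm (refinement :: 'v odag_mor \<Rightarrow> _)"
  proof
    show "Fm G \<in> Obj MarCat" for G :: "'v odag" by (simp add: markov_category_Fm)
    fix \<phi> \<psi> :: "'v odag_mor" and G H K :: "'v odag"
    show "refinement (Ide FinODAG G) = Ide MarCat (Fm G)" if "G \<in> Obj FinODAG"
    proof -
      have "odag_mor (Ide FinODAG G)" using O.Ide_in[OF that] by (simp add: hom_def FinODAG_simps)
      moreover have "odag G" using that by (simp add: FinODAG_simps)
      \<comment> \<open>Functoriality is read off from uniqueness: both sides refine the same
        morphism.\<close>
      ultimately show ?thesis using refines_unique refines_refinement refines_Ide by blast
    qed
    assume "\<phi> \<in> hom FinODAG H G"
    then have \<phi>: "odag_mor \<phi>" "osrc \<phi> = H" "otgt \<phi> = G" by (auto simp: hom_def FinODAG_simps)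
    then interpret strict_markov_functor "Fm G" "Fm H" "refinement \<phi>"
      using strict_markov_functor_refinement by blast
    show "refinement \<phi> \<in> hom MarCat (Fm G) (Fm H)"
      using Src Tgt markov_functor_axioms by (simp add: hom_def)
    assume \<psi>': "\<psi> \<in> hom FinODAG G K"
    then have \<psi>: "odag_mor \<psi>" "osrc \<psi> = G" "otgt \<psi> = K" by (auto simp: hom_def FinODAG_simps)
    have "odag_mor (Cmp FinODAG \<psi> \<phi>)"
      using O.Cmp_in[OF \<open>\<phi> \<in> hom FinODAG H G\<close> \<psi>'] by (simp add: hom_def FinODAG_simps)
    moreover have "refines (Cmp FinODAG \<psi> \<phi>) (Cmp MarCat (refinement \<phi>) (refinement \<psi>))"
      using \<phi> \<psi> by (intro refines_Cmp refines_refinement) simp_all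
    ultimately show "refinement (Cmp FinODAG \<psi> \<phi>) = Cmp MarCat (refinement \<phi>) (refinement \<psi>)"
      using refines_unique refines_refinement by blast
  qed
  show "is_refinement \<phi> (refinement \<phi>)" if "\<phi> \<in> Arr FinODAG" for \<phi> :: "'v odag_mor"
    using that refines_refinement refines_unique unfolding is_refinement_def FinODAG_simps by blast
qed

end
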